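(* Let $\mathscr{A}$ be a proper abelian subcategory of a Krull--Schmidt triangulated category $\mathscr{C}$, let $n \geqslant 4$ be an integer or $\infty$, and assume that $\mathscr{A}$ satisfies condition $E_n$. Then there are order preserving, mutually inverse bijections \[ \Phi : \mathsf{TorsPair}(\mathscr{A}) \longrightarrow [\mathscr{A},\Sigma\mathscr{A}]_{n-1}, \qquad \Psi : [\mathscr{A},\Sigma\mathscr{A}]_{n-1} \longrightarrow \mathsf{TorsPair}(\mathscr{A}) \] given by \[ \Phi(\mathscr{T},\mathscr{F}) = \Sigma\mathscr{F} * \mathscr{T}, \qquad \Psi(\mathscr{B}) = (\mathscr{A} \cap \mathscr{B},\ \mathscr{A} \cap \Sigma^{-1}\mathscr{B}), \] where $\mathsf{TorsPair}(\mathscr{A})$ carries the partial order $\sqsubseteq$ and $[\mathscr{A},\Sigma\mathscr{A}]_{n-1}$ carries the partial order $\preccurlyeq$.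
   Context: $\Sigma$ denotes the suspension functor of a triangulated category $\mathscr{C}$. An additive subcategory is a full subcategory closed under isomorphisms, direct sums, and direct summands. A short triangle is a diagram $c' \xrightarrow{\gamma'} c \xrightarrow{\gamma} c''$ in $\mathscr{C}$ for which there is a triangle $c' \xrightarrow{\gamma'} c \xrightarrow{\gamma} c'' \xrightarrow{\gamma''} \Sigma c'$. For full subcategories $\mathscr{X},\mathscr{Y} \subseteq \mathscr{C}$, $\mathscr{X} * \mathscr{Y}$ is the full subcategory of those $e \in \mathscr{C}$ for which there is a short triangle $x \to e \to y$ with $x \in \mathscr{X}$, $y \in \mathscr{Y}$. $\mathscr{X}$ is extension closed if $\mathscr{X} * \mathscr{X} \subseteq \mathscr{X}$. Proper abelian subcategory: an additive, extension closed subcategory $\mathscr{A}$ of $\mathscr{C}$ which is abelian and satisfies that $0 \to a' \xrightarrow{\alpha'} a \xrightarrow{\alpha} a'' \to 0$ is a short exact sequence in $\mathscr{A}$ if and only if $a',a,a''$ are in $\mathscr{A}$ and there is a triangle $a' \xrightarrow{\alpha'} a \xrightarrow{\alpha} a'' \to \Sigma a'$ in $\mathscr{C}$. Condition $E_n$ ($n \geqslant 1$ an integer or $\infty$): a full subcategory $\mathscr{X} \subseteq \mathscr{C}$ satisfies $E_n$ if $\mathscr{C}(\mathscr{X},\Sigma^i\mathscr{X}) = 0$ for all integers $i$ with $-n-1 < i < 0$. By convention $\infty - 1 = \infty$. For $m \geqslant 1$ an integer or $\infty$, the $E_m$-interval $[\mathscr{A},\Sigma\mathscr{A}]_m$ is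 the class of proper abelian subcategories $\mathscr{B} \subseteq \mathscr{C}$ satisfying $E_m$ such that $\mathscr{A} \subseteq \mathscr{B} * \Sigma^{-1}\mathscr{B}$ and $\mathscr{B} \subseteq \Sigma\mathscr{A} * \mathscr{A}$. For $\mathscr{B}',\mathscr{B} \in [\mathscr{A},\Sigma\mathscr{A}]_m$, write $\mathscr{B}' \preccurlyeq \mathscr{B}$ if $\mathscr{B}' \subseteq \mathscr{B} * \Sigma^{-1}\mathscr{B}$ and $\mathscr{B} \subseteq \Sigma\mathscr{B}' * \mathscr{B}'$. $\mathsf{TorsPair}(\mathscr{A})$ is the class of torsion pairs in the abelian category $\mathscr{A}$, i.e. pairs $(\mathscr{T},\mathscr{F})$ of full subcategories of $\mathscr{A}$ closed under isomorphism such that every morphism from an object of $\mathscr{T}$ to an object of $\mathscr{F}$ is zero and each $a \in \mathscr{A}$ permits a short exact sequence $0 \to t \to a \to f \to 0$ in $\mathscr{A}$ with $t \in \mathscr{T}$, $f \in \mathscr{F}$. The partial order is $(\mathscr{T}',\mathscr{F}') \sqsubseteq (\mathscr{T},\mathscr{F})$ if and only if $\mathscr{F}' \subseteq \mathscr{F}$. *)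

theory Defs
  imports "HOL-Algebra.Ring" "HOL-Library.Extended_Nat"
begin

section \<open>Categories\<close>

record ('o, 'm) cat =
  Obj :: "'o set"
  Arr :: "'m set"
  Dom :: "'m \<Rightarrow> 'o"
  Cod :: "'m \<Rightarrow> 'o"
  Idt :: "'o \<Rightarrow> 'm"
  Cmp :: "'m \<Rightarrow> 'm \<Rightarrow> 'm" (infixr \<open>\<bullet>\<index>\<close> 70)

definition Hom :: "('o, 'm, 'z) cat_scheme \<Rightarrow> 'o \<Rightarrow> 'o \<Rightarrow> 'm set" where
  "Hom C x y = {f \<in> Arr C. Dom C f = x \<and> Cod C f = y}"

locale category =
  fixes C :: "('o, 'm, 'z) cat_scheme" (structure)
  assumes Dom_in: "f \<in> Arr C \<Longrightarrow> Dom C f \<in> Obj C"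
    and Cod_in: "f \<in> Arr C \<Longrightarrow> Cod C f \<in> Obj C"
    and Idt_in: "x \<in> Obj C \<Longrightarrow> Idt C x \<in> Hom C x x"
    and Cmp_in: "\<lbrakk>f \<in> Hom C x y; g \<in> Hom C y z\<rbrakk> \<Longrightarrow> g \<bullet> f \<in> Hom C x z"
    and Cmp_Idt: "f \<in> Hom C x y \<Longrightarrow> f \<bullet> Idt C x = f"
    and Idt_Cmp: "f \<in> Hom C x y \<Longrightarrow> Idt C y \<bullet> f = f"
    and Cmp_assoc:
      "\<lbrakk>f \<in> Hom C w x; g \<in> Hom C x y; h \<in> Hom C y z\<rbrakk> \<Longrightarrow> (h \<bullet> g) \<bullet> f = h \<bullet> (g \<bullet> f)"

definition iso_arr :: "('o, 'm, 'z) cat_scheme \<Rightarrow> 'm \<Rightarrow> bool" where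
  "iso_arr C f \<longleftrightarrow> f \<in> Arr C \<and>
     (\<exists>g \<in> Hom C (Cod C f) (Dom C f).
        g \<bullet>\<^bsub>C\<^esub> f = Idt C (Dom C f) \<and> f \<bullet>\<^bsub>C\<^esub> g = Idt C (Cod C f))"

definition isomorphic :: "('o, 'm, 'z) cat_scheme \<Rightarrow> 'o \<Rightarrow> 'o \<Rightarrow> bool" where
  "isomorphic C x y \<longleftrightarrow> (\<exists>f \<in> Hom C x y. iso_arr C f)"

definition mono_arr :: "('o, 'm, 'z) cat_scheme \<Rightarrow> 'm \<Rightarrow> bool" where
  "mono_arr C f \<longleftrightarrow> f \<in> Arr C \<and>
     (\<forall>w. \<forall>s \<in> Hom C w (Dom C f). \<forall>t \<in> Hom C w (Dom C f). f \<bullet>\<^bsub>C\<^esub> s = f \<bullet>\<^bsub>C\<^esub> t \<longrightarrow> s = t)"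

definition epi_arr :: "('o, 'm, 'z) cat_scheme \<Rightarrow> 'm \<Rightarrow> bool" where
  "epi_arr C f \<longleftrightarrow> f \<in> Arr C \<and>
     (\<forall>w. \<forall>s \<in> Hom C (Cod C f) w. \<forall>t \<in> Hom C (Cod C f) w. s \<bullet>\<^bsub>C\<^esub> f = t \<bullet>\<^bsub>C\<^esub> f \<longrightarrow> s = t)"

definition zero_obj :: "('o, 'm, 'z) cat_scheme \<Rightarrow> 'o \<Rightarrow> bool" where
  "zero_obj C z \<longleftrightarrow> z \<in> Obj C \<and>
     (\<forall>x \<in> Obj C. (\<exists>!f. f \<in> Hom C z x) \<and> (\<exists>!f. f \<in> Hom C x z))"

text \<open>
  A full subcategory is represented by its set of objects; \<open>full_sub\<close> turns such a set into
  a category.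
\<close>

definition full_sub :: "('o, 'm, 'z) cat_scheme \<Rightarrow> 'o set \<Rightarrow> ('o, 'm, 'z) cat_scheme" where
  "full_sub C X = C\<lparr>Obj := X, Arr := {f \<in> Arr C. Dom C f \<in> X \<and> Cod C f \<in> X}\<rparr>"

definition iso_closed :: "('o, 'm, 'z) cat_scheme \<Rightarrow> 'o set \<Rightarrow> bool" where
  "iso_closed C X \<longleftrightarrow> (\<forall>x \<in> X. \<forall>y \<in> Obj C. isomorphic C x y \<longrightarrow> y \<in> X)"


section \<open>Additive and abelian categories\<close>

record ('o, 'm) addcat = "('o, 'm) cat" +
  Zer :: "'o \<Rightarrow> 'o \<Rightarrow> 'm"
  Add :: "'m \<Rightarrow> 'm \<Rightarrow> 'm"

definition hom_group :: "('o, 'm, 'z) addcat_scheme \<Rightarrow> 'o \<Rightarrow> 'o \<Rightarrow> 'm monoid" where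
  "hom_group C x y = \<lparr>carrier = Hom C x y, mult = Add C, one = Zer C x y\<rparr>"

definition Neg :: "('o, 'm, 'z) addcat_scheme \<Rightarrow> 'm \<Rightarrow> 'm" where
  "Neg C f = inv\<^bsub>hom_group C (Dom C f) (Cod C f)\<^esub> f"

locale preadditive_category = category C for C :: "('o, 'm, 'z) addcat_scheme" (structure) +
  assumes hom_comm_group: "\<lbrakk>x \<in> Obj C; y \<in> Obj C\<rbrakk> \<Longrightarrow> comm_group (hom_group C x y)"
    and Cmp_Add_left:
      "\<lbrakk>f \<in> Hom C x y; g \<in> Hom C y z; g' \<in> Hom C y z\<rbrakk>
        \<Longrightarrow> Add C g g' \<bullet> f = Add C (g \<bullet> f) (g' \<bullet> f)"
    and Cmp_Add_right:
      "\<lbrakk>f \<in> Hom C x y; f' \<in> Hom C x y; g \<in> Hom C y z\<rbrakk>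
        \<Longrightarrow> g \<bullet> Add C f f' = Add C (g \<bullet> f) (g \<bullet> f')"

definition direct_sum :: "('o, 'm, 'z) addcat_scheme \<Rightarrow> 'o \<Rightarrow> 'o \<Rightarrow> 'o \<Rightarrow> bool" where
  "direct_sum C x y s \<longleftrightarrow> x \<in> Obj C \<and> y \<in> Obj C \<and> s \<in> Obj C \<and>
     (\<exists>i \<in> Hom C x s. \<exists>j \<in> Hom C y s. \<exists>p \<in> Hom C s x. \<exists>q \<in> Hom C s y.
        p \<bullet>\<^bsub>C\<^esub> i = Idt C x \<and> q \<bullet>\<^bsub>C\<^esub> j = Idt C y \<and>
        p \<bullet>\<^bsub>C\<^esub> j = Zer C y x \<and> q \<bullet>\<^bsub>C\<^esub> i = Zer C x y \<and>
        Add C (i \<bullet>\<^bsub>C\<^esub> p) (j \<bullet>\<^bsub>C\<^esub> q) = Idt C s)"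

locale additive_category = preadditive_category C
  for C :: "('o, 'm, 'z) addcat_scheme" (structure) +
  assumes ex_zero_obj: "\<exists>z. zero_obj C z"
    and ex_direct_sum: "\<lbrakk>x \<in> Obj C; y \<in> Obj C\<rbrakk> \<Longrightarrow> \<exists>s. direct_sum C x y s"

definition is_kernel :: "('o, 'm, 'z) addcat_scheme \<Rightarrow> 'm \<Rightarrow> 'm \<Rightarrow> bool" where
  "is_kernel C k f \<longleftrightarrow> k \<in> Arr C \<and> f \<in> Arr C \<and> Cod C k = Dom C f \<and>
     f \<bullet>\<^bsub>C\<^esub> k = Zer C (Dom C k) (Cod C f) \<and>
     (\<forall>w. \<forall>t \<in> Hom C w (Dom C f). f \<bullet>\<^bsub>C\<^esub> t = Zer C w (Cod C f) \<longrightarrow>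
        (\<exists>!s. s \<in> Hom C w (Dom C k) \<and> k \<bullet>\<^bsub>C\<^esub> s = t))"

definition is_cokernel :: "('o, 'm, 'z) addcat_scheme \<Rightarrow> 'm \<Rightarrow> 'm \<Rightarrow> bool" where
  "is_cokernel C c f \<longleftrightarrow> c \<in> Arr C \<and> f \<in> Arr C \<and> Dom C c = Cod C f \<and>
     c \<bullet>\<^bsub>C\<^esub> f = Zer C (Dom C f) (Cod C c) \<and>
     (\<forall>w. \<forall>t \<in> Hom C (Cod C f) w. t \<bullet>\<^bsub>C\<^esub> f = Zer C (Dom C f) w \<longrightarrow>
        (\<exists>!s. s \<in> Hom C (Cod C c) w \<and> s \<bullet>\<^bsub>C\<^esub> c = t))"

locale abelian_category = additive_category C
  for C :: "('o, 'm, 'z) addcat_scheme" (structure) +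
  assumes ex_kernel: "f \<in> Arr C \<Longrightarrow> \<exists>k. is_kernel C k f"
    and ex_cokernel: "f \<in> Arr C \<Longrightarrow> \<exists>c. is_cokernel C c f"
    and mono_is_kernel: "mono_arr C f \<Longrightarrow> \<exists>g. is_kernel C f g"
    and epi_is_cokernel: "epi_arr C f \<Longrightarrow> \<exists>g. is_cokernel C f g"

text \<open>\<open>0 \<rightarrow> x \<rightarrow> y \<rightarrow> z \<rightarrow> 0\<close> with maps \<open>f\<close> and \<open>g\<close> is short exact:\<close>

definition short_exact :: "('o, 'm, 'z) addcat_scheme \<Rightarrow> 'm \<Rightarrow> 'm \<Rightarrow> bool" where
  "short_exact C f g \<longleftrightarrow> is_kernel C f g \<and> is_cokernel C g f"

definition torsion_pairs :: "('o, 'm, 'z) addcat_scheme \<Rightarrow> ('o set \<times> 'o set) set" where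
  "torsion_pairs C = {(T, F).
     T \<subseteq> Obj C \<and> F \<subseteq> Obj C \<and> iso_closed C T \<and> iso_closed C F \<and>
     (\<forall>t \<in> T. \<forall>f \<in> F. Hom C t f = {Zer C t f}) \<and>
     (\<forall>a \<in> Obj C. \<exists>t \<in> T. \<exists>f \<in> F. \<exists>u \<in> Hom C t a. \<exists>v \<in> Hom C a f. short_exact C u v)}"

definition tors_le :: "'o set \<times> 'o set \<Rightarrow> 'o set \<times> 'o set \<Rightarrow> bool" where
  "tors_le p' p \<longleftrightarrow> snd p' \<subseteq> snd p"


section \<open>Krull--Schmidt categories\<close>

definition End_ring :: "('o, 'm, 'z) addcat_scheme \<Rightarrow> 'o \<Rightarrow> 'm ring" where
  "End_ring C x =
     \<lparr>carrier = Hom C x x, mult = Cmp C, one = Idt C x, zero = Zer C x x, add = Add C\<rparr>"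

text \<open>Not necessarily commutative local rings: nonzero, and the nonunits are closed under addition.\<close>

definition local_ring :: "('a, 'b) ring_scheme \<Rightarrow> bool" where
  "local_ring R \<longleftrightarrow> ring R \<and> \<one>\<^bsub>R\<^esub> \<noteq> \<zero>\<^bsub>R\<^esub> \<and>
     (\<forall>a \<in> carrier R - Units R. \<forall>b \<in> carrier R - Units R. a \<oplus>\<^bsub>R\<^esub> b \<notin> Units R)"

inductive_set finite_direct_sums :: "('o, 'm, 'z) addcat_scheme \<Rightarrow> 'o set \<Rightarrow> 'o set"
  for C :: "('o, 'm, 'z) addcat_scheme" and X :: "'o set" where
  empty_sum: "zero_obj C z \<Longrightarrow> z \<in> finite_direct_sums C X"
| add_summand: "\<lbrakk>x \<in> X; y \<in> finite_direct_sums C X; direct_sum C x y s\<rbrakk>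
    \<Longrightarrow> s \<in> finite_direct_sums C X"

locale krull_schmidt_category = additive_category C
  for C :: "('o, 'm, 'z) addcat_scheme" (structure) +
  assumes krull_schmidt:
    "x \<in> Obj C \<Longrightarrow> x \<in> finite_direct_sums C {y \<in> Obj C. local_ring (End_ring C y)}"


section \<open>Triangulated categories\<close>

record ('o, 'm) tricat = "('o, 'm) addcat" +
  SigO :: "'o \<Rightarrow> 'o"
  SigA :: "'m \<Rightarrow> 'm"
  Tri :: "('m \<times> 'm \<times> 'm) set"

text \<open>Diagrams \<open>x \<rightarrow> y \<rightarrow> z \<rightarrow> \<Sigma>x\<close>, with no exactness condition:\<close>

definition candidate :: "('o, 'm, 'z) tricat_scheme \<Rightarrow> 'm \<Rightarrow> 'm \<Rightarrow> 'm \<Rightarrow> bool" where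
  "candidate C f g h \<longleftrightarrow> f \<in> Arr C \<and> g \<in> Arr C \<and> h \<in> Arr C \<and>
     Cod C f = Dom C g \<and> Cod C g = Dom C h \<and> Cod C h = SigO C (Dom C f)"

text \<open>
  The suspension is only required to be an additive autoequivalence, not an automorphism.
  The axiom \<open>octahedron\<close> uses triangles
  \<open>x -f\<rightarrow> y -a\<rightarrow> z' -b\<rightarrow> \<Sigma>x\<close>, \<open>y -g\<rightarrow> z -c\<rightarrow> x' -d\<rightarrow> \<Sigma>y\<close> and \<open>x -gf\<rightarrow> z -p\<rightarrow> y' -q\<rightarrow> \<Sigma>x\<close>.
\<close>

locale triangulated_category = additive_category C
  for C :: "('o, 'm, 'z) tricat_scheme" (structure) +
  assumes SigO_in: "x \<in> Obj C \<Longrightarrow> SigO C x \<in> Obj C"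
    and SigA_Idt: "x \<in> Obj C \<Longrightarrow> SigA C (Idt C x) = Idt C (SigO C x)"
    and SigA_Cmp:
      "\<lbrakk>f \<in> Hom C x y; g \<in> Hom C y z\<rbrakk> \<Longrightarrow> SigA C (g \<bullet> f) = SigA C g \<bullet> SigA C f"
    and SigA_Add:
      "\<lbrakk>f \<in> Hom C x y; f' \<in> Hom C x y\<rbrakk> \<Longrightarrow> SigA C (Add C f f') = Add C (SigA C f) (SigA C f')"
    and SigA_bij:
      "\<lbrakk>x \<in> Obj C; y \<in> Obj C\<rbrakk> \<Longrightarrow> bij_betw (SigA C) (Hom C x y) (Hom C (SigO C x) (SigO C y))"
    and SigO_ess_surj: "y \<in> Obj C \<Longrightarrow> \<exists>x \<in> Obj C. isomorphic C (SigO C x) y"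
    and Tri_candidate: "(f, g, h) \<in> Tri C \<Longrightarrow> candidate C f g h"
    and Tri_iso:
      "\<lbrakk>(f, g, h) \<in> Tri C; candidate C f' g' h';
        u \<in> Hom C (Dom C f) (Dom C f'); v \<in> Hom C (Dom C g) (Dom C g');
        w \<in> Hom C (Dom C h) (Dom C h'); iso_arr C u; iso_arr C v; iso_arr C w;
        v \<bullet> f = f' \<bullet> u; w \<bullet> g = g' \<bullet> v; SigA C u \<bullet> h = h' \<bullet> w\<rbrakk>
        \<Longrightarrow> (f', g', h') \<in> Tri C"
    and Tri_Idt:
      "\<lbrakk>x \<in> Obj C; zero_obj C z\<rbrakk> \<Longrightarrow> (Idt C x, Zer C x z, Zer C z (SigO C x)) \<in> Tri C"
    and Tri_cone: "f \<in> Arr C \<Longrightarrow> \<exists>g h. (f, g, h) \<in> Tri C"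
    and Tri_rotate:
      "candidate C f g h \<Longrightarrow> (f, g, h) \<in> Tri C \<longleftrightarrow> (g, h, Neg C (SigA C f)) \<in> Tri C"
    and Tri_fill:
      "\<lbrakk>(f, g, h) \<in> Tri C; (f', g', h') \<in> Tri C;
        u \<in> Hom C (Dom C f) (Dom C f'); v \<in> Hom C (Dom C g) (Dom C g'); v \<bullet> f = f' \<bullet> u\<rbrakk>
        \<Longrightarrow> \<exists>w \<in> Hom C (Dom C h) (Dom C h'). w \<bullet> g = g' \<bullet> v \<and> h' \<bullet> w = SigA C u \<bullet> h"
    and octahedron:
      "\<lbrakk>(f, a, b) \<in> Tri C; (g, c, d) \<in> Tri C; Cod C f = Dom C g; (g \<bullet> f, p, q) \<in> Tri C\<rbrakk>
        \<Longrightarrow> \<exists>r \<in> Hom C (Cod C a) (Cod C p). \<exists>s \<in> Hom C (Cod C p) (Cod C c).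
              (r, s, SigA C a \<bullet> d) \<in> Tri C \<and>
              r \<bullet> a = p \<bullet> g \<and> q \<bullet> r = b \<and> s \<bullet> p = c \<and> d \<bullet> s = SigA C f \<bullet> q"

definition short_triangle :: "('o, 'm, 'z) tricat_scheme \<Rightarrow> 'm \<Rightarrow> 'm \<Rightarrow> bool" where
  "short_triangle C f g \<longleftrightarrow> (\<exists>h. (f, g, h) \<in> Tri C)"

text \<open>The operation \<open>X * Y\<close> on full subcategories:\<close>

definition ext_prod :: "('o, 'm, 'z) tricat_scheme \<Rightarrow> 'o set \<Rightarrow> 'o set \<Rightarrow> 'o set" where
  "ext_prod C X Y = {e \<in> Obj C. \<exists>x \<in> X. \<exists>y \<in> Y. \<exists>f \<in> Hom C x e. \<exists>g \<in> Hom C e y.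
     short_triangle C f g}"

text \<open>
  The full subcategory \<open>\<Sigma>\<^sup>i X\<close>, closed under isomorphism. As the suspension need not be invertible
  on the nose, a negative power is described by \<open>c \<in> \<Sigma>\<^sup>-\<^sup>k X\<close> iff \<open>\<Sigma>\<^sup>k c \<cong> x\<close> for some \<open>x \<in> X\<close>;
  in the formula one of the two exponents is \<open>0\<close>.
\<close>

definition shift :: "('o, 'm, 'z) tricat_scheme \<Rightarrow> int \<Rightarrow> 'o set \<Rightarrow> 'o set" where
  "shift C i X = {c \<in> Obj C. \<exists>x \<in> X.
     isomorphic C ((SigO C ^^ nat (- i)) c) ((SigO C ^^ nat i) x)}"

definition additive_subcategory :: "('o, 'm, 'z) addcat_scheme \<Rightarrow> 'o set \<Rightarrow> bool" where
  "additive_subcategory C X \<longleftrightarrow> X \<subseteq> Obj C \<and> iso_closed C X \<and>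
     (\<forall>z. zero_obj C z \<longrightarrow> z \<in> X) \<and>
     (\<forall>x y s. direct_sum C x y s \<longrightarrow> (s \<in> X \<longleftrightarrow> x \<in> X \<and> y \<in> X))"

definition extension_closed :: "('o, 'm, 'z) tricat_scheme \<Rightarrow> 'o set \<Rightarrow> bool" where
  "extension_closed C X \<longleftrightarrow> ext_prod C X X \<subseteq> X"

definition proper_abelian :: "('o, 'm, 'z) tricat_scheme \<Rightarrow> 'o set \<Rightarrow> bool" where
  "proper_abelian C A \<longleftrightarrow>
     additive_subcategory C A \<and> extension_closed C A \<and> abelian_category (full_sub C A) \<and>
     (\<forall>f g. short_exact (full_sub C A) f g \<longleftrightarrow>
        Dom C f \<in> A \<and> Cod C f \<in> A \<and> Cod C g \<in> A \<and> short_triangle C f g)"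

text \<open>\<open>E_cond C n X\<close>: \<open>C(X, \<Sigma>\<^sup>i X) = 0\<close> for all \<open>i\<close> with \<open>-n-1 < i < 0\<close>.\<close>

definition E_cond :: "('o, 'm, 'z) tricat_scheme \<Rightarrow> enat \<Rightarrow> 'o set \<Rightarrow> bool" where
  "E_cond C n X \<longleftrightarrow>
     (\<forall>i :: int. i < 0 \<and> enat (nat (- i)) < n + 1 \<longrightarrow>
        (\<forall>x \<in> X. \<forall>y \<in> shift C i X. Hom C x y = {Zer C x y}))"

definition E_interval :: "('o, 'm, 'z) tricat_scheme \<Rightarrow> enat \<Rightarrow> 'o set \<Rightarrow> 'o set set" where
  "E_interval C m A = {B. proper_abelian C B \<and> E_cond C m B \<and>
     A \<subseteq> ext_prod C B (shift C (- 1) B) \<and> B \<subseteq> ext_prod C (shift C 1 A) A}"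

definition interval_le :: "('o, 'm, 'z) tricat_scheme \<Rightarrow> 'o set \<Rightarrow> 'o set \<Rightarrow> bool" where
  "interval_le C B' B \<longleftrightarrow>
     B' \<subseteq> ext_prod C B (shift C (- 1) B) \<and> B \<subseteq> ext_prod C (shift C 1 B') B'"

end

theory Submission
  imports Defs
begin

text \<open>
  Everything reduces to the calculus of the associative operation \<open>*\<close> together with the vanishing of
  negative extensions. A full subcategory \<open>B\<close> with vanishing first and second negative extensions is
  proper abelian as soon as it is additive, extension closed and satisfies \<open>B * \<Sigma>B \<subseteq> \<Sigma>B * B\<close>
  (Beilinson--Bernstein--Deligne): the cone of a morphism in \<open>B\<close> lies in \<open>B * \<Sigma>B\<close>, and writing it as an
  extension of \<open>c \<in> B\<close> by \<open>\<Sigma>k\<close> with \<open>k \<in> B\<close> displays \<open>c\<close> as the cokernel and \<open>k\<close> as the kernel. For \<open>B = \<Sigma>F * T\<close> one has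
  \<open>B * \<Sigma>B = \<Sigma>F * T * \<Sigma>\<^sup>2F * \<Sigma>T \<subseteq> \<Sigma>F * \<Sigma>\<^sup>2F * T * \<Sigma>T \<subseteq> \<Sigma>\<^sup>2F * \<Sigma>A * \<Sigma>A * T \<subseteq> \<Sigma>\<^sup>2F * \<Sigma>A * T \<subseteq> \<Sigma>B * B\<close>,
  where the second inclusion takes kernels in \<open>F\<close> and cokernels in \<open>T\<close>. Closure under summands follows by
  lifting an idempotent along \<open>\<Sigma>F \<rightarrow> B \<rightarrow> T\<close> and splitting it in the abelian category \<open>A\<close>. Conversely,
  for \<open>B\<close> in the interval, the triangles witnessing \<open>A \<subseteq> B * \<Sigma>\<^sup>-\<^sup>1B\<close> have both ends in \<open>A\<close>, and those witnessing
  \<open>B \<subseteq> \<Sigma>A * A\<close> have both ends in \<open>B\<close>. The order on the interval is then transported from the one on torsion pairs.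
\<close>

section \<open>Arrows of a preadditive category\<close>

text \<open>The bounds come from counting degrees. Mapping \<Sigma>^k of
  \<open>sh F \<star> T\<close> back to itself meets C(\<Sigma>^(k+1) F, T), one degree beyond k;
  hence \<open>n - 1\<close> for the tilted category. Conversely \<open>B\<close> itself has to be
  decomposed along \<Sigma>A, and the obstruction is an arrow from \<Sigma>^3 B to an object known
  only to lie in \<Sigma>B * B. Killing it takes degrees two and three of \<open>B\<close>, so n - 1
  must be at least 3.

  The suspension is only an autoequivalence, so \<Sigma>^-1 is not an operation on objects.
  Vanishing conditions are therefore rewritten with positive shifts, and membership in
  \<open>shift C (- 1) X\<close>, for \<open>X\<close> closed under isomorphism, is read as
  membership of the suspension in \<open>X\<close>. The second obstacle is that fillers of morphisms
  of triangles are not unique: uniqueness is supplied by orthogonality, or circumvented by showing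
  that a filler is at least invertible.\<close>

lemma Hom_iff: "f \<in> Hom C x y \<longleftrightarrow> f \<in> Arr C \<and> Dom C f = x \<and> Cod C f = y"
  by (simp add: Hom_def)

context category
begin

lemma Obj_Dom [simp]: "f \<in> Arr C \<Longrightarrow> Dom C f \<in> Obj C"
  by (rule Dom_in)

lemma Obj_Cod [simp]: "f \<in> Arr C \<Longrightarrow> Cod C f \<in> Obj C"
  by (rule Cod_in)

lemma Idt_simps [simp]:
  assumes "x \<in> Obj C"
  shows "Idt C x \<in> Arr C" "Dom C (Idt C x) = x" "Cod C (Idt C x) = x"
  using Idt_in[OF assms] by (auto simp: Hom_iff)

lemma Cmp_simps [simp]:
  assumes "f \<in> Arr C" "g \<in> Arr C" "Cod C f = Dom C g"
  shows "g \<bullet> f \<in> Arr C" "Dom C (g \<bullet> f) = Dom C f" "Cod C (g \<bullet> f) = Cod C g"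
  using Cmp_in[of f "Dom C f" "Dom C g" g "Cod C g"] assms by (auto simp: Hom_iff)

lemma Cmp_Idt_simp [simp]: "f \<in> Arr C \<Longrightarrow> Dom C f = x \<Longrightarrow> f \<bullet> Idt C x = f"
  using Cmp_Idt[of f x "Cod C f"] by (auto simp: Hom_iff)

lemma Idt_Cmp_simp [simp]: "f \<in> Arr C \<Longrightarrow> Cod C f = y \<Longrightarrow> Idt C y \<bullet> f = f"
  using Idt_Cmp[of f "Dom C f" y] by (auto simp: Hom_iff)

lemma Cmp_assoc_simp [simp]:
  "\<lbrakk>f \<in> Arr C; g \<in> Arr C; h \<in> Arr C; Cod C f = Dom C g; Cod C g = Dom C h\<rbrakk>
    \<Longrightarrow> (h \<bullet> g) \<bullet> f = h \<bullet> (g \<bullet> f)"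
  using Cmp_assoc[of f "Dom C f" "Dom C g" g "Dom C h" h "Cod C h"] by (auto simp: Hom_iff)

text \<open>Simplification nests composites to the right, so an equation for
  \<open>g \<bullet> f\<close> no longer matches inside \<open>g \<bullet> (f \<bullet> s)\<close>;
  this is its form with a tail \<open>s\<close>.\<close>

lemma Cmp_eq_Cmp:
  "\<lbrakk>g \<bullet> f = k; f \<in> Arr C; g \<in> Arr C; Cod C f = Dom C g; s \<in> Arr C; Cod C s = Dom C f\<rbrakk>
    \<Longrightarrow> g \<bullet> (f \<bullet> s) = k \<bullet> s"
  using Cmp_assoc_simp[of s f g] by simp

lemma iso_arrE:
  assumes "iso_arr C f"
  obtains g where "f \<in> Arr C" "g \<in> Arr C" "Dom C g = Cod C f" "Cod C g = Dom C f"
    "g \<bullet> f = Idt C (Dom C f)" "f \<bullet> g = Idt C (Cod C f)"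
  using assms by (auto simp: iso_arr_def Hom_iff)

lemma iso_arrI:
  assumes "f \<in> Arr C" "g \<in> Arr C" "Dom C g = Cod C f" "Cod C g = Dom C f"
    "g \<bullet> f = Idt C (Dom C f)" "f \<bullet> g = Idt C (Cod C f)"
  shows "iso_arr C f"
  using assms by (auto simp: iso_arr_def Hom_iff)

lemma iso_arr_Idt [simp]: "x \<in> Obj C \<Longrightarrow> iso_arr C (Idt C x)"
  by (rule iso_arrI[where g = "Idt C x"]) auto

lemma isomorphicE:
  assumes "isomorphic C x y"
  obtains f g where "f \<in> Arr C" "Dom C f = x" "Cod C f = y"
    "g \<in> Arr C" "Dom C g = y" "Cod C g = x" "g \<bullet> f = Idt C x" "f \<bullet> g = Idt C y"
    "iso_arr C f" "iso_arr C g"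
proof -
  obtain f where f: "f \<in> Arr C" "Dom C f = x" "Cod C f = y" "iso_arr C f"
    using assms by (auto simp: isomorphic_def Hom_iff)
  obtain g where g: "g \<in> Arr C" "Dom C g = Cod C f" "Cod C g = Dom C f"
    "g \<bullet> f = Idt C (Dom C f)" "f \<bullet> g = Idt C (Cod C f)"
    using f(4) by (rule iso_arrE)
  have "iso_arr C g" by (rule iso_arrI[where g = f]) (use f g in auto)
  then show thesis using that f g by auto
qed

lemma isomorphicI:
  assumes "f \<in> Arr C" "Dom C f = x" "Cod C f = y" "g \<in> Arr C" "Dom C g = y" "Cod C g = x"
    "g \<bullet> f = Idt C x" "f \<bullet> g = Idt C y"
  shows "isomorphic C x y"
proof -
  have "iso_arr C f" by (rule iso_arrI[where g = g]) (use assms in auto)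
  then show ?thesis using assms by (auto simp: isomorphic_def Hom_iff)
qed

lemma isomorphic_refl [simp]: "x \<in> Obj C \<Longrightarrow> isomorphic C x x"
  by (rule isomorphicI[where f = "Idt C x" and g = "Idt C x"]) auto

lemma isomorphic_sym: "isomorphic C x y \<Longrightarrow> isomorphic C y x"
  by (erule isomorphicE) (rule isomorphicI)

lemma isomorphic_trans:
  assumes "isomorphic C x y" "isomorphic C y z"
  shows "isomorphic C x z"
proof -
  obtain f f' where f: "f \<in> Arr C" "Dom C f = x" "Cod C f = y"
    "f' \<in> Arr C" "Dom C f' = y" "Cod C f' = x" "f' \<bullet> f = Idt C x" "f \<bullet> f' = Idt C y"
    using assms(1) by (rule isomorphicE)
  obtain g g' where g: "g \<in> Arr C" "Dom C g = y" "Cod C g = z"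
    "g' \<in> Arr C" "Dom C g' = z" "Cod C g' = y" "g' \<bullet> g = Idt C y" "g \<bullet> g' = Idt C z"
    using assms(2) by (rule isomorphicE)
  show ?thesis
    by (rule isomorphicI[where f = "g \<bullet> f" and g = "f' \<bullet> g'"])
      (use f g Cmp_eq_Cmp[OF g(7), of f] Cmp_eq_Cmp[OF f(8), of g'] in auto)
qed

lemma isomorphic_Obj: "isomorphic C x y \<Longrightarrow> x \<in> Obj C \<and> y \<in> Obj C"
  by (auto elim!: isomorphicE)

end

section \<open>Retracts\<close>

definition retract :: "('o, 'm, 'z) cat_scheme \<Rightarrow> 'o \<Rightarrow> 'o \<Rightarrow> bool" where
  "retract C x y \<longleftrightarrow> (\<exists>s \<in> Hom C x y. \<exists>r \<in> Hom C y x. r \<bullet>\<^bsub>C\<^esub> s = Idt C x)"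

text \<open>Isomorphic objects are retracts of each other and, in a triangulated category, retracts
  are direct summands; so this one condition covers closure under isomorphisms and under
  summands.\<close>

definition retract_closed :: "('o, 'm, 'z) cat_scheme \<Rightarrow> 'o set \<Rightarrow> bool" where
  "retract_closed C X \<longleftrightarrow> X \<subseteq> Obj C \<and> (\<forall>y \<in> X. \<forall>x. retract C x y \<longrightarrow> x \<in> X)"

lemma retractI:
  "\<lbrakk>s \<in> Arr C; Dom C s = x; Cod C s = y; r \<in> Arr C; Dom C r = y; Cod C r = x; r \<bullet>\<^bsub>C\<^esub> s = Idt C x\<rbrakk>
    \<Longrightarrow> retract C x y"
  unfolding retract_def by (intro bexI[of _ s] bexI[of _ r]) (simp_all add: Hom_iff)

lemma retract_closedD: "retract_closed C X \<Longrightarrow> retract C x y \<Longrightarrow> y \<in> X \<Longrightarrow> x \<in> X"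
  by (auto simp: retract_closed_def)

lemma isomorphic_retract: "isomorphic C x y \<Longrightarrow> retract C x y"
  by (auto simp: isomorphic_def iso_arr_def Hom_iff intro: retractI)

lemma (in category) retract_closed_iso_closed: "retract_closed C X \<Longrightarrow> iso_closed C X"
  unfolding iso_closed_def retract_closed_def by (blast intro: isomorphic_sym isomorphic_retract)

context preadditive_category
begin

lemma hom_group_simps [simp]:
  "carrier (hom_group C x y) = Hom C x y" "mult (hom_group C x y) = Add C"
  "one (hom_group C x y) = Zer C x y"
  by (simp_all add: hom_group_def)

lemma Zer_simps [simp]:
  assumes "x \<in> Obj C" "y \<in> Obj C"
  shows "Zer C x y \<in> Arr C" "Dom C (Zer C x y) = x" "Cod C (Zer C x y) = y"
proof -
  interpret G: comm_group "hom_group C x y" using assms by (rule hom_comm_group)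
  have "Zer C x y \<in> Hom C x y" using G.one_closed by simp
  then show "Zer C x y \<in> Arr C" "Dom C (Zer C x y) = x" "Cod C (Zer C x y) = y"
    by (auto simp: Hom_iff)
qed

lemma Add_simps [simp]:
  assumes "f \<in> Arr C" "g \<in> Arr C" "Dom C f = Dom C g" "Cod C f = Cod C g"
  shows "Add C f g \<in> Arr C" "Dom C (Add C f g) = Dom C g" "Cod C (Add C f g) = Cod C g"
proof -
  interpret G: comm_group "hom_group C (Dom C g) (Cod C g)"
    using assms by (intro hom_comm_group) auto
  have "Add C f g \<in> Hom C (Dom C g) (Cod C g)"
    using G.m_closed[of f g] assms by (simp add: Hom_iff)
  then show "Add C f g \<in> Arr C" "Dom C (Add C f g) = Dom C g" "Cod C (Add C f g) = Cod C g"
    by (auto simp: Hom_iff)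
qed

lemma Neg_simps [simp]:
  assumes "f \<in> Arr C"
  shows "Neg C f \<in> Arr C" "Dom C (Neg C f) = Dom C f" "Cod C (Neg C f) = Cod C f"
proof -
  interpret G: comm_group "hom_group C (Dom C f) (Cod C f)"
    using assms by (intro hom_comm_group) auto
  have "Neg C f \<in> Hom C (Dom C f) (Cod C f)"
    using G.inv_closed[of f] assms by (simp add: Hom_iff Neg_def)
  then show "Neg C f \<in> Arr C" "Dom C (Neg C f) = Dom C f" "Cod C (Neg C f) = Cod C f"
    by (auto simp: Hom_iff)
qed

lemma Add_Zer [simp]: "f \<in> Arr C \<Longrightarrow> Dom C f = x \<Longrightarrow> Cod C f = y \<Longrightarrow> Add C f (Zer C x y) = f"
proof -
  assume f: "f \<in> Arr C" "Dom C f = x" "Cod C f = y"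
  interpret G: comm_group "hom_group C x y" using f by (intro hom_comm_group) auto
  show ?thesis using G.r_one[of f] f by (simp add: Hom_iff)
qed

lemma Zer_Add [simp]: "f \<in> Arr C \<Longrightarrow> Dom C f = x \<Longrightarrow> Cod C f = y \<Longrightarrow> Add C (Zer C x y) f = f"
proof -
  assume f: "f \<in> Arr C" "Dom C f = x" "Cod C f = y"
  interpret G: comm_group "hom_group C x y" using f by (intro hom_comm_group) auto
  show ?thesis using G.l_one[of f] f by (simp add: Hom_iff)
qed

lemma Add_Neg [simp]: "f \<in> Arr C \<Longrightarrow> Add C f (Neg C f) = Zer C (Dom C f) (Cod C f)"
proof -
  assume f: "f \<in> Arr C"
  interpret G: comm_group "hom_group C (Dom C f) (Cod C f)"
    using f by (intro hom_comm_group) auto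
  show ?thesis using G.r_inv[of f] f by (simp add: Hom_iff Neg_def)
qed

lemma Neg_Add [simp]: "f \<in> Arr C \<Longrightarrow> Add C (Neg C f) f = Zer C (Dom C f) (Cod C f)"
proof -
  assume f: "f \<in> Arr C"
  interpret G: comm_group "hom_group C (Dom C f) (Cod C f)"
    using f by (intro hom_comm_group) auto
  show ?thesis using G.l_inv[of f] f by (simp add: Hom_iff Neg_def)
qed

lemma Add_commute:
  "f \<in> Arr C \<Longrightarrow> g \<in> Arr C \<Longrightarrow> Dom C f = Dom C g \<Longrightarrow> Cod C f = Cod C g \<Longrightarrow> Add C f g = Add C g f"
proof -
  assume f: "f \<in> Arr C" "g \<in> Arr C" "Dom C f = Dom C g" "Cod C f = Cod C g"
  interpret G: comm_group "hom_group C (Dom C g) (Cod C g)"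
    using f by (intro hom_comm_group) auto
  show ?thesis using G.m_comm[of f g] f by (simp add: Hom_iff)
qed

lemma Add_assoc:
  "\<lbrakk>f \<in> Arr C; g \<in> Arr C; h \<in> Arr C; Dom C f = Dom C g; Cod C f = Cod C g;
    Dom C g = Dom C h; Cod C g = Cod C h\<rbrakk> \<Longrightarrow> Add C (Add C f g) h = Add C f (Add C g h)"
proof -
  assume f: "f \<in> Arr C" "g \<in> Arr C" "h \<in> Arr C" "Dom C f = Dom C g" "Cod C f = Cod C g"
    "Dom C g = Dom C h" "Cod C g = Cod C h"
  interpret G: comm_group "hom_group C (Dom C h) (Cod C h)"
    using f by (intro hom_comm_group) auto
  show ?thesis using G.m_assoc[of f g h] f by (simp add: Hom_iff)
qed

lemma Add_eq_Zer_iff: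
  assumes "f \<in> Arr C" "g \<in> Arr C" "Dom C f = Dom C g" "Cod C f = Cod C g"
  shows "Add C f g = Zer C (Dom C g) (Cod C g) \<longleftrightarrow> g = Neg C f"
proof
  assume *: "Add C f g = Zer C (Dom C g) (Cod C g)"
  have "Add C (Neg C f) (Add C f g) = g"
    using assms Add_assoc[of "Neg C f" f g] by simp
  then show "g = Neg C f" using * assms by simp
qed (use assms in auto)

lemma Neg_Neg [simp]: "f \<in> Arr C \<Longrightarrow> Neg C (Neg C f) = f"
  using Add_eq_Zer_iff[of "Neg C f" f] by simp

lemma Add_diff_cancel [simp]:
  assumes "f \<in> Arr C" "g \<in> Arr C" "Dom C f = Dom C g" "Cod C f = Cod C g"
  shows "Add C f (Add C (Neg C f) g) = g" "Add C (Neg C f) (Add C f g) = g"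
  using assms Add_assoc[of "Neg C f" f g] Add_assoc[of f "Neg C f" g] by simp_all

lemma diff_eq_Zer:
  assumes "Add C f (Neg C g) = Zer C x y"
    "f \<in> Arr C" "g \<in> Arr C" "Dom C f = x" "Dom C g = x" "Cod C f = y" "Cod C g = y"
  shows "f = g"
proof -
  have "Neg C g = Neg C f"
    using Add_eq_Zer_iff[of f "Neg C g"] assms by simp
  then show ?thesis using Neg_Neg[of f] Neg_Neg[of g] assms(2,3) by metis
qed

lemma Cmp_Add [simp]:
  "\<lbrakk>f \<in> Arr C; f' \<in> Arr C; g \<in> Arr C; Dom C f = Dom C f'; Cod C f = Cod C f'; Cod C f' = Dom C g\<rbrakk>
    \<Longrightarrow> g \<bullet> Add C f f' = Add C (g \<bullet> f) (g \<bullet> f')"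
  by (rule Cmp_Add_right[where x = "Dom C f'" and y = "Dom C g" and z = "Cod C g"])
    (auto simp: Hom_iff)

lemma Add_Cmp [simp]:
  "\<lbrakk>g \<in> Arr C; g' \<in> Arr C; f \<in> Arr C; Dom C g = Dom C g'; Cod C g = Cod C g'; Cod C f = Dom C g'\<rbrakk>
    \<Longrightarrow> Add C g g' \<bullet> f = Add C (g \<bullet> f) (g' \<bullet> f)"
  by (rule Cmp_Add_left[where x = "Dom C f" and y = "Dom C g'" and z = "Cod C g'"])
    (auto simp: Hom_iff)

lemma Add_self_eq:
  assumes "Add C f f = f" "f \<in> Arr C" shows "f = Zer C (Dom C f) (Cod C f)"
proof -
  have "f = Add C (Neg C f) (Add C f f)"
    using assms(2) Add_assoc[of "Neg C f" f f] by simp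
  then show ?thesis using assms by simp
qed

lemma Cmp_Zer [simp]:
  assumes "f \<in> Arr C" "x \<in> Obj C" "Dom C f = y"
  shows "f \<bullet> Zer C x y = Zer C x (Cod C f)"
proof -
  have "y \<in> Obj C" using assms by auto
  then have "f \<bullet> Zer C x y = Add C (f \<bullet> Zer C x y) (f \<bullet> Zer C x y)"
    using assms Cmp_Add[of "Zer C x y" "Zer C x y" f] by simp
  then show ?thesis using Add_self_eq[of "f \<bullet> Zer C x y"] assms \<open>y \<in> Obj C\<close> by simp
qed

lemma Zer_Cmp [simp]:
  assumes "f \<in> Arr C" "z \<in> Obj C" "Cod C f = y"
  shows "Zer C y z \<bullet> f = Zer C (Dom C f) z"
proof -
  have "y \<in> Obj C" using assms by auto
  then have "Zer C y z \<bullet> f = Add C (Zer C y z \<bullet> f) (Zer C y z \<bullet> f)"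
    using assms Add_Cmp[of "Zer C y z" "Zer C y z" f] by simp
  then show ?thesis using Add_self_eq[of "Zer C y z \<bullet> f"] assms \<open>y \<in> Obj C\<close> by simp
qed

lemma Cmp_Neg [simp]:
  assumes "f \<in> Arr C" "g \<in> Arr C" "Cod C f = Dom C g"
  shows "g \<bullet> Neg C f = Neg C (g \<bullet> f)"
  using Add_eq_Zer_iff[of "g \<bullet> f" "g \<bullet> Neg C f"] Cmp_Add[of f "Neg C f" g] assms by simp

lemma Neg_Cmp [simp]:
  assumes "f \<in> Arr C" "g \<in> Arr C" "Cod C f = Dom C g"
  shows "Neg C g \<bullet> f = Neg C (g \<bullet> f)"
  using Add_eq_Zer_iff[of "g \<bullet> f" "Neg C g \<bullet> f"] Add_Cmp[of g "Neg C g" f] assms by simp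

lemma Neg_Zer [simp]: "x \<in> Obj C \<Longrightarrow> y \<in> Obj C \<Longrightarrow> Neg C (Zer C x y) = Zer C x y"
  using Add_eq_Zer_iff[of "Zer C x y" "Zer C x y"] by simp

lemma Neg_eqD: "Neg C f = Neg C g \<Longrightarrow> f \<in> Arr C \<Longrightarrow> g \<in> Arr C \<Longrightarrow> f = g"
  by (metis Neg_Neg)

lemma Neg_eq_Zer_iff [simp]:
  "f \<in> Arr C \<Longrightarrow> Dom C f = x \<Longrightarrow> Cod C f = y \<Longrightarrow> Neg C f = Zer C x y \<longleftrightarrow> f = Zer C x y"
  by (metis Neg_Neg Neg_Zer Dom_in Cod_in)

text \<open>Every arrow into or out of \<open>z\<close> is a composite with \<open>Idt C z\<close>,
  so it vanishes with it. The right-hand side is an equation, hence passes at once to full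
  subcategories and along \<Sigma>.\<close>

lemma zero_obj_iff: "zero_obj C z \<longleftrightarrow> z \<in> Obj C \<and> Idt C z = Zer C z z"
proof (intro iffI conjI)
  assume z: "zero_obj C z"
  then show "z \<in> Obj C" by (simp add: zero_obj_def)
  moreover have "\<exists>!f. f \<in> Hom C z z" using z by (simp add: zero_obj_def)
  ultimately show "Idt C z = Zer C z z" by (auto simp: Hom_iff)
next
  assume z: "z \<in> Obj C \<and> Idt C z = Zer C z z"
  have "f = Zer C z x" if "f \<in> Hom C z x" for f x
    using that z Cmp_Idt_simp[of f z] by (auto simp: Hom_iff simp del: Cmp_Idt_simp)
  moreover have "f = Zer C x z" if "f \<in> Hom C x z" for f x
    using that z Idt_Cmp_simp[of f z] by (auto simp: Hom_iff simp del: Idt_Cmp_simp)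
  ultimately show "zero_obj C z"
    unfolding zero_obj_def using z by (metis Hom_iff Zer_simps)
qed

lemma zero_obj_Dom: "zero_obj C z \<Longrightarrow> f \<in> Arr C \<Longrightarrow> Dom C f = z \<Longrightarrow> f = Zer C z (Cod C f)"
  using Cmp_Idt_simp[of f z] by (auto simp: zero_obj_iff simp del: Cmp_Idt_simp)

lemma zero_obj_Cod: "zero_obj C z \<Longrightarrow> f \<in> Arr C \<Longrightarrow> Cod C f = z \<Longrightarrow> f = Zer C (Dom C f) z"
  using Idt_Cmp_simp[of f z] by (auto simp: zero_obj_iff simp del: Idt_Cmp_simp)

lemma direct_sumE:
  assumes "direct_sum C x y s"
  obtains i j p q where
    "i \<in> Arr C" "Dom C i = x" "Cod C i = s" "j \<in> Arr C" "Dom C j = y" "Cod C j = s"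
    "p \<in> Arr C" "Dom C p = s" "Cod C p = x" "q \<in> Arr C" "Dom C q = s" "Cod C q = y"
    "p \<bullet> i = Idt C x" "q \<bullet> j = Idt C y" "p \<bullet> j = Zer C y x" "q \<bullet> i = Zer C x y"
    "Add C (i \<bullet> p) (j \<bullet> q) = Idt C s"
  using assms unfolding direct_sum_def by (auto simp: Hom_iff)

lemma direct_sumI:
  assumes
    "i \<in> Arr C" "Dom C i = x" "Cod C i = s" "j \<in> Arr C" "Dom C j = y" "Cod C j = s"
    "p \<in> Arr C" "Dom C p = s" "Cod C p = x" "q \<in> Arr C" "Dom C q = s" "Cod C q = y"
    "p \<bullet> i = Idt C x" "q \<bullet> j = Idt C y" "p \<bullet> j = Zer C y x" "q \<bullet> i = Zer C x y"
    "Add C (i \<bullet> p) (j \<bullet> q) = Idt C s"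
  shows "direct_sum C x y s"
proof -
  have "i \<in> Hom C x s" "j \<in> Hom C y s" "p \<in> Hom C s x" "q \<in> Hom C s y"
    using assms by (simp_all add: Hom_iff)
  moreover have "x \<in> Obj C" "y \<in> Obj C" "s \<in> Obj C"
    using assms Obj_Dom Obj_Cod by blast+
  ultimately show ?thesis
    unfolding direct_sum_def using assms(13-17) by blast
qed

lemma direct_sum_sym: "direct_sum C x y s \<Longrightarrow> direct_sum C y x s"
proof (erule direct_sumE)
  fix i j p q
  assume a: "i \<in> Arr C" "Dom C i = x" "Cod C i = s" "j \<in> Arr C" "Dom C j = y" "Cod C j = s"
    "p \<in> Arr C" "Dom C p = s" "Cod C p = x" "q \<in> Arr C" "Dom C q = s" "Cod C q = y"
    "p \<bullet> i = Idt C x" "q \<bullet> j = Idt C y" "p \<bullet> j = Zer C y x" "q \<bullet> i = Zer C x y"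
    "Add C (i \<bullet> p) (j \<bullet> q) = Idt C s"
  then have "Add C (j \<bullet> q) (i \<bullet> p) = Idt C s"
    using Add_commute[of "i \<bullet> p" "j \<bullet> q"] by simp
  then show ?thesis
    using a by (intro direct_sumI[of j y s i x q p])
qed

lemma zero_obj_retract:
  assumes "zero_obj C z" "x \<in> Obj C" shows "retract C z x"
  using assms by (intro retractI[where s = "Zer C z x" and r = "Zer C x z"]) (auto simp: zero_obj_iff)

lemma direct_sum_retract: "direct_sum C x y s \<Longrightarrow> retract C x s \<and> retract C y s"
  by (erule direct_sumE) (auto intro: retractI)

end

text \<open>The inclusion, in place of an equality, avoids requiring that \<open>x\<close> and
  \<open>y\<close> be objects; for objects it amounts to the equality in \<open>E_cond\<close>,
  since the zero arrow is always present.\<close>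

definition perp :: "('o, 'm, 'z) addcat_scheme \<Rightarrow> 'o set \<Rightarrow> 'o set \<Rightarrow> bool" where
  "perp C X Y \<longleftrightarrow> (\<forall>x \<in> X. \<forall>y \<in> Y. Hom C x y \<subseteq> {Zer C x y})"

lemma perpD:
  "\<lbrakk>perp C X Y; f \<in> Arr C; Dom C f = x; Cod C f = y; x \<in> X; y \<in> Y\<rbrakk> \<Longrightarrow> f = Zer C x y"
  by (fastforce simp: perp_def Hom_iff)

lemma perpI:
  "(\<And>f. f \<in> Arr C \<Longrightarrow> Dom C f \<in> X \<Longrightarrow> Cod C f \<in> Y \<Longrightarrow> f = Zer C (Dom C f) (Cod C f)) \<Longrightarrow> perp C X Y"
  by (auto simp: perp_def Hom_iff)

lemma perp_mono: "perp C X Y \<Longrightarrow> X' \<subseteq> X \<Longrightarrow> Y' \<subseteq> Y \<Longrightarrow> perp C X' Y'"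
  unfolding perp_def by blast

section \<open>Exactness properties of triangles\<close>

context triangulated_category
begin

lemma SigO_Obj [simp]: "x \<in> Obj C \<Longrightarrow> SigO C x \<in> Obj C"
  by (rule SigO_in)

lemma SigA_simps [simp]:
  assumes "f \<in> Arr C"
  shows "SigA C f \<in> Arr C" "Dom C (SigA C f) = SigO C (Dom C f)" "Cod C (SigA C f) = SigO C (Cod C f)"
proof -
  have "SigA C f \<in> Hom C (SigO C (Dom C f)) (SigO C (Cod C f))"
    using SigA_bij[of "Dom C f" "Cod C f"] assms by (auto simp: bij_betw_def Hom_iff)
  then show "SigA C f \<in> Arr C" "Dom C (SigA C f) = SigO C (Dom C f)" "Cod C (SigA C f) = SigO C (Cod C f)"
    by (auto simp: Hom_iff)
qed

lemma SigA_Idt_simp [simp]: "x \<in> Obj C \<Longrightarrow> SigA C (Idt C x) = Idt C (SigO C x)"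
  by (rule SigA_Idt)

lemma SigA_Cmp_simp [simp]:
  "f \<in> Arr C \<Longrightarrow> g \<in> Arr C \<Longrightarrow> Cod C f = Dom C g \<Longrightarrow> SigA C (g \<bullet> f) = SigA C g \<bullet> SigA C f"
  by (rule SigA_Cmp[of f "Dom C f" "Dom C g" g "Cod C g"]) (auto simp: Hom_iff)

lemma SigA_Add_simp [simp]:
  "\<lbrakk>f \<in> Arr C; g \<in> Arr C; Dom C f = Dom C g; Cod C f = Cod C g\<rbrakk>
    \<Longrightarrow> SigA C (Add C f g) = Add C (SigA C f) (SigA C g)"
  by (rule SigA_Add[of f "Dom C g" "Cod C g" g]) (auto simp: Hom_iff)

lemma SigA_Zer [simp]:
  assumes "x \<in> Obj C" "y \<in> Obj C"
  shows "SigA C (Zer C x y) = Zer C (SigO C x) (SigO C y)"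
  using SigA_Add_simp[of "Zer C x y" "Zer C x y"] Add_self_eq[of "SigA C (Zer C x y)"] assms by simp

lemma SigA_Neg [simp]: "f \<in> Arr C \<Longrightarrow> SigA C (Neg C f) = Neg C (SigA C f)"
  using SigA_Add_simp[of f "Neg C f"] Add_eq_Zer_iff[of "SigA C f" "SigA C (Neg C f)"] by simp

lemma SigA_eqD:
  assumes "SigA C f = SigA C g" "f \<in> Arr C" "g \<in> Arr C" "Dom C f = Dom C g" "Cod C f = Cod C g"
  shows "f = g"
proof -
  have "inj_on (SigA C) (Hom C (Dom C g) (Cod C g))"
    using SigA_bij[of "Dom C g" "Cod C g"] assms by (auto simp: bij_betw_def)
  then show ?thesis using assms by (auto simp: inj_on_def Hom_iff)
qed

lemma SigA_eq_Zer:
  "SigA C f = Zer C (SigO C x) (SigO C y) \<Longrightarrow> f \<in> Arr C \<Longrightarrow> Dom C f = x \<Longrightarrow> Cod C f = y \<Longrightarrow> f = Zer C x y"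
  by (rule SigA_eqD) auto

lemma SigA_full:
  assumes "h \<in> Arr C" "Dom C h = SigO C x" "Cod C h = SigO C y" "x \<in> Obj C" "y \<in> Obj C"
  obtains f where "f \<in> Arr C" "Dom C f = x" "Cod C f = y" "SigA C f = h"
proof -
  have "h \<in> SigA C ` Hom C x y"
    using SigA_bij[of x y] assms by (auto simp: bij_betw_def Hom_iff)
  then show ?thesis using that by (auto simp: Hom_iff)
qed

lemma zero_obj_SigO: "zero_obj C z \<Longrightarrow> zero_obj C (SigO C z)"
  unfolding zero_obj_iff using SigA_Idt[of z] by simp

section \<open>Long exact Hom sequences of a triangle\<close>

lemma TriD:
  assumes "(f, g, h) \<in> Tri C"
  shows "f \<in> Arr C" "g \<in> Arr C" "h \<in> Arr C" "Dom C g = Cod C f" "Dom C h = Cod C g"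
    "Cod C h = SigO C (Dom C f)"
  using Tri_candidate[OF assms] by (auto simp: candidate_def)

lemma Tri_rot: "(f, g, h) \<in> Tri C \<Longrightarrow> (g, h, Neg C (SigA C f)) \<in> Tri C"
  using Tri_rotate Tri_candidate by blast

lemma Tri_unrot:
  "\<lbrakk>(g, h, Neg C (SigA C f)) \<in> Tri C; f \<in> Arr C; Cod C f = Dom C g; Cod C h = SigO C (Dom C f)\<rbrakk>
    \<Longrightarrow> (f, g, h) \<in> Tri C"
  using Tri_rotate[of f g h] TriD[of g h "Neg C (SigA C f)"] by (simp add: candidate_def)

text \<open>A morphism from the triangle x = x \<rightarrow> 0 to the given one starts from 0 on the
  third vertex, and so factors \<open>g \<bullet> f\<close> through 0.\<close>

lemma Tri_Cmp_first:
  assumes T: "(f, g, h) \<in> Tri C" shows "g \<bullet> f = Zer C (Dom C f) (Cod C g)"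
proof -
  note t = TriD[OF T]
  obtain z where z: "zero_obj C z" using ex_zero_obj by blast
  have zO: "z \<in> Obj C" using z by (simp add: zero_obj_iff)
  have "\<exists>w \<in> Hom C (Dom C (Zer C z (SigO C (Dom C f)))) (Dom C h).
      w \<bullet> Zer C (Dom C f) z = g \<bullet> f \<and> h \<bullet> w = SigA C (Idt C (Dom C f)) \<bullet> Zer C z (SigO C (Dom C f))"
    by (rule Tri_fill[OF Tri_Idt[OF _ z] T]) (use t zO in \<open>auto simp: Hom_iff\<close>)
  then obtain w where "w \<in> Arr C" "Dom C w = z" "Cod C w = Cod C g" "w \<bullet> Zer C (Dom C f) z = g \<bullet> f"
    using t zO by (auto simp: Hom_iff)
  then show ?thesis using t zO by simp
qed

lemma Tri_Cmp:
  assumes T: "(f, g, h) \<in> Tri C"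
  shows "g \<bullet> f = Zer C (Dom C f) (Cod C g)" "h \<bullet> g = Zer C (Cod C f) (SigO C (Dom C f))"
    "SigA C f \<bullet> h = Zer C (Cod C g) (SigO C (Cod C f))"
proof -
  note t = TriD[OF T]
  show "g \<bullet> f = Zer C (Dom C f) (Cod C g)" by (rule Tri_Cmp_first[OF T])
  show "h \<bullet> g = Zer C (Cod C f) (SigO C (Dom C f))"
    using Tri_Cmp_first[OF Tri_rot[OF T]] t by simp
  show "SigA C f \<bullet> h = Zer C (Cod C g) (SigO C (Cod C f))"
    using Tri_Cmp_first[OF Tri_rot[OF Tri_rot[OF T]]] t by simp
qed

lemma Tri_Zer_Idt:
  assumes w: "w \<in> Obj C" and z: "zero_obj C z"
  shows "(Zer C z w, Idt C w, Zer C w (SigO C z)) \<in> Tri C"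
proof -
  have zO: "z \<in> Obj C" using z by (simp add: zero_obj_iff)
  have "(Idt C w, Zer C w (SigO C z), Zer C (SigO C z) (SigO C w)) \<in> Tri C"
    using w zero_obj_SigO[OF z] by (rule Tri_Idt)
  then show ?thesis
    by (intro Tri_unrot[of "Idt C w"]) (use zO w in simp_all)
qed

text \<open>Exactness of C(-, w) at the middle vertex: the filler of a morphism to the triangle 0
  \<rightarrow> w = w is the required extension.\<close>

lemma Tri_extend:
  assumes T: "(f, g, h) \<in> Tri C"
    and a: "a \<in> Arr C" "Dom C a = Cod C f" "a \<bullet> f = Zer C (Dom C f) (Cod C a)"
  obtains s where "s \<in> Arr C" "Dom C s = Cod C g" "Cod C s = Cod C a" "s \<bullet> g = a"
proof -
  note t = TriD[OF T]
  obtain z where z: "zero_obj C z" using ex_zero_obj by blast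
  have zO: "z \<in> Obj C" using z by (simp add: zero_obj_iff)
  let ?w = "Cod C a"
  have w: "?w \<in> Obj C" using a by simp
  have Tw: "(Zer C z ?w, Idt C ?w, Zer C ?w (SigO C z)) \<in> Tri C"
    by (rule Tri_Zer_Idt[OF w z])
  have "\<exists>s \<in> Hom C (Dom C h) (Dom C (Zer C ?w (SigO C z))). s \<bullet> g = Idt C ?w \<bullet> a \<and>
      Zer C ?w (SigO C z) \<bullet> s = SigA C (Zer C (Dom C f) z) \<bullet> h"
    by (rule Tri_fill[OF T Tw]) (use t a zO w in \<open>auto simp: Hom_iff\<close>)
  then obtain s where "s \<in> Hom C (Cod C g) ?w" "s \<bullet> g = Idt C ?w \<bullet> a"
    using t w zO by auto
  then show ?thesis using that[of s] a by (simp add: Hom_iff)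
qed

text \<open>Exactness of C(w, -). Since \<open>Tri_fill\<close> only supplies the third arrow, both
  triangles are rotated until the wanted arrow stands there; it then appears suspended, and \<Sigma>
  being fully faithful brings it down.\<close>

lemma Tri_lift:
  assumes T: "(f, g, h) \<in> Tri C"
    and a: "a \<in> Arr C" "Cod C a = Cod C f" "g \<bullet> a = Zer C (Dom C a) (Cod C g)"
  obtains s where "s \<in> Arr C" "Dom C s = Dom C a" "Cod C s = Dom C f" "f \<bullet> s = a"
proof -
  note t = TriD[OF T]
  obtain z where z: "zero_obj C z" using ex_zero_obj by blast
  have zO: "z \<in> Obj C" using z by (simp add: zero_obj_iff)
  let ?w = "Dom C a"
  have w: "?w \<in> Obj C" using a by simp
  have Tw: "(Zer C ?w z, Zer C z (SigO C ?w), Neg C (Idt C (SigO C ?w))) \<in> Tri C"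
    using Tri_rot[OF Tri_Idt[OF w z]] w zO by simp
  have "\<exists>s \<in> Hom C (Dom C (Neg C (Idt C (SigO C ?w)))) (Dom C (Neg C (SigA C f))).
      s \<bullet> Zer C z (SigO C ?w) = h \<bullet> Zer C z (Cod C g) \<and>
      Neg C (SigA C f) \<bullet> s = SigA C a \<bullet> Neg C (Idt C (SigO C ?w))"
    by (rule Tri_fill[OF Tw Tri_rot[OF T]]) (use t a zO w in \<open>auto simp: Hom_iff\<close>)
  then obtain s where s: "s \<in> Arr C" "Dom C s = SigO C ?w" "Cod C s = SigO C (Dom C f)"
    "Neg C (SigA C f \<bullet> s) = Neg C (SigA C a)"
    using t a w zO by (auto simp: Hom_iff)
  have "SigA C f \<bullet> s = SigA C a"
    by (rule Neg_eqD[OF s(4)]) (use s a t in simp_all)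
  moreover obtain s' where s': "s' \<in> Arr C" "Dom C s' = ?w" "Cod C s' = Dom C f" "SigA C s' = s"
    using SigA_full[OF s(1-3)] w t by auto
  ultimately have "f \<bullet> s' = a"
    by (intro SigA_eqD[of "f \<bullet> s'" a]) (use a t in simp_all)
  then show ?thesis using that s' by blast
qed

lemma Tri_extend2:
  assumes T: "(f, g, h) \<in> Tri C"
    and a: "a \<in> Arr C" "Dom C a = Cod C g" "a \<bullet> g = Zer C (Cod C f) (Cod C a)"
  obtains s where "s \<in> Arr C" "Dom C s = SigO C (Dom C f)" "Cod C s = Cod C a" "s \<bullet> h = a"
  using Tri_extend[OF Tri_rot[OF T] a(1,2)] TriD[OF T] a that by auto

lemma Tri_lift2:
  assumes T: "(f, g, h) \<in> Tri C"
    and a: "a \<in> Arr C" "Cod C a = Cod C g" "h \<bullet> a = Zer C (Dom C a) (SigO C (Dom C f))"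
  obtains s where "s \<in> Arr C" "Dom C s = Dom C a" "Cod C s = Cod C f" "g \<bullet> s = a"
  using Tri_lift[OF Tri_rot[OF T] a(1,2)] TriD[OF T] a that by auto

lemma Tri_lift3:
  assumes T: "(f, g, h) \<in> Tri C"
    and a: "a \<in> Arr C" "Cod C a = SigO C (Dom C f)" "SigA C f \<bullet> a = Zer C (Dom C a) (SigO C (Cod C f))"
  obtains s where "s \<in> Arr C" "Dom C s = Dom C a" "Cod C s = Cod C g" "h \<bullet> s = a"
proof -
  note t = TriD[OF T]
  have "Neg C (SigA C f) \<bullet> a = Zer C (Dom C a) (Cod C (Neg C (SigA C f)))"
    using a t by simp
  then show ?thesis
    using Tri_lift[OF Tri_rot[OF Tri_rot[OF T]] a(1)] t a that by auto
qed

text \<open>The obstruction to \<open>f\<close> being monic: whatever \<open>f\<close> kills comes,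
  after suspension, from the cone. Where no nonzero arrow to the cone exists, \<open>f\<close> can
  be cancelled.\<close>

lemma Tri_SigA_lift:
  assumes T: "(f, g, h) \<in> Tri C"
    and a: "a \<in> Arr C" "Cod C a = Dom C f" "f \<bullet> a = Zer C (Dom C a) (Cod C f)"
  obtains s where "s \<in> Arr C" "Dom C s = SigO C (Dom C a)" "Cod C s = Cod C g" "h \<bullet> s = SigA C a"
proof -
  note t = TriD[OF T]
  have "SigA C f \<bullet> SigA C a = Zer C (SigO C (Dom C a)) (SigO C (Cod C f))"
    using a t SigA_Cmp_simp[of a f] by simp
  then show ?thesis using Tri_lift3[OF T, of "SigA C a"] a that t by auto
qed

text \<open>The identity of the middle vertex extends along \<open>g\<close>. With its dual below
  this is the standard way to prove membership: orthogonality kills one map of a triangle, and the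
  middle vertex becomes a retract of an end.\<close>

lemma Tri_first_Zer_retract:
  assumes T: "(f, g, h) \<in> Tri C" and f: "f = Zer C (Dom C f) (Cod C f)"
  shows "retract C (Cod C f) (Cod C g)"
proof -
  note t = TriD[OF T]
  let ?y = "Cod C f"
  have y: "?y \<in> Obj C" using t by simp
  have "Idt C ?y \<bullet> f = Zer C (Dom C f) (Cod C (Idt C ?y))" using f t y by simp
  then obtain p where "p \<in> Arr C" "Dom C p = Cod C g" "Cod C p = ?y" "p \<bullet> g = Idt C ?y"
    using Tri_extend[OF T, of "Idt C ?y"] y by auto
  then show ?thesis using t by (intro retractI[of g _ _ _ p]) simp_all
qed

lemma Tri_second_Zer_retract:
  assumes T: "(f, g, h) \<in> Tri C" and g: "g = Zer C (Cod C f) (Cod C g)"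
  shows "retract C (Cod C f) (Dom C f)"
proof -
  note t = TriD[OF T]
  let ?y = "Cod C f"
  have y: "?y \<in> Obj C" using t by simp
  have "g \<bullet> Idt C ?y = Zer C (Dom C (Idt C ?y)) (Cod C g)" using g t y by simp
  then obtain p where "p \<in> Arr C" "Dom C p = ?y" "Cod C p = Dom C f" "f \<bullet> p = Idt C ?y"
    using Tri_lift[OF T, of "Idt C ?y"] y by auto
  then show ?thesis using t by (intro retractI[of p _ _ _ f]) simp_all
qed

text \<open>Writing \<open>w = 1 + d\<close>, the hypotheses give \<open>d\<^sup>2 = 0\<close>, so \<open>1 - d\<close> is inverse to \<open>w\<close>.\<close>

lemma Tri_endo_iso:
  assumes T: "(f, g, h) \<in> Tri C"
    and w: "w \<in> Arr C" "Dom C w = Cod C g" "Cod C w = Cod C g" "w \<bullet> g = g" "h \<bullet> w = h"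
  shows "iso_arr C w"
proof -
  note t = TriD[OF T]
  let ?z = "Cod C g" and ?i = "Idt C (Cod C g)"
  define d where "d = Add C w (Neg C ?i)"
  have z: "?z \<in> Obj C" using t by simp
  have d: "d \<in> Arr C" "Dom C d = ?z" "Cod C d = ?z" using w z by (simp_all add: d_def)
  have "d \<bullet> g = Zer C (Cod C f) (Cod C d)" using w t d z by (simp add: d_def)
  then obtain s where s: "s \<in> Arr C" "Dom C s = SigO C (Dom C f)" "Cod C s = ?z" "s \<bullet> h = d"
    using Tri_extend2[OF T d(1,2)] d by metis
  have hd: "h \<bullet> d = Zer C ?z (SigO C (Dom C f))" using w t z by (simp add: d_def)
  have dd: "d \<bullet> d = Zer C ?z ?z"
    using Cmp_eq_Cmp[OF s(4), of d] hd s t d z by simp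
  have wd: "w = Add C d ?i"
    unfolding d_def using w z by (simp add: Add_assoc)
  define v where "v = Add C (Neg C d) ?i"
  have v: "v \<in> Arr C" "Dom C v = ?z" "Cod C v = ?z" using d z by (simp_all add: v_def)
  have "w \<bullet> v = ?i" "v \<bullet> w = ?i"
    unfolding v_def wd using d z dd by (simp_all add: Add_assoc)
  then show ?thesis using iso_arrI[of w v] w v by simp
qed

text \<open>A lift \<open>j\<close> of the identity along \<open>g\<close> exists as
  \<open>h\<close> vanishes, and 1 - jg then factors as \<open>f \<bullet> p\<close>. The identities
  for \<open>p\<close> are tested after composing with \<open>f\<close>, which is monic because what
  it kills comes from \<open>h\<close>.\<close>

lemma Tri_split_direct_sum:
  assumes T: "(f, g, h) \<in> Tri C" and h: "h = Zer C (Cod C g) (SigO C (Dom C f))"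
  shows "direct_sum C (Dom C f) (Cod C g) (Cod C f)"
proof -
  note t = TriD[OF T]
  let ?x = "Dom C f" and ?y = "Cod C f" and ?z = "Cod C g"
  have O: "?x \<in> Obj C" "?y \<in> Obj C" "?z \<in> Obj C" using t by simp_all
  have "h \<bullet> Idt C ?z = Zer C (Dom C (Idt C ?z)) (SigO C ?x)" using h O by simp
  then obtain j where j: "j \<in> Arr C" "Dom C j = ?z" "Cod C j = ?y" "g \<bullet> j = Idt C ?z"
    using Tri_lift2[OF T, of "Idt C ?z"] O by auto
  define e where "e = Add C (Idt C ?y) (Neg C (j \<bullet> g))"
  have e: "e \<in> Arr C" "Dom C e = ?y" "Cod C e = ?y" using j t O by (simp_all add: e_def)
  have "g \<bullet> e = Zer C (Dom C e) ?z"
    using Cmp_eq_Cmp[OF j(4), of g] j t O e by (simp add: e_def)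
  then obtain p where p: "p \<in> Arr C" "Dom C p = ?y" "Cod C p = ?x" "f \<bullet> p = e"
    using Tri_lift[OF T e(1)] e by metis
  have mono: "a = Zer C (Dom C a) ?x"
    if a: "a \<in> Arr C" "Cod C a = ?x" "f \<bullet> a = Zer C (Dom C a) ?y" for a
  proof -
    obtain s where s: "s \<in> Arr C" "Dom C s = SigO C (Dom C a)" "Cod C s = ?z" "h \<bullet> s = SigA C a"
      using Tri_SigA_lift[OF T a] by blast
    have "h \<bullet> s = Zer C (SigO C (Dom C a)) (SigO C ?x)"
      unfolding h using s(1-3) O by simp
    then have "SigA C a = Zer C (SigO C (Dom C a)) (SigO C ?x)" using s(4) by simp
    then show ?thesis by (rule SigA_eq_Zer) (use a in simp_all)
  qed
  have gf: "g \<bullet> f = Zer C ?x ?z" using Tri_Cmp[OF T] by simp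
  have ef: "e \<bullet> f = f" using j t O gf by (simp add: e_def)
  have ej: "e \<bullet> j = Zer C ?z ?y" using j t O by (simp add: e_def)
  have "f \<bullet> Add C (p \<bullet> f) (Neg C (Idt C ?x)) = Zer C ?x ?y"
    using p t O ef Cmp_eq_Cmp[OF p(4), of f] by simp
  then have "Add C (p \<bullet> f) (Neg C (Idt C ?x)) = Zer C ?x ?x"
    using mono[of "Add C (p \<bullet> f) (Neg C (Idt C ?x))"] p t O by simp
  then have pf: "p \<bullet> f = Idt C ?x"
    by (rule diff_eq_Zer) (use p t O in simp_all)
  have "f \<bullet> (p \<bullet> j) = Zer C ?z ?y"
    using p t O ej j Cmp_eq_Cmp[OF p(4), of j] by simp
  then have pj: "p \<bullet> j = Zer C ?z ?x" using mono[of "p \<bullet> j"] p j by simp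
  have "Add C (f \<bullet> p) (j \<bullet> g) = Idt C ?y"
    using p j t O by (simp add: e_def Add_assoc)
  then show ?thesis
    using p j t O pf pj gf by (intro direct_sumI[of f ?x ?y j ?z p g]) simp_all
qed

text \<open>The complement is the cone of the section: \<Sigma>s is split monic and kills
  \<open>h\<close> from the left, so \<open>h\<close> vanishes and the triangle splits.\<close>

lemma retract_direct_sum:
  assumes "retract C x y" obtains c where "direct_sum C x c y"
proof -
  obtain s r where s: "s \<in> Arr C" "Dom C s = x" "Cod C s = y"
    and r: "r \<in> Arr C" "Dom C r = y" "Cod C r = x" "r \<bullet> s = Idt C x"
    using assms by (auto simp: retract_def Hom_iff)
  obtain g h where T: "(s, g, h) \<in> Tri C" using Tri_cone s by blast
  note t = TriD[OF T]
  have x: "x \<in> Obj C" using s by auto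
  have "SigA C r \<bullet> SigA C s = Idt C (SigO C x)"
    using SigA_Cmp_simp[of s r] r s x by simp
  then have "h = SigA C r \<bullet> (SigA C s \<bullet> h)"
    using Cmp_eq_Cmp[of "SigA C r" "SigA C s" "Idt C (SigO C x)" h] s r t by simp
  also have "\<dots> = Zer C (Cod C g) (SigO C (Dom C s))"
    using Tri_Cmp[OF T] r s t by simp
  finally show ?thesis using Tri_split_direct_sum[OF T] that s by simp
qed

lemma additive_subcategory_retract_closed:
  "additive_subcategory C X \<Longrightarrow> retract_closed C X"
  unfolding additive_subcategory_def retract_closed_def
  by (metis retract_direct_sum)

text \<open>Only a cone of \<open>i\<close> is given by the axioms, so \<open>y\<close> is compared
  with it: \<open>q\<close> induces \<open>w\<close>, with candidate inverse
  \<open>g \<bullet> j\<close>. The defect of this inverse factors through \<open>h\<close>, which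
  is zero because \<Sigma>i is split monic.\<close>

lemma direct_sum_Tri:
  assumes "direct_sum C x y s"
  obtains i q h where "(i, q, h) \<in> Tri C" "Dom C i = x" "Cod C i = s" "Cod C q = y"
proof -
  obtain i j p q where a: "i \<in> Arr C" "Dom C i = x" "Cod C i = s"
    "j \<in> Arr C" "Dom C j = y" "Cod C j = s"
    "p \<in> Arr C" "Dom C p = s" "Cod C p = x" "q \<in> Arr C" "Dom C q = s" "Cod C q = y"
    "p \<bullet> i = Idt C x" "q \<bullet> j = Idt C y" "p \<bullet> j = Zer C y x" "q \<bullet> i = Zer C x y"
    "Add C (i \<bullet> p) (j \<bullet> q) = Idt C s"
    using assms by (rule direct_sumE)
  have O: "x \<in> Obj C" "y \<in> Obj C" "s \<in> Obj C" using assms by (auto simp: direct_sum_def)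
  obtain g h where T: "(i, g, h) \<in> Tri C" using Tri_cone a by blast
  note t = TriD[OF T]
  let ?c = "Cod C g"
  have c: "?c \<in> Obj C" using t by simp
  obtain w where w: "w \<in> Arr C" "Dom C w = ?c" "Cod C w = y" "w \<bullet> g = q"
    using Tri_extend[OF T, of q] a by metis
  have wgj: "w \<bullet> (g \<bullet> j) = Idt C y" using Cmp_eq_Cmp[OF w(4), of j] w t a by simp
  have gi: "g \<bullet> i = Zer C x ?c" using Tri_Cmp[OF T] a by simp
  define d where "d = Add C ((g \<bullet> j) \<bullet> w) (Neg C (Idt C ?c))"
  have d: "d \<in> Arr C" "Dom C d = ?c" "Cod C d = ?c" using w t a c by (simp_all add: d_def)
  have "g = g \<bullet> Add C (i \<bullet> p) (j \<bullet> q)" using a t O by simp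
  also have "\<dots> = g \<bullet> (j \<bullet> q)"
    using a(1-12) t O gi c Cmp_eq_Cmp[OF gi, of p] by simp
  finally have gjq: "g \<bullet> (j \<bullet> q) = g" by simp
  have dg: "d \<bullet> g = Zer C (Cod C i) (Cod C d)"
    using w t a c gjq by (simp add: d_def)
  obtain k where k: "k \<in> Arr C" "Dom C k = SigO C x" "Cod C k = ?c" "k \<bullet> h = d"
    using Tri_extend2[OF T d(1,2) dg] d a by metis
  have "SigA C p \<bullet> SigA C i = Idt C (SigO C x)"
    using SigA_Cmp_simp[of i p] a O by simp
  then have "h = SigA C p \<bullet> (SigA C i \<bullet> h)"
    using Cmp_eq_Cmp[of "SigA C p" "SigA C i" "Idt C (SigO C x)" h] a t by simp
  also have "\<dots> = Zer C ?c (SigO C x)"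
    using Tri_Cmp[OF T] a t c O by simp
  finally have "d = Zer C ?c ?c" using k c O by simp
  then have gjw: "(g \<bullet> j) \<bullet> w = Idt C ?c"
    unfolding d_def by (rule diff_eq_Zer) (use w t a c in simp_all)
  have isow: "iso_arr C w"
    by (rule iso_arrI[where g = "g \<bullet> j"]) (use w t a wgj gjw in simp_all)
  have "(i, q, h \<bullet> (g \<bullet> j)) \<in> Tri C"
    by (rule Tri_iso[OF T, where u = "Idt C x" and v = "Idt C s" and w = w])
      (use isow w t a O c gjw in \<open>simp_all add: Hom_iff candidate_def\<close>)
  then show ?thesis using that a by blast
qed

section \<open>Extension products and shifts\<close>

abbreviation sh :: "'o set \<Rightarrow> 'o set" where
  "sh X \<equiv> shift C 1 X"

abbreviation ext :: "'o set \<Rightarrow> 'o set \<Rightarrow> 'o set" (infixr "\<star>" 65) where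
  "X \<star> Y \<equiv> ext_prod C X Y"

section \<open>Suspension of objects and of full subcategories\<close>

lemma SigO_isomorphic:
  assumes "isomorphic C x y" shows "isomorphic C (SigO C x) (SigO C y)"
proof -
  obtain f g where a: "f \<in> Arr C" "Dom C f = x" "Cod C f = y"
    "g \<in> Arr C" "Dom C g = y" "Cod C g = x" "g \<bullet> f = Idt C x" "f \<bullet> g = Idt C y"
    using assms by (rule isomorphicE)
  have "x \<in> Obj C" "y \<in> Obj C" using a by auto
  then show ?thesis
    using SigA_Cmp_simp[of f g] SigA_Cmp_simp[of g f] a
    by (intro isomorphicI[where f = "SigA C f" and g = "SigA C g"]) simp_all
qed

lemma isomorphic_SigO_iff:
  assumes "x \<in> Obj C" "y \<in> Obj C"
  shows "isomorphic C (SigO C x) (SigO C y) \<longleftrightarrow> isomorphic C x y"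
proof
  assume "isomorphic C (SigO C x) (SigO C y)"
  then obtain f g where a: "f \<in> Arr C" "Dom C f = SigO C x" "Cod C f = SigO C y"
    "g \<in> Arr C" "Dom C g = SigO C y" "Cod C g = SigO C x"
    "g \<bullet> f = Idt C (SigO C x)" "f \<bullet> g = Idt C (SigO C y)"
    by (rule isomorphicE)
  obtain f' where f': "f' \<in> Arr C" "Dom C f' = x" "Cod C f' = y" "SigA C f' = f"
    using SigA_full[OF a(1-3) assms] by blast
  obtain g' where g': "g' \<in> Arr C" "Dom C g' = y" "Cod C g' = x" "SigA C g' = g"
    using SigA_full[OF a(4-6) assms(2,1)] by blast
  have "g' \<bullet> f' = Idt C x"
    by (rule SigA_eqD) (use a f' g' assms in simp_all)
  moreover have "f' \<bullet> g' = Idt C y"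
    by (rule SigA_eqD) (use a f' g' assms in simp_all)
  ultimately show "isomorphic C x y"
    using f' g' by (intro isomorphicI[where f = f' and g = g'])
qed (rule SigO_isomorphic)

lemma mem_sh: "c \<in> sh X \<longleftrightarrow> (\<exists>x \<in> X. isomorphic C c (SigO C x))"
  by (auto simp: shift_def dest: isomorphic_Obj)

lemma SigO_mem_sh: "x \<in> X \<Longrightarrow> x \<in> Obj C \<Longrightarrow> SigO C x \<in> sh X"
  by (auto simp: mem_sh intro!: bexI[of _ x])

lemma sh_Obj: "sh X \<subseteq> Obj C"
  by (auto simp: shift_def)

lemma sh_mono: "X \<subseteq> Y \<Longrightarrow> sh X \<subseteq> sh Y"
  unfolding shift_def by blast

lemma sh_isomorphic: "c \<in> sh X \<Longrightarrow> isomorphic C c c' \<Longrightarrow> c' \<in> sh X"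
  unfolding mem_sh using isomorphic_trans isomorphic_sym by blast

lemma SigO_mem_sh_iff:
  assumes "iso_closed C X" "X \<subseteq> Obj C" "c \<in> Obj C"
  shows "SigO C c \<in> sh X \<longleftrightarrow> c \<in> X"
  using assms isomorphic_SigO_iff[of c] isomorphic_sym
  by (auto simp: mem_sh iso_closed_def intro!: bexI[of _ c])

lemma mem_shift_minus1:
  assumes "iso_closed C X"
  shows "c \<in> shift C (- 1) X \<longleftrightarrow> c \<in> Obj C \<and> SigO C c \<in> X"
proof -
  have "c \<in> shift C (- 1) X \<longleftrightarrow> c \<in> Obj C \<and> (\<exists>x \<in> X. isomorphic C (SigO C c) x)"
    by (simp add: shift_def)
  moreover have "(\<exists>x \<in> X. isomorphic C (SigO C c) x) \<longleftrightarrow> SigO C c \<in> X" if "c \<in> Obj C"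
    using that assms isomorphic_refl[of "SigO C c"] isomorphic_sym[of "SigO C c"] SigO_in[OF that]
    unfolding iso_closed_def by blast
  ultimately show ?thesis by blast
qed

lemma retract_SigO:
  assumes "retract C (SigO C x) (SigO C y)" "x \<in> Obj C" "y \<in> Obj C"
  shows "retract C x y"
proof -
  obtain f g where a: "f \<in> Arr C" "Dom C f = SigO C x" "Cod C f = SigO C y"
    "g \<in> Arr C" "Dom C g = SigO C y" "Cod C g = SigO C x" "g \<bullet> f = Idt C (SigO C x)"
    using assms(1) by (auto simp: retract_def Hom_iff)
  obtain f' where f': "f' \<in> Arr C" "Dom C f' = x" "Cod C f' = y" "SigA C f' = f"
    using SigA_full[OF a(1-3)] assms by blast
  obtain g' where g': "g' \<in> Arr C" "Dom C g' = y" "Cod C g' = x" "SigA C g' = g"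
    using SigA_full[OF a(4-6)] assms by blast
  have "g' \<bullet> f' = Idt C x"
    by (rule SigA_eqD) (use a f' g' assms in simp_all)
  then show ?thesis using f' g' retractI by metis
qed

lemma retract_trans:
  assumes "retract C x y" "retract C y z" shows "retract C x z"
proof -
  obtain f g where a: "f \<in> Arr C" "Dom C f = x" "Cod C f = y"
    "g \<in> Arr C" "Dom C g = y" "Cod C g = x" "g \<bullet> f = Idt C x"
    using assms(1) by (auto simp: retract_def Hom_iff)
  obtain f' g' where b: "f' \<in> Arr C" "Dom C f' = y" "Cod C f' = z"
    "g' \<in> Arr C" "Dom C g' = z" "Cod C g' = y" "g' \<bullet> f' = Idt C y"
    using assms(2) by (auto simp: retract_def Hom_iff)
  show ?thesis
    by (rule retractI[where s = "f' \<bullet> f" and r = "g \<bullet> g'"])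
      (use a b Cmp_eq_Cmp[OF b(7), of f] in simp_all)
qed

lemma retract_Obj: "retract C x y \<Longrightarrow> x \<in> Obj C \<and> y \<in> Obj C"
  by (auto simp: retract_def Hom_iff)

text \<open>An object need not be a suspension, only isomorphic to one; the retraction is moved
  there and then reflected by the fully faithful \<Sigma>.\<close>

lemma retract_closed_sh:
  assumes X: "retract_closed C X" shows "retract_closed C (sh X)"
  unfolding retract_closed_def
proof (intro conjI ballI allI impI)
  show "sh X \<subseteq> Obj C" by (rule sh_Obj)
  fix y x assume y: "y \<in> sh X" and xy: "retract C x y"
  obtain v where v: "v \<in> X" "isomorphic C y (SigO C v)" using y by (auto simp: mem_sh)
  have vO: "v \<in> Obj C" using X v by (auto simp: retract_closed_def)
  have x: "x \<in> Obj C" using xy retract_Obj by blast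
  obtain u where u: "u \<in> Obj C" "isomorphic C (SigO C u) x" using SigO_ess_surj[OF x] by blast
  have "retract C (SigO C u) (SigO C v)"
    using u(2) xy v(2) by (meson isomorphic_retract retract_trans)
  then have "retract C u v" using u(1) vO by (rule retract_SigO)
  then have "u \<in> X" using v(1) by (rule retract_closedD[OF X])
  then show "x \<in> sh X" using isomorphic_sym[OF u(2)] by (auto simp: mem_sh)
qed

section \<open>Extension products, and triangles up to isomorphism and backward rotation\<close>

lemma ext_prodI:
  "\<lbrakk>(f, g, h) \<in> Tri C; Dom C f \<in> X; Cod C f = e; Cod C g \<in> Y\<rbrakk> \<Longrightarrow> e \<in> X \<star> Y"
  using TriD[of f g h] by (fastforce simp: ext_prod_def short_triangle_def Hom_iff)

lemma ext_prodE:
  assumes "e \<in> X \<star> Y"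
  obtains f g h where "(f, g, h) \<in> Tri C" "Dom C f \<in> X" "Cod C f = e" "Cod C g \<in> Y"
  using assms by (fastforce simp: ext_prod_def short_triangle_def Hom_iff)

lemma ext_Obj: "X \<star> Y \<subseteq> Obj C"
  by (auto simp: ext_prod_def)

lemma ext_mono: "X \<subseteq> X' \<Longrightarrow> Y \<subseteq> Y' \<Longrightarrow> X \<star> Y \<subseteq> X' \<star> Y'"
  unfolding ext_prod_def by blast

lemma ext_zero_right:
  assumes "X \<subseteq> Obj C" "zero_obj C z" "z \<in> Y" shows "X \<subseteq> X \<star> Y"
proof
  fix x assume x: "x \<in> X"
  show "x \<in> X \<star> Y"
    by (rule ext_prodI[OF Tri_Idt[of x z]]) (use assms x in \<open>auto simp: zero_obj_iff\<close>)
qed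

lemma ext_zero_left:
  assumes "Y \<subseteq> Obj C" "zero_obj C z" "z \<in> X" shows "Y \<subseteq> X \<star> Y"
proof
  fix y assume y: "y \<in> Y"
  show "y \<in> X \<star> Y"
    by (rule ext_prodI[OF Tri_Zer_Idt[of y z]]) (use assms y in \<open>auto simp: zero_obj_iff\<close>)
qed

lemma Tri_isomorphic:
  assumes T: "(f, g, h) \<in> Tri C"
    and "isomorphic C (Dom C f) x" "isomorphic C (Cod C f) y" "isomorphic C (Cod C g) z"
  obtains f' g' h' where "(f', g', h') \<in> Tri C" "Dom C f' = x" "Cod C f' = y" "Cod C g' = z"
proof -
  note t = TriD[OF T]
  obtain u u' where u: "u \<in> Arr C" "Dom C u = Dom C f" "Cod C u = x" "u' \<in> Arr C" "Dom C u' = x"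
    "Cod C u' = Dom C f" "u' \<bullet> u = Idt C (Dom C f)" "u \<bullet> u' = Idt C x" "iso_arr C u"
    using assms(2) by (rule isomorphicE)
  obtain v v' where v: "v \<in> Arr C" "Dom C v = Cod C f" "Cod C v = y" "v' \<in> Arr C" "Dom C v' = y"
    "Cod C v' = Cod C f" "v' \<bullet> v = Idt C (Cod C f)" "v \<bullet> v' = Idt C y" "iso_arr C v"
    using assms(3) by (rule isomorphicE)
  obtain w w' where w: "w \<in> Arr C" "Dom C w = Cod C g" "Cod C w = z" "w' \<in> Arr C" "Dom C w' = z"
    "Cod C w' = Cod C g" "w' \<bullet> w = Idt C (Cod C g)" "w \<bullet> w' = Idt C z" "iso_arr C w"
    using assms(4) by (rule isomorphicE)
  have "(v \<bullet> (f \<bullet> u'), w \<bullet> (g \<bullet> v'), SigA C u \<bullet> (h \<bullet> w')) \<in> Tri C"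
    by (rule Tri_iso[OF T, of _ _ _ u v w])
      (use t u v w Cmp_eq_Cmp[OF v(7), of f] in \<open>simp_all add: candidate_def Hom_iff\<close>)
  then show ?thesis
    by (rule that) (use t u v w in simp_all)
qed

lemma ext_isomorphic:
  assumes e: "e \<in> X \<star> Y" and i: "isomorphic C e e'" shows "e' \<in> X \<star> Y"
proof -
  obtain f g h where T: "(f, g, h) \<in> Tri C" "Dom C f \<in> X" "Cod C f = e" "Cod C g \<in> Y"
    using e by (rule ext_prodE)
  note t = TriD[OF T(1)]
  have i': "isomorphic C (Dom C f) (Dom C f)" "isomorphic C (Cod C f) e'"
    "isomorphic C (Cod C g) (Cod C g)" using t i T(3) by simp_all
  obtain f' g' h' where "(f', g', h') \<in> Tri C" "Dom C f' = Dom C f" "Cod C f' = e'" "Cod C g' = Cod C g"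
    by (rule Tri_isomorphic[OF T(1) i'])
  then show ?thesis using T ext_prodI by metis
qed

lemma ext_sh_leftE:
  assumes "e \<in> sh X \<star> Y" "X \<subseteq> Obj C"
  obtains f g h x where "(f, g, h) \<in> Tri C" "x \<in> X" "Dom C f = SigO C x" "Cod C f = e" "Cod C g \<in> Y"
proof -
  obtain f g h where T: "(f, g, h) \<in> Tri C" "Dom C f \<in> sh X" "Cod C f = e" "Cod C g \<in> Y"
    using assms(1) by (rule ext_prodE)
  note t = TriD[OF T(1)]
  obtain x where x: "x \<in> X" "isomorphic C (Dom C f) (SigO C x)" using T(2) by (auto simp: mem_sh)
  have i: "isomorphic C (Cod C f) e" "isomorphic C (Cod C g) (Cod C g)"
    using t T(3) Obj_Cod[of f] by simp_all
  obtain f' g' h' where "(f', g', h') \<in> Tri C" "Dom C f' = SigO C x" "Cod C f' = e" "Cod C g' = Cod C g"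
    by (rule Tri_isomorphic[OF T(1) x(2) i])
  then show ?thesis using that T x by metis
qed

text \<open>Rotating backwards requires \<open>Cod C h\<close> to be a suspension on the nose, so it
  is first replaced by \<Sigma>x; the missing arrow is then the preimage under \<Sigma> of the third
  arrow, up to sign.\<close>

lemma Tri_cocone:
  assumes T: "(g, h, k) \<in> Tri C" and x: "x \<in> Obj C" "isomorphic C (Cod C h) (SigO C x)"
  obtains f h' where "(f, g, h') \<in> Tri C" "Dom C f = x" "Cod C f = Dom C g"
proof -
  note t = TriD[OF T]
  obtain a b where a: "a \<in> Arr C" "Dom C a = Cod C h" "Cod C a = SigO C x" "b \<in> Arr C" "Dom C b = SigO C x"
    "Cod C b = Cod C h" "b \<bullet> a = Idt C (Cod C h)" "a \<bullet> b = Idt C (SigO C x)" "iso_arr C a"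
    using x(2) by (rule isomorphicE)
  have T': "(g, a \<bullet> h, k \<bullet> b) \<in> Tri C"
    by (rule Tri_iso[OF T, of _ _ _ "Idt C (Dom C g)" "Idt C (Dom C h)" a])
      (use t a in \<open>simp_all add: candidate_def Hom_iff\<close>)
  obtain f where f: "f \<in> Arr C" "Dom C f = x" "Cod C f = Dom C g" "SigA C f = Neg C (k \<bullet> b)"
    using SigA_full[of "Neg C (k \<bullet> b)" x "Dom C g"] t a x by auto
  have "(f, g, a \<bullet> h) \<in> Tri C"
    by (rule Tri_unrot) (use T' f t a in simp_all)
  then show ?thesis using that f by blast
qed

lemma Tri_cocone_ext:
  assumes T: "(g, h, k) \<in> Tri C" and X: "X \<subseteq> Obj C" "Cod C h \<in> sh X" and "Cod C g \<in> Y"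
  shows "Dom C g \<in> X \<star> Y"
proof -
  obtain x where x: "x \<in> X" "isomorphic C (Cod C h) (SigO C x)" using X by (auto simp: mem_sh)
  moreover have "x \<in> Obj C" using x X by blast
  ultimately obtain f h' where "(f, g, h') \<in> Tri C" "Dom C f = x" "Cod C f = Dom C g"
    using Tri_cocone[OF T] by blast
  then show ?thesis using x assms ext_prodI by metis
qed

lemma ext_sh_rightE:
  assumes "e \<in> X \<star> sh Y" "Y \<subseteq> Obj C"
  obtains f g h where "(f, g, h) \<in> Tri C" "Dom C f \<in> Y" "Cod C f \<in> X" "Cod C g = e"
proof -
  obtain g h k where T: "(g, h, k) \<in> Tri C" "Dom C g \<in> X" "Cod C g = e" "Cod C h \<in> sh Y"
    using assms(1) by (rule ext_prodE)
  obtain y where y: "y \<in> Y" "isomorphic C (Cod C h) (SigO C y)" using T(4) by (auto simp: mem_sh)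
  moreover have "y \<in> Obj C" using y assms by blast
  ultimately obtain f h' where "(f, g, h') \<in> Tri C" "Dom C f = y" "Cod C f = Dom C g"
    using Tri_cocone[OF T(1)] by blast
  then show ?thesis using that T y by metis
qed

lemma ext_sh_rightI:
  assumes T: "(f, g, h) \<in> Tri C" "Dom C f \<in> Y" "Cod C f \<in> X"
  shows "Cod C g \<in> X \<star> sh Y"
proof -
  note t = TriD[OF T(1)]
  show ?thesis
    by (rule ext_prodI[OF Tri_rot[OF T(1)]]) (use t T SigO_mem_sh[of "Dom C f" Y] in auto)
qed

section \<open>Suspending and desuspending triangles\<close>

lemma Tri_SigA:
  assumes T: "(f, g, h) \<in> Tri C" shows "(SigA C f, SigA C g, Neg C (SigA C h)) \<in> Tri C"
proof -
  note t = TriD[OF T]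
  have i: "iso_arr C (Neg C (Idt C (SigO C (Cod C f))))"
    by (rule iso_arrI[where g = "Neg C (Idt C (SigO C (Cod C f)))"]) (use t in simp_all)
  show ?thesis
    by (rule Tri_iso[OF Tri_rot[OF Tri_rot[OF Tri_rot[OF T]]],
          where u = "Idt C (SigO C (Dom C f))" and v = "Neg C (Idt C (SigO C (Cod C f)))"
          and w = "Idt C (SigO C (Cod C g))"])
      (use t i in \<open>simp_all add: candidate_def Hom_iff\<close>)
qed

text \<open>Three backward rotations start from a triangle with all three suspended arrows negated.
  The given one has a single sign; acting by -1 on the middle vertex puts signs on the other two
  arrows.\<close>

lemma Tri_SigA_D:
  assumes T: "(SigA C f, SigA C g, Neg C (SigA C h)) \<in> Tri C" and c: "candidate C f g h"
  shows "(f, g, h) \<in> Tri C"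
proof -
  have t: "f \<in> Arr C" "g \<in> Arr C" "h \<in> Arr C" "Dom C g = Cod C f" "Dom C h = Cod C g"
    "Cod C h = SigO C (Dom C f)" using c by (auto simp: candidate_def)
  have i: "iso_arr C (Neg C (Idt C (SigO C (Cod C f))))"
    by (rule iso_arrI[where g = "Neg C (Idt C (SigO C (Cod C f)))"]) (use t in simp_all)
  have "(Neg C (SigA C f), Neg C (SigA C g), Neg C (SigA C h)) \<in> Tri C"
    by (rule Tri_iso[OF T, where u = "Idt C (SigO C (Dom C f))" and v = "Neg C (Idt C (SigO C (Cod C f)))"
          and w = "Idt C (SigO C (Cod C g))"])
      (use t i in \<open>simp_all add: candidate_def Hom_iff\<close>)
  then have "(h, Neg C (SigA C f), Neg C (SigA C g)) \<in> Tri C"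
    by (rule Tri_unrot) (use t in simp_all)
  then have "(g, h, Neg C (SigA C f)) \<in> Tri C"
    by (rule Tri_unrot) (use t in simp_all)
  then show ?thesis
    by (rule Tri_unrot) (use t in simp_all)
qed

lemma Tri_desuspend:
  assumes T: "(F, G, H) \<in> Tri C" and O: "x \<in> Obj C" "y \<in> Obj C" "z \<in> Obj C"
    and e: "isomorphic C (Dom C F) (SigO C x)" "isomorphic C (Cod C F) (SigO C y)"
      "isomorphic C (Cod C G) (SigO C z)"
  obtains f g h where "(f, g, h) \<in> Tri C" "Dom C f = x" "Cod C f = y" "Cod C g = z"
proof -
  obtain F' G' H' where T': "(F', G', H') \<in> Tri C" "Dom C F' = SigO C x" "Cod C F' = SigO C y"
    "Cod C G' = SigO C z"
    using Tri_isomorphic[OF T e] by blast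
  note t = TriD[OF T'(1)]
  obtain f where f: "f \<in> Arr C" "Dom C f = x" "Cod C f = y" "SigA C f = F'"
    using SigA_full[of F' x y] t T' O by metis
  obtain g where g: "g \<in> Arr C" "Dom C g = y" "Cod C g = z" "SigA C g = G'"
    using SigA_full[of G' y z] t T' O by metis
  obtain h where h: "h \<in> Arr C" "Dom C h = z" "Cod C h = SigO C x" "SigA C h = Neg C H'"
    using SigA_full[of "Neg C H'" z "SigO C x"] t T' O by auto
  have "(f, g, h) \<in> Tri C"
    by (rule Tri_SigA_D) (use T' t f g h in \<open>simp_all add: candidate_def\<close>)
  then show ?thesis using that f g h by blast
qed

lemma sh_ext:
  assumes X: "X \<subseteq> Obj C" and Y: "Y \<subseteq> Obj C" shows "sh (X \<star> Y) = sh X \<star> sh Y"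
proof (intro equalityI subsetI)
  fix c assume "c \<in> sh (X \<star> Y)"
  then obtain e where e: "e \<in> X \<star> Y" "isomorphic C c (SigO C e)" by (auto simp: mem_sh)
  obtain f g h where T: "(f, g, h) \<in> Tri C" "Dom C f \<in> X" "Cod C f = e" "Cod C g \<in> Y"
    using e(1) by (rule ext_prodE)
  note t = TriD[OF T(1)]
  have "SigO C e \<in> sh X \<star> sh Y"
    by (rule ext_prodI[OF Tri_SigA[OF T(1)]]) (use t T in \<open>simp_all add: SigO_mem_sh\<close>)
  then show "c \<in> sh X \<star> sh Y" using e(2) ext_isomorphic isomorphic_sym by blast
next
  fix e assume e: "e \<in> sh X \<star> sh Y"
  obtain f g h where T: "(f, g, h) \<in> Tri C" "Dom C f \<in> sh X" "Cod C f = e" "Cod C g \<in> sh Y"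
    using e by (rule ext_prodE)
  note t = TriD[OF T(1)]
  obtain x where x: "x \<in> X" "isomorphic C (Dom C f) (SigO C x)" using T by (auto simp: mem_sh)
  obtain y where y: "y \<in> Y" "isomorphic C (Cod C g) (SigO C y)" using T by (auto simp: mem_sh)
  have "e \<in> Obj C" using e ext_Obj by blast
  then obtain d where d: "d \<in> Obj C" "isomorphic C (SigO C d) e" using SigO_ess_surj by blast
  have "isomorphic C (Cod C f) (SigO C d)" using d T isomorphic_sym by blast
  moreover have "x \<in> Obj C" "y \<in> Obj C" using x y X Y by auto
  ultimately obtain f' g' h' where
    "(f', g', h') \<in> Tri C" "Dom C f' = x" "Cod C f' = d" "Cod C g' = y"
    using Tri_desuspend[OF T(1) _ d(1) _ x(2) _ y(2)] by metis
  then have "d \<in> X \<star> Y" using ext_prodI x y by metis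
  then show "e \<in> sh (X \<star> Y)" using isomorphic_sym[OF d(2)] by (auto simp: mem_sh)
qed

text \<open>Both inclusions are the octahedral axiom: one for the cone of a composite of first maps,
  the other, one suspension higher, for the cocone of a composite of second maps.\<close>

lemma ext_assoc:
  assumes X: "X \<subseteq> Obj C" and Y: "Y \<subseteq> Obj C" and Z: "Z \<subseteq> Obj C"
  shows "(X \<star> Y) \<star> Z = X \<star> (Y \<star> Z)"
proof (intro equalityI subsetI)
  fix e assume "e \<in> (X \<star> Y) \<star> Z"
  then obtain g c k where T: "(g, c, k) \<in> Tri C" "Dom C g \<in> X \<star> Y" "Cod C g = e" "Cod C c \<in> Z"
    by (rule ext_prodE)
  obtain f a b where T': "(f, a, b) \<in> Tri C" "Dom C f \<in> X" "Cod C f = Dom C g" "Cod C a \<in> Y"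
    using T(2) by (rule ext_prodE)
  note t = TriD[OF T(1)] TriD[OF T'(1)]
  have "g \<bullet> f \<in> Arr C" using t T'(3) by simp
  then obtain p q where T'': "(g \<bullet> f, p, q) \<in> Tri C" using Tri_cone by blast
  note t'' = TriD[OF T'']
  obtain r s where rs: "r \<in> Hom C (Cod C a) (Cod C p)" "s \<in> Hom C (Cod C p) (Cod C c)"
    "(r, s, SigA C a \<bullet> k) \<in> Tri C"
    using octahedron[OF T'(1) T(1) T'(3) T''] by blast
  have "Cod C p \<in> Y \<star> Z"
    by (rule ext_prodI[OF rs(3)]) (use rs T T' in \<open>simp_all add: Hom_iff\<close>)
  then show "e \<in> X \<star> (Y \<star> Z)"
    by (rule ext_prodI[OF T'', rotated 2]) (use t T T' in simp_all)
next
  fix e assume "e \<in> X \<star> (Y \<star> Z)"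
  then obtain f g h where T: "(f, g, h) \<in> Tri C" "Dom C f \<in> X" "Cod C f = e" "Cod C g \<in> Y \<star> Z"
    by (rule ext_prodE)
  obtain a b k where T': "(a, b, k) \<in> Tri C" "Dom C a \<in> Y" "Cod C a = Cod C g" "Cod C b \<in> Z"
    using T(4) by (rule ext_prodE)
  note t = TriD[OF T(1)] TriD[OF T'(1)]
  have "b \<bullet> g \<in> Arr C" using t T'(3) by simp
  then obtain p q where T'': "(b \<bullet> g, p, q) \<in> Tri C" using Tri_cone by blast
  note t'' = TriD[OF T'']
  \<comment> \<open>For the composite \<open>b \<bullet> g\<close> both triangles are rotated, so
    the axiom presents the cone \<open>Cod C p\<close> as an extension of \<Sigma>y by \<Sigma>x,
    where x = \<open>Dom C f\<close> and y = \<open>Dom C a\<close>. Desuspending it gives the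
    object \<open>d\<close> of \<open>X \<star> Y\<close> that maps to \<open>e\<close> with cone in
    \<open>Z\<close>.\<close>
  obtain r s l where rs: "r \<in> Hom C (Cod C h) (Cod C p)" "s \<in> Hom C (Cod C p) (Cod C k)"
    "(r, s, l) \<in> Tri C"
    using octahedron[OF Tri_rot[OF T(1)] Tri_rot[OF T'(1)] _ T''] t T'(3) by auto
  obtain d where d: "d \<in> Obj C" "isomorphic C (SigO C d) (Cod C p)"
    using SigO_ess_surj[of "Cod C p"] t'' by auto
  obtain f' g' h' where F: "(f', g', h') \<in> Tri C" "Dom C f' = Dom C f" "Cod C f' = d" "Cod C g' = Dom C a"
    using Tri_desuspend[OF rs(3), of "Dom C f" d "Dom C a"] d rs t isomorphic_sym[OF d(2)]
    by (auto simp: Hom_iff)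
  have dXY: "d \<in> X \<star> Y" by (rule ext_prodI[OF F(1)]) (use F T T' in simp_all)
  obtain u v where u: "(u, b \<bullet> g, v) \<in> Tri C" "Dom C u = d" "Cod C u = Dom C (b \<bullet> g)"
    using Tri_cocone[OF T'' d(1) isomorphic_sym[OF d(2)]] by blast
  show "e \<in> (X \<star> Y) \<star> Z"
    by (rule ext_prodI[OF u(1)]) (use u t T T' dXY in simp_all)
qed

section \<open>Orthogonality, exchange and retracts of extension products\<close>

lemma perp_ext_left:
  assumes X: "perp C X Z" and Y: "perp C Y Z" and O: "Z \<subseteq> Obj C" shows "perp C (X \<star> Y) Z"
proof (rule perpI)
  fix a assume a: "a \<in> Arr C" "Dom C a \<in> X \<star> Y" "Cod C a \<in> Z"
  obtain f g h where T: "(f, g, h) \<in> Tri C" "Dom C f \<in> X" "Cod C f = Dom C a" "Cod C g \<in> Y"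
    using a(2) by (rule ext_prodE)
  note t = TriD[OF T(1)]
  have "a \<bullet> f = Zer C (Dom C f) (Cod C a)"
    by (rule perpD[OF X]) (use a T t in simp_all)
  then obtain s where s: "s \<in> Arr C" "Dom C s = Cod C g" "Cod C s = Cod C a" "s \<bullet> g = a"
    using Tri_extend[OF T(1) a(1)] T by metis
  have "s = Zer C (Cod C g) (Cod C a)"
    by (rule perpD[OF Y]) (use a T t s in simp_all)
  then have "a = Zer C (Cod C g) (Cod C a) \<bullet> g" using s by metis
  also have "\<dots> = Zer C (Dom C a) (Cod C a)" using t T a by simp
  finally show "a = Zer C (Dom C a) (Cod C a)" .
qed

lemma perp_ext_right:
  assumes X: "perp C Z X" and Y: "perp C Z Y" shows "perp C Z (X \<star> Y)"
proof (rule perpI)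
  fix a assume a: "a \<in> Arr C" "Dom C a \<in> Z" "Cod C a \<in> X \<star> Y"
  obtain f g h where T: "(f, g, h) \<in> Tri C" "Dom C f \<in> X" "Cod C f = Cod C a" "Cod C g \<in> Y"
    using a(3) by (rule ext_prodE)
  note t = TriD[OF T(1)]
  have "g \<bullet> a = Zer C (Dom C a) (Cod C g)"
    by (rule perpD[OF Y]) (use a T t in simp_all)
  then obtain s where s: "s \<in> Arr C" "Dom C s = Dom C a" "Cod C s = Dom C f" "f \<bullet> s = a"
    using Tri_lift[OF T(1) a(1)] T by metis
  have "s = Zer C (Dom C a) (Dom C f)"
    by (rule perpD[OF X]) (use a T t s in simp_all)
  then have "a = f \<bullet> Zer C (Dom C a) (Dom C f)" using s by metis
  also have "\<dots> = Zer C (Dom C a) (Cod C a)" using t T a by simp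
  finally show "a = Zer C (Dom C a) (Cod C a)" .
qed

text \<open>A triangle on a zero map \<open>y \<rightarrow> x\<close> splits, so its cone is \<open>x \<oplus> \<Sigma>y\<close>.\<close>

lemma ext_sh_commute:
  assumes "perp C Y X" "Y \<subseteq> Obj C" shows "X \<star> sh Y \<subseteq> sh Y \<star> X"
proof
  fix e assume "e \<in> X \<star> sh Y"
  then obtain f g h where T: "(f, g, h) \<in> Tri C" "Dom C f \<in> Y" "Cod C f \<in> X" "Cod C g = e"
    using assms(2) by (rule ext_sh_rightE)
  note t = TriD[OF T(1)]
  have "f = Zer C (Dom C f) (Cod C f)" by (rule perpD[OF assms(1)]) (use t T in simp_all)
  moreover have "Dom C f \<in> Obj C" "Cod C f \<in> Obj C" using t by simp_all
  ultimately have "Neg C (SigA C f) = Zer C (SigO C (Dom C f)) (SigO C (Cod C f))"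
    by (metis SigA_Zer Neg_Zer SigO_Obj)
  then have "direct_sum C (Cod C f) (SigO C (Dom C f)) e"
    using Tri_split_direct_sum[OF Tri_rot[OF T(1)]] t T by simp
  then obtain i q k where i: "(i, q, k) \<in> Tri C" "Dom C i = SigO C (Dom C f)" "Cod C i = e" "Cod C q = Cod C f"
    using direct_sum_Tri direct_sum_sym by metis
  show "e \<in> sh Y \<star> X"
    by (rule ext_prodI[OF i(1)]) (use i t T in \<open>simp_all add: SigO_mem_sh\<close>)
qed

text \<open>The first orthogonality makes endomorphisms of e descend to y, the second makes the
  descent unique; so the idempotent of e given by a retract descends to an idempotent of y.
  Splitting is demanded for \<open>Y\<close> only: the \<open>X\<close>-part of the retract is
  obtained from a cone, recognised as a retract of \<Sigma>x.\<close>

lemma retract_closed_ext: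
  assumes X: "retract_closed C X" and Y: "retract_closed C Y"
    and XY: "perp C X Y" "perp C (sh X) Y"
    and split: "\<And>b. \<lbrakk>b \<in> Arr C; Dom C b \<in> Y; Cod C b = Dom C b; b \<bullet> b = b\<rbrakk> \<Longrightarrow>
      \<exists>i p. i \<in> Arr C \<and> p \<in> Arr C \<and> Cod C i = Dom C b \<and> Dom C p = Dom C b \<and> Cod C p = Dom C i \<and>
        p \<bullet> i = Idt C (Dom C i) \<and> i \<bullet> p = b"
  shows "retract_closed C (X \<star> Y)"
  unfolding retract_closed_def
proof (intro conjI ballI allI impI)
  show "X \<star> Y \<subseteq> Obj C" by (rule ext_Obj)
  fix e e' assume e: "e \<in> X \<star> Y" and "retract C e' e"
  then obtain s r where s: "s \<in> Arr C" "Dom C s = e'" "Cod C s = e"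
    and r: "r \<in> Arr C" "Dom C r = e" "Cod C r = e'" "r \<bullet> s = Idt C e'"
    by (auto simp: retract_def Hom_iff)
  obtain f g h where T: "(f, g, h) \<in> Tri C" "Dom C f \<in> X" "Cod C f = e" "Cod C g \<in> Y"
    using e by (rule ext_prodE)
  note t = TriD[OF T(1), unfolded T(3)]
  define x y where xy: "x = Dom C f" "y = Cod C g"
  note t = t[folded xy]
  have O: "e \<in> Obj C" "e' \<in> Obj C" "x \<in> Obj C" "y \<in> Obj C" using r t xy by auto
  have XO: "X \<subseteq> Obj C" using X by (auto simp: retract_closed_def)
  define a where "a = g \<bullet> (s \<bullet> r)"
  have a: "a \<in> Arr C" "Dom C a = e" "Cod C a = y" using s r t xy by (simp_all add: a_def)
  have "a \<bullet> f = Zer C x y"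
    by (rule perpD[OF XY(1)]) (use T t a xy in simp_all)
  then obtain b where b: "b \<in> Arr C" "Dom C b = y" "Cod C b = y" "b \<bullet> g = a"
    using Tri_extend[OF T(1) a(1)] a T xy by metis
  \<comment> \<open>The failure of \<open>b\<close> to be idempotent vanishes after composing with
    \<open>g\<close>, so it factors through \<Sigma>x, and there is no nonzero arrow from \<Sigma>x
    to y.\<close>
  define d where "d = Add C (b \<bullet> b) (Neg C b)"
  have d: "d \<in> Arr C" "Dom C d = y" "Cod C d = y" using b by (simp_all add: d_def)
  have bg: "b \<bullet> g = g \<bullet> (s \<bullet> r)" using b a_def by simp
  have rs: "r \<bullet> (s \<bullet> r) = r" using Cmp_eq_Cmp[OF r(4), of r] r s by simp
  have "b \<bullet> (b \<bullet> g) = b \<bullet> g"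
    using Cmp_eq_Cmp[OF bg, of "s \<bullet> r"] b(1-3) t s r rs T xy by (simp add: bg)
  then have "d \<bullet> g = Zer C e y"
    using a b t T O xy by (simp add: d_def)
  then obtain k where k: "k \<in> Arr C" "Dom C k = SigO C x" "Cod C k = y" "k \<bullet> h = d"
    using Tri_extend2[OF T(1) d(1)] d T xy by metis
  have "k = Zer C (SigO C x) y"
    by (rule perpD[OF XY(2)]) (use k T O xy in \<open>simp_all add: SigO_mem_sh\<close>)
  then have "d = Zer C (SigO C x) y \<bullet> h" using k by metis
  then have "d = Zer C y y" using t O xy by simp
  then have bb: "b \<bullet> b = b" unfolding d_def by (rule diff_eq_Zer) (use b in simp_all)
  obtain i p where ip: "i \<in> Arr C" "p \<in> Arr C" "Cod C i = y" "Dom C p = y" "Cod C p = Dom C i"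
    "p \<bullet> i = Idt C (Dom C i)" "i \<bullet> p = b"
    using split[OF b(1) _ _ bb] b T xy by auto
  let ?y' = "Dom C i"
  have y': "?y' \<in> Y"
    by (rule retract_closedD[OF Y retractI[of i _ _ y p]]) (use ip T xy in simp_all)
  \<comment> \<open>The candidate for the second map of a triangle with middle vertex
    \<open>e'\<close>: it is \<open>g\<close> restricted to the images of the two
    idempotents.\<close>
  define g' where "g' = p \<bullet> (g \<bullet> s)"
  have g': "g' \<in> Arr C" "Dom C g' = e'" "Cod C g' = ?y'"
    using ip t T s xy by (simp_all add: g'_def)
  obtain h' k' where T': "(g', h', k') \<in> Tri C" using Tri_cone g' by blast
  note t' = TriD[OF T', unfolded g']
  let ?c = "Cod C h'"
  have "i \<bullet> g' = b \<bullet> (g \<bullet> s)"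
    using Cmp_eq_Cmp[OF ip(7), of "g \<bullet> s"] ip t T s xy by (simp add: g'_def)
  also have "\<dots> = g \<bullet> s"
    using Cmp_eq_Cmp[OF bg, of s] b t T s r xy by simp
  finally have sq1: "i \<bullet> g' = g \<bullet> s" .
  have "g' \<bullet> r = p \<bullet> (b \<bullet> g)" using ip t T s r xy by (simp add: g'_def bg)
  also have "\<dots> = p \<bullet> g"
    using Cmp_eq_Cmp[OF ip(6), of "p \<bullet> g"] ip(1-5) t T xy by (simp flip: ip(7))
  finally have sq2: "p \<bullet> g = g' \<bullet> r" by simp
  note R = Tri_rot[OF T(1)]
  have "\<exists>w \<in> Hom C (Dom C k') (Dom C (Neg C (SigA C f))). w \<bullet> h' = h \<bullet> i \<and>
      Neg C (SigA C f) \<bullet> w = SigA C s \<bullet> k'"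
    by (rule Tri_fill[OF T' R _ _ sq1]) (use ip t t' T s g' xy in \<open>simp_all add: Hom_iff\<close>)
  then obtain w where w: "w \<in> Arr C" "Dom C w = ?c" "Cod C w = SigO C x"
    "w \<bullet> h' = h \<bullet> i" "Neg C (SigA C f) \<bullet> w = SigA C s \<bullet> k'"
    using t t' xy by (auto simp: Hom_iff)
  have "\<exists>w \<in> Hom C (Dom C (Neg C (SigA C f))) (Dom C k'). w \<bullet> h = h' \<bullet> p \<and>
      k' \<bullet> w = SigA C r \<bullet> Neg C (SigA C f)"
    by (rule Tri_fill[OF R T' _ _ sq2]) (use ip t t' T r g' xy in \<open>simp_all add: Hom_iff\<close>)
  then obtain v where v: "v \<in> Arr C" "Dom C v = SigO C x" "Cod C v = ?c"
    "v \<bullet> h = h' \<bullet> p" "k' \<bullet> v = SigA C r \<bullet> Neg C (SigA C f)"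
    using t t' xy by (auto simp: Hom_iff)
  have "(v \<bullet> w) \<bullet> h' = v \<bullet> (h \<bullet> i)" using v w t t' by simp
  also have "\<dots> = h' \<bullet> (p \<bullet> i)"
    using Cmp_eq_Cmp[OF v(4), of i] v t ip t' xy by simp
  also have "\<dots> = h'" using ip t' by simp
  finally have vw1: "(v \<bullet> w) \<bullet> h' = h'" .
  have "k' \<bullet> (v \<bullet> w) = (SigA C r \<bullet> Neg C (SigA C f)) \<bullet> w"
    by (rule Cmp_eq_Cmp[OF v(5)]) (use v w t' in simp_all)
  also have "\<dots> = SigA C r \<bullet> (Neg C (SigA C f) \<bullet> w)"
    by (rule Cmp_assoc_simp) (use w t r T xy in simp_all)
  also have "\<dots> = SigA C r \<bullet> (SigA C s \<bullet> k')" by (simp only: w(5))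
  also have "\<dots> = k'"
    using Cmp_eq_Cmp[of "SigA C r" "SigA C s" "Idt C (SigO C e')" k'] SigA_Cmp_simp[of s r] r s t' O
    by simp
  finally have vw2: "k' \<bullet> (v \<bullet> w) = k'" .
  \<comment> \<open>Fillers do not compose functorially, so \<open>v \<bullet> w\<close> need not be
    the identity; being compatible with \<open>h'\<close> and \<open>k'\<close> it is still
    invertible, which is enough for a retraction.\<close>
  have "iso_arr C (v \<bullet> w)"
    by (rule Tri_endo_iso[OF T']) (use v w vw1 vw2 in simp_all)
  then obtain n where n: "n \<in> Arr C" "Dom C n = ?c" "Cod C n = ?c" "n \<bullet> (v \<bullet> w) = Idt C ?c"
    using v w by (auto elim!: iso_arrE)
  have "retract C ?c (SigO C x)"
    by (rule retractI[of w _ _ _ "n \<bullet> v"]) (use n v w in simp_all)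
  moreover have "SigO C x \<in> sh X" using T O xy by (simp add: SigO_mem_sh)
  ultimately have "?c \<in> sh X" using retract_closedD[OF retract_closed_sh[OF X]] by blast
  then have "Dom C g' \<in> X \<star> Y"
    by (rule Tri_cocone_ext[OF T' XO]) (use g' y' in simp)
  then show "e' \<in> X \<star> Y" using g' by simp
qed

end

section \<open>Kernels and cokernels\<close>

context preadditive_category
begin

lemma is_kernelD:
  assumes "is_kernel C k f"
  shows "k \<in> Arr C" "f \<in> Arr C" "Dom C f = Cod C k" "f \<bullet> k = Zer C (Dom C k) (Cod C f)"
  using assms by (simp_all add: is_kernel_def)

lemma kernel_lift:
  assumes "is_kernel C k f" "a \<in> Arr C" "Cod C a = Cod C k" "f \<bullet> a = Zer C (Dom C a) (Cod C f)"
  obtains s where "s \<in> Arr C" "Dom C s = Dom C a" "Cod C s = Dom C k" "k \<bullet> s = a"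
  using assms unfolding is_kernel_def by (metis (no_types, lifting) Hom_iff)

lemma kernel_cancel:
  assumes K: "is_kernel C k f" and s: "s \<in> Arr C" "Cod C s = Dom C k"
    and s': "s' \<in> Arr C" "Cod C s' = Dom C k" "Dom C s' = Dom C s" and eq: "k \<bullet> s = k \<bullet> s'"
  shows "s = s'"
proof -
  note k = is_kernelD[OF K]
  have "f \<bullet> (k \<bullet> s) = Zer C (Dom C s) (Cod C f)"
    using Cmp_eq_Cmp[OF k(4), of s] k s by simp
  moreover have "k \<bullet> s \<in> Hom C (Dom C s) (Dom C f)" using k s by (simp add: Hom_iff)
  ultimately have "\<exists>!r. r \<in> Hom C (Dom C s) (Dom C k) \<and> k \<bullet> r = k \<bullet> s"
    using K unfolding is_kernel_def by blast
  moreover have "s \<in> Hom C (Dom C s) (Dom C k)" "s' \<in> Hom C (Dom C s) (Dom C k)"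
    using s s' by (simp_all add: Hom_iff)
  ultimately show ?thesis using eq by metis
qed

lemma is_kernelI:
  assumes k: "k \<in> Arr C" "f \<in> Arr C" "Dom C f = Cod C k" "f \<bullet> k = Zer C (Dom C k) (Cod C f)"
    and lift: "\<And>a. \<lbrakk>a \<in> Arr C; Cod C a = Cod C k; f \<bullet> a = Zer C (Dom C a) (Cod C f)\<rbrakk> \<Longrightarrow>
      \<exists>s. s \<in> Arr C \<and> Dom C s = Dom C a \<and> Cod C s = Dom C k \<and> k \<bullet> s = a"
    and mono: "\<And>s. \<lbrakk>s \<in> Arr C; Cod C s = Dom C k; k \<bullet> s = Zer C (Dom C s) (Cod C k)\<rbrakk> \<Longrightarrow>
      s = Zer C (Dom C s) (Dom C k)"
  shows "is_kernel C k f"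
proof -
  have "s = s'" if s: "s \<in> Arr C" "Cod C s = Dom C k" "s' \<in> Arr C" "Cod C s' = Dom C k"
    "Dom C s = Dom C s'" "k \<bullet> s = k \<bullet> s'" for s s'
  proof -
    have "Add C s (Neg C s') = Zer C (Dom C s') (Dom C k)"
      using mono[of "Add C s (Neg C s')"] s k by simp
    then show ?thesis by (rule diff_eq_Zer) (use s in simp_all)
  qed
  note inj = this
  show ?thesis
    unfolding is_kernel_def
  proof (intro conjI allI ballI impI)
    fix w t assume t0: "t \<in> Hom C w (Dom C f)" "f \<bullet> t = Zer C w (Cod C f)"
    have t: "t \<in> Arr C" "Dom C t = w" "Cod C t = Cod C k" using t0 k by (simp_all add: Hom_iff)
    obtain s where s: "s \<in> Arr C" "Dom C s = w" "Cod C s = Dom C k" "k \<bullet> s = t"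
      using lift[of t] t t0(2) by auto
    show "\<exists>!s. s \<in> Hom C w (Dom C k) \<and> k \<bullet> s = t"
    proof (rule ex1I[of _ s])
      show "s \<in> Hom C w (Dom C k) \<and> k \<bullet> s = t" using s by (simp add: Hom_iff)
      fix s' assume "s' \<in> Hom C w (Dom C k) \<and> k \<bullet> s' = t"
      then show "s' = s" using s by - (rule inj, simp_all add: Hom_iff)
    qed
  qed (use k in simp_all)
qed

lemma is_cokernelD:
  assumes "is_cokernel C c f"
  shows "c \<in> Arr C" "f \<in> Arr C" "Dom C c = Cod C f" "c \<bullet> f = Zer C (Dom C f) (Cod C c)"
  using assms by (simp_all add: is_cokernel_def)

lemma cokernel_extend:
  assumes "is_cokernel C c f" "a \<in> Arr C" "Dom C a = Cod C f" "a \<bullet> f = Zer C (Dom C f) (Cod C a)"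
  obtains s where "s \<in> Arr C" "Dom C s = Cod C c" "Cod C s = Cod C a" "s \<bullet> c = a"
  using assms unfolding is_cokernel_def by (metis (no_types, lifting) Hom_iff)

lemma cokernel_cancel:
  assumes K: "is_cokernel C c f" and s: "s \<in> Arr C" "Dom C s = Cod C c"
    and s': "s' \<in> Arr C" "Dom C s' = Cod C c" "Cod C s' = Cod C s" and eq: "s \<bullet> c = s' \<bullet> c"
  shows "s = s'"
proof -
  note k = is_cokernelD[OF K]
  have "(s \<bullet> c) \<bullet> f = Zer C (Dom C f) (Cod C s)"
    using k s by simp
  moreover have "s \<bullet> c \<in> Hom C (Cod C f) (Cod C s)" using k s by (simp add: Hom_iff)
  ultimately have "\<exists>!r. r \<in> Hom C (Cod C c) (Cod C s) \<and> r \<bullet> c = s \<bullet> c"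
    using K unfolding is_cokernel_def by blast
  moreover have "s \<in> Hom C (Cod C c) (Cod C s)" "s' \<in> Hom C (Cod C c) (Cod C s)"
    using s s' by (simp_all add: Hom_iff)
  ultimately show ?thesis using eq by metis
qed

lemma is_cokernelI:
  assumes k: "c \<in> Arr C" "f \<in> Arr C" "Dom C c = Cod C f" "c \<bullet> f = Zer C (Dom C f) (Cod C c)"
    and ext: "\<And>a. \<lbrakk>a \<in> Arr C; Dom C a = Cod C f; a \<bullet> f = Zer C (Dom C f) (Cod C a)\<rbrakk> \<Longrightarrow>
      \<exists>s. s \<in> Arr C \<and> Dom C s = Cod C c \<and> Cod C s = Cod C a \<and> s \<bullet> c = a"
    and epi: "\<And>s. \<lbrakk>s \<in> Arr C; Dom C s = Cod C c; s \<bullet> c = Zer C (Cod C f) (Cod C s)\<rbrakk> \<Longrightarrow>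
      s = Zer C (Cod C c) (Cod C s)"
  shows "is_cokernel C c f"
proof -
  have "s = s'" if s: "s \<in> Arr C" "Dom C s = Cod C c" "s' \<in> Arr C" "Dom C s' = Cod C c"
    "Cod C s = Cod C s'" "s \<bullet> c = s' \<bullet> c" for s s'
  proof -
    have "Add C s (Neg C s') = Zer C (Cod C c) (Cod C s')"
      using epi[of "Add C s (Neg C s')"] s k by simp
    then show ?thesis by (rule diff_eq_Zer) (use s in simp_all)
  qed
  note inj = this
  show ?thesis
    unfolding is_cokernel_def
  proof (intro conjI allI ballI impI)
    fix w t assume t0: "t \<in> Hom C (Cod C f) w" "t \<bullet> f = Zer C (Dom C f) w"
    have t: "t \<in> Arr C" "Cod C t = w" "Dom C t = Cod C f" using t0 k by (simp_all add: Hom_iff)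
    obtain s where s: "s \<in> Arr C" "Dom C s = Cod C c" "Cod C s = w" "s \<bullet> c = t"
      using ext[of t] t t0(2) by auto
    show "\<exists>!s. s \<in> Hom C (Cod C c) w \<and> s \<bullet> c = t"
    proof (rule ex1I[of _ s])
      show "s \<in> Hom C (Cod C c) w \<and> s \<bullet> c = t" using s by (simp add: Hom_iff)
      fix s' assume "s' \<in> Hom C (Cod C c) w \<and> s' \<bullet> c = t"
      then show "s' = s" using s by - (rule inj, simp_all add: Hom_iff)
    qed
  qed (use k in simp_all)
qed

lemma mono_arrI:
  assumes f: "f \<in> Arr C"
    and mono: "\<And>s. \<lbrakk>s \<in> Arr C; Cod C s = Dom C f; f \<bullet> s = Zer C (Dom C s) (Cod C f)\<rbrakk> \<Longrightarrow>
      s = Zer C (Dom C s) (Dom C f)"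
  shows "mono_arr C f"
proof -
  have "s = s'" if s: "s \<in> Arr C" "Cod C s = Dom C f" "s' \<in> Arr C" "Cod C s' = Dom C f"
    "Dom C s = Dom C s'" "f \<bullet> s = f \<bullet> s'" for s s'
  proof -
    have "Add C s (Neg C s') = Zer C (Dom C s') (Dom C f)"
      using mono[of "Add C s (Neg C s')"] s f by simp
    then show ?thesis by (rule diff_eq_Zer) (use s in simp_all)
  qed
  then show ?thesis using f by (auto simp: mono_arr_def Hom_iff)
qed

lemma mono_arr_cancel:
  "\<lbrakk>mono_arr C f; s \<in> Arr C; s' \<in> Arr C; Cod C s = Dom C f; Cod C s' = Dom C f; Dom C s = Dom C s';
    f \<bullet> s = f \<bullet> s'\<rbrakk> \<Longrightarrow> s = s'"
  unfolding mono_arr_def by (metis Hom_iff)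

lemma epi_arr_cancel:
  "\<lbrakk>epi_arr C f; s \<in> Arr C; s' \<in> Arr C; Dom C s = Cod C f; Dom C s' = Cod C f; Cod C s = Cod C s';
    s \<bullet> f = s' \<bullet> f\<rbrakk> \<Longrightarrow> s = s'"
  unfolding epi_arr_def by (metis Hom_iff)

lemma kernel_mono: "is_kernel C k f \<Longrightarrow> mono_arr C k"
  using kernel_cancel is_kernelD(1) by (simp add: mono_arr_def Hom_iff)

lemma cokernel_epi: "is_cokernel C c f \<Longrightarrow> epi_arr C c"
  using cokernel_cancel is_cokernelD(1) by (simp add: epi_arr_def Hom_iff)

lemma epi_arr_Cmp:
  assumes "epi_arr C f" "epi_arr C g" "Cod C f = Dom C g" shows "epi_arr C (g \<bullet> f)"
proof -
  have fg: "f \<in> Arr C" "g \<in> Arr C" using assms by (auto simp: epi_arr_def)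
  have "s = s'" if s: "s \<in> Arr C" "Dom C s = Cod C g" "s' \<in> Arr C" "Dom C s' = Cod C g"
    "Cod C s = Cod C s'" "s \<bullet> (g \<bullet> f) = s' \<bullet> (g \<bullet> f)" for s s'
  proof -
    have "s \<bullet> g = s' \<bullet> g"
      by (rule epi_arr_cancel[OF assms(1)]) (use s fg assms(3) in simp_all)
    then show ?thesis
      by (rule epi_arr_cancel[OF assms(2), rotated -1]) (use s in simp_all)
  qed
  then show ?thesis using fg assms(3) by (auto simp: epi_arr_def Hom_iff)
qed

end

section \<open>Short exact sequences, images and idempotents in an abelian category\<close>

context abelian_category
begin

text \<open>A monomorphism is the kernel of some \<open>g\<close>, and \<open>g\<close> factors
  through the cokernel of the monomorphism; so whatever the cokernel kills is killed by
  \<open>g\<close> and lifts.\<close>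

lemma mono_short_exact:
  assumes "mono_arr C k" obtains c where "short_exact C k c"
proof -
  obtain g where g: "is_kernel C k g" using mono_is_kernel[OF assms] by blast
  obtain c where c: "is_cokernel C c k" using ex_cokernel is_kernelD(1)[OF g] by blast
  note k = is_kernelD[OF g] is_cokernelD[OF c]
  obtain g' where g': "g' \<in> Arr C" "Dom C g' = Cod C c" "Cod C g' = Cod C g" "g' \<bullet> c = g"
    using cokernel_extend[OF c k(2,3,4)] by blast
  have "is_kernel C k c"
  proof (rule is_kernelI)
    fix a assume a: "a \<in> Arr C" "Cod C a = Cod C k" "c \<bullet> a = Zer C (Dom C a) (Cod C c)"
    have "g \<bullet> a = Zer C (Dom C a) (Cod C g)"
      using Cmp_eq_Cmp[OF g'(4), of a] g' a k by simp
    then show "\<exists>s. s \<in> Arr C \<and> Dom C s = Dom C a \<and> Cod C s = Dom C k \<and> k \<bullet> s = a"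
      using kernel_lift[OF g a(1,2)] by metis
  next
    fix s assume "s \<in> Arr C" "Cod C s = Dom C k" "k \<bullet> s = Zer C (Dom C s) (Cod C k)"
    then show "s = Zer C (Dom C s) (Dom C k)"
      using kernel_cancel[OF g, of s "Zer C (Dom C s) (Dom C k)"] k by simp
  qed (use k in simp_all)
  then show ?thesis using that c by (simp add: short_exact_def)
qed

lemma epi_short_exact:
  assumes "epi_arr C c" obtains k where "short_exact C k c"
proof -
  obtain g where g: "is_cokernel C c g" using epi_is_cokernel[OF assms] by blast
  obtain k where k: "is_kernel C k c" using ex_kernel is_cokernelD(1)[OF g] by blast
  note kk = is_kernelD[OF k] is_cokernelD[OF g]
  have "Cod C g = Cod C k" using kk by simp
  then obtain g' where g': "g' \<in> Arr C" "Dom C g' = Dom C g" "Cod C g' = Dom C k" "k \<bullet> g' = g"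
    using kernel_lift[OF k kk(6) _ kk(8)] by blast
  have "is_cokernel C c k"
  proof (rule is_cokernelI)
    fix a assume a: "a \<in> Arr C" "Dom C a = Cod C k" "a \<bullet> k = Zer C (Dom C k) (Cod C a)"
    have "a \<bullet> g = Zer C (Dom C g) (Cod C a)"
      using Cmp_eq_Cmp[OF a(3), of g'] g' a kk by simp
    then show "\<exists>s. s \<in> Arr C \<and> Dom C s = Cod C c \<and> Cod C s = Cod C a \<and> s \<bullet> c = a"
      using cokernel_extend[OF g a(1)] a(2) kk by metis
  next
    fix s assume "s \<in> Arr C" "Dom C s = Cod C c" "s \<bullet> c = Zer C (Cod C k) (Cod C s)"
    then show "s = Zer C (Cod C c) (Cod C s)"
      using cokernel_cancel[OF g, of s "Zer C (Cod C c) (Cod C s)"] kk by simp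
  qed (use kk in simp_all)
  then show ?thesis using that k by (simp add: short_exact_def)
qed

text \<open>
  If \<open>q\<close> is the cokernel of the kernel of \<open>f\<close> and \<open>f = m q\<close>, then \<open>m\<close> is monic: for \<open>m s = 0\<close>
  let \<open>e\<close> be the cokernel of \<open>s\<close>; then \<open>e q\<close> is an epimorphism with the same kernel as \<open>q\<close>,
  so \<open>e\<close> is split monic, while \<open>e s = 0\<close>.
\<close>

lemma epi_mono_factorization:
  assumes f: "f \<in> Arr C"
  obtains k q m c where "short_exact C k q" "short_exact C m c" "Cod C q = Dom C m" "m \<bullet> q = f"
    "Cod C k = Dom C f" "Cod C m = Cod C f"
proof -
  obtain k where k: "is_kernel C k f" using ex_kernel[OF f] by blast
  note kf = is_kernelD[OF k]
  obtain q where sq: "short_exact C k q" using mono_short_exact[OF kernel_mono[OF k]] by blast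
  then have q: "is_cokernel C q k" and kq: "is_kernel C k q" by (auto simp: short_exact_def)
  note qk = is_cokernelD[OF q]
  obtain m where m: "m \<in> Arr C" "Dom C m = Cod C q" "Cod C m = Cod C f" "m \<bullet> q = f"
    using cokernel_extend[OF q f kf(3,4)] by blast
  have "mono_arr C m"
  proof (rule mono_arrI[OF m(1)])
    fix s assume s: "s \<in> Arr C" "Cod C s = Dom C m" "m \<bullet> s = Zer C (Dom C s) (Cod C m)"
    obtain e where e: "is_cokernel C e s" using ex_cokernel[OF s(1)] by blast
    note es = is_cokernelD[OF e]
    obtain m' where m': "m' \<in> Arr C" "Dom C m' = Cod C e" "Cod C m' = Cod C m" "m' \<bullet> e = m"
      using cokernel_extend[OF e m(1) _ s(3)] s(2) by metis
    have "epi_arr C (e \<bullet> q)"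
      by (rule epi_arr_Cmp[OF cokernel_epi[OF q] cokernel_epi[OF e]]) (use es s m in simp)
    then obtain k' where "short_exact C k' (e \<bullet> q)" using epi_short_exact by blast
    then have k': "is_kernel C k' (e \<bullet> q)" "is_cokernel C (e \<bullet> q) k'" by (auto simp: short_exact_def)
    note kk' = is_kernelD[OF k'(1)]
    have d: "Dom C q = Cod C k'" "Cod C q = Dom C e" "Dom C e = Dom C m"
      using kk' es qk s m by simp_all
    have "m' \<bullet> (e \<bullet> q) = f"
      using Cmp_eq_Cmp[OF m'(4), of q] m' es qk d m(4) by simp
    moreover have "(m' \<bullet> (e \<bullet> q)) \<bullet> k' = m' \<bullet> ((e \<bullet> q) \<bullet> k')"
      by (rule Cmp_assoc_simp) (use m' kk' es qk d in simp_all)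
    ultimately have "f \<bullet> k' = m' \<bullet> ((e \<bullet> q) \<bullet> k')" by simp
    also have "\<dots> = Zer C (Dom C k') (Cod C f)"
      unfolding kk'(4) using m' kk' m es qk d by simp
    finally obtain l where l: "l \<in> Arr C" "Dom C l = Dom C k'" "Cod C l = Dom C k" "k \<bullet> l = k'"
      using kernel_lift[OF k kk'(1)] kk' qk d by metis
    have "q \<bullet> k' = Zer C (Dom C k') (Cod C q)"
      using Cmp_eq_Cmp[OF qk(4), of l] l qk kf by simp
    then obtain r where r: "r \<in> Arr C" "Dom C r = Cod C (e \<bullet> q)" "Cod C r = Cod C q" "r \<bullet> (e \<bullet> q) = q"
      using cokernel_extend[OF k'(2) qk(1)] d by metis
    have re: "r \<bullet> e = Idt C (Cod C q)"
      by (rule cokernel_cancel[OF q]) (use r es qk d in simp_all)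
    have "s = (r \<bullet> e) \<bullet> s" using re s m by simp
    also have "\<dots> = r \<bullet> (e \<bullet> s)"
      by (rule Cmp_assoc_simp) (use r es qk d s in simp_all)
    also have "\<dots> = Zer C (Dom C s) (Dom C m)"
      unfolding es(4) using r(1-3) es(1,2) qk(1) s(1,2) m(1) d by simp
    finally show "s = Zer C (Dom C s) (Dom C m)" .
  qed
  then obtain c where "short_exact C m c" using mono_short_exact by blast
  then show ?thesis using that sq m kf by metis
qed

text \<open>The image of \<open>b\<close> is the kernel of 1 - b; \<open>b\<close> itself factors
  through it, which gives the projection.\<close>

lemma idempotent_split:
  assumes b: "b \<in> Arr C" "Cod C b = Dom C b" "b \<bullet> b = b"
  obtains i p where "i \<in> Arr C" "p \<in> Arr C" "Cod C i = Dom C b" "Dom C p = Dom C b"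
    "Cod C p = Dom C i" "p \<bullet> i = Idt C (Dom C i)" "i \<bullet> p = b"
proof -
  let ?y = "Dom C b"
  have y: "?y \<in> Obj C" using b by simp
  define d where "d = Add C (Idt C ?y) (Neg C b)"
  have d: "d \<in> Arr C" "Dom C d = ?y" "Cod C d = ?y" using b y by (simp_all add: d_def)
  obtain i where i: "is_kernel C i d" using ex_kernel[OF d(1)] by blast
  note ii = is_kernelD[OF i]
  have "d \<bullet> b = Zer C (Dom C b) (Cod C d)" using b y by (simp add: d_def)
  then obtain p where p: "p \<in> Arr C" "Dom C p = ?y" "Cod C p = Dom C i" "i \<bullet> p = b"
    using kernel_lift[OF i b(1)] b ii d by metis
  have ci: "Cod C i = ?y" using ii d by simp
  have "Add C i (Neg C (b \<bullet> i)) = Zer C (Dom C i) ?y"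
    using ii(4) ii(1) b y d ci by (simp add: d_def)
  then have "i = b \<bullet> i" by (rule diff_eq_Zer) (use ii b ci in simp_all)
  then have "i \<bullet> (p \<bullet> i) = i \<bullet> Idt C (Dom C i)"
    using Cmp_eq_Cmp[OF p(4), of i] p ii ci by simp
  then have "p \<bullet> i = Idt C (Dom C i)"
    by - (rule kernel_cancel[OF i], use p ii ci in simp_all)
  then show ?thesis using that ii p ci by metis
qed

end

section \<open>Full subcategories and vanishing of morphisms\<close>

lemma full_sub_simps [simp]:
  "Obj (full_sub C X) = X" "Dom (full_sub C X) = Dom C" "Cod (full_sub C X) = Cod C"
  "Idt (full_sub C X) = Idt C" "Cmp (full_sub C X) = Cmp C"
  "Arr (full_sub C X) = {f \<in> Arr C. Dom C f \<in> X \<and> Cod C f \<in> X}"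
  by (simp_all add: full_sub_def)

lemma full_sub_add_simps [simp]:
  "Zer (full_sub C X) = Zer C" "Add (full_sub C X) = Add C"
  by (simp_all add: full_sub_def)

lemma Hom_full_sub: "Hom (full_sub C X) x y = (if x \<in> X \<and> y \<in> X then Hom C x y else {})"
  by (auto simp: Hom_def)

context preadditive_category
begin

lemma full_sub_preadditive:
  assumes X: "X \<subseteq> Obj C" shows "preadditive_category (full_sub C X)"
proof (intro preadditive_category.intro preadditive_category_axioms.intro category.intro)
  fix f assume "f \<in> Arr (full_sub C X)"
  then show "Dom (full_sub C X) f \<in> Obj (full_sub C X)" "Cod (full_sub C X) f \<in> Obj (full_sub C X)"
    by simp_all
next
  fix x y assume "x \<in> Obj (full_sub C X)" "y \<in> Obj (full_sub C X)"
  then have xy: "x \<in> X" "y \<in> X" by simp_all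
  then have "hom_group (full_sub C X) x y = hom_group C x y"
    by (simp add: hom_group_def Hom_full_sub)
  then show "comm_group (hom_group (full_sub C X) x y)"
    using hom_comm_group[of x y] xy X by auto
qed (use X in \<open>auto simp: Hom_full_sub Hom_iff split: if_splits\<close>)

lemma zero_obj_full_sub:
  assumes "X \<subseteq> Obj C" shows "zero_obj (full_sub C X) z \<longleftrightarrow> z \<in> X \<and> zero_obj C z"
  using assms preadditive_category.zero_obj_iff[OF full_sub_preadditive[OF assms]]
  by (auto simp: zero_obj_iff)

lemma direct_sum_full_sub:
  "X \<subseteq> Obj C \<Longrightarrow> x \<in> X \<Longrightarrow> y \<in> X \<Longrightarrow> s \<in> X \<Longrightarrow> direct_sum (full_sub C X) x y s \<longleftrightarrow> direct_sum C x y s"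
  by (auto simp: direct_sum_def Hom_full_sub)

lemma perp_isomorphic:
  assumes "isomorphic C x x'" "isomorphic C y y'" and p: "perp C {x} {y}"
  shows "perp C {x'} {y'}"
proof (rule perpI)
  fix f assume f: "f \<in> Arr C" "Dom C f \<in> {x'}" "Cod C f \<in> {y'}"
  obtain u u' where u: "u \<in> Arr C" "Dom C u = x" "Cod C u = x'" "u' \<in> Arr C" "Dom C u' = x'"
    "Cod C u' = x" "u \<bullet> u' = Idt C x'"
    using assms(1) by (rule isomorphicE)
  obtain v v' where v: "v \<in> Arr C" "Dom C v = y" "Cod C v = y'" "v' \<in> Arr C" "Dom C v' = y'"
    "Cod C v' = y" "v \<bullet> v' = Idt C y'"
    using assms(2) by (rule isomorphicE)
  have xy: "x \<in> Obj C" "y \<in> Obj C" "x' \<in> Obj C" "y' \<in> Obj C" using u v by auto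
  have z: "v' \<bullet> (f \<bullet> u) = Zer C x y"
    by (rule perpD[OF p]) (use u v f in simp_all)
  have "f = v \<bullet> ((v' \<bullet> (f \<bullet> u)) \<bullet> u')"
    using u v f Cmp_eq_Cmp[OF v(7), of f] by simp
  also have "\<dots> = Zer C (Dom C f) (Cod C f)"
    unfolding z using u v f xy by simp
  finally show "f = Zer C (Dom C f) (Cod C f)" .
qed

end

lemma perp_pointwise: "perp C X Y \<longleftrightarrow> (\<forall>x \<in> X. \<forall>y \<in> Y. perp C {x} {y})"
  by (auto simp: perp_def)

context triangulated_category
begin

section \<open>Orthogonality under suspension, and condition E_n\<close>

lemma perp_SigO:
  assumes "x \<in> Obj C" "y \<in> Obj C"
  shows "perp C {SigO C x} {SigO C y} \<longleftrightarrow> perp C {x} {y}"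
proof
  assume p: "perp C {SigO C x} {SigO C y}"
  show "perp C {x} {y}"
  proof (rule perpI)
    fix f assume f: "f \<in> Arr C" "Dom C f \<in> {x}" "Cod C f \<in> {y}"
    have "SigA C f = Zer C (SigO C x) (SigO C y)"
      by (rule perpD[OF p]) (use f in simp_all)
    then have "f = Zer C x y" by (rule SigA_eq_Zer) (use f in simp_all)
    then show "f = Zer C (Dom C f) (Cod C f)" using f by simp
  qed
next
  assume p: "perp C {x} {y}"
  show "perp C {SigO C x} {SigO C y}"
  proof (rule perpI)
    fix f assume f: "f \<in> Arr C" "Dom C f \<in> {SigO C x}" "Cod C f \<in> {SigO C y}"
    obtain g where g: "g \<in> Arr C" "Dom C g = x" "Cod C g = y" "SigA C g = f"
      using SigA_full[of f x y] f assms by auto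
    have "g = Zer C x y" by (rule perpD[OF p]) (use g in simp_all)
    then have "f = SigA C (Zer C x y)" using g by metis
    then show "f = Zer C (Dom C f) (Cod C f)" using assms f by simp
  qed
qed

lemma perp_sh:
  assumes p: "perp C X Y" and O: "X \<subseteq> Obj C" "Y \<subseteq> Obj C" shows "perp C (sh X) (sh Y)"
  unfolding perp_pointwise[of C "sh X"]
proof (intro ballI)
  fix a b assume "a \<in> sh X" "b \<in> sh Y"
  then obtain x y where xy: "x \<in> X" "isomorphic C a (SigO C x)" "y \<in> Y" "isomorphic C b (SigO C y)"
    by (auto simp: mem_sh)
  have "perp C {x} {y}" using p xy by (auto simp: perp_def)
  then have "perp C {SigO C x} {SigO C y}" using perp_SigO[of x y] xy O by auto
  then show "perp C {a} {b}"
    by (rule perp_isomorphic[OF isomorphic_sym[OF xy(2)] isomorphic_sym[OF xy(4)]])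
qed

lemma SigO_funpow_Obj: "x \<in> Obj C \<Longrightarrow> (SigO C ^^ k) x \<in> Obj C"
  by (induction k) auto

text \<open>Iterating \<open>sh\<close> closes up under isomorphism at every stage; since \<Sigma>
  preserves isomorphisms, this gives nothing more than applying \<Sigma>^k to objects and closing up
  once.\<close>

lemma mem_funpow_sh:
  assumes "X \<subseteq> Obj C" "iso_closed C X"
  shows "c \<in> (sh ^^ k) X \<longleftrightarrow> (\<exists>x \<in> X. isomorphic C c ((SigO C ^^ k) x))"
proof (induction k arbitrary: c)
  case 0
  have "c \<in> X" if "x \<in> X" "isomorphic C c x" for x
    using that assms(2) isomorphic_sym[OF that(2)] isomorphic_Obj[OF that(2)]
    unfolding iso_closed_def by blast
  moreover have "isomorphic C c c" if "c \<in> X" using that assms(1) by auto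
  ultimately have "c \<in> X \<longleftrightarrow> (\<exists>x \<in> X. isomorphic C c x)" by blast
  then show ?case by simp
next
  case (Suc k)
  have "c \<in> (sh ^^ Suc k) X \<longleftrightarrow> (\<exists>d \<in> (sh ^^ k) X. isomorphic C c (SigO C d))"
    by (simp add: mem_sh)
  also have "\<dots> \<longleftrightarrow> (\<exists>x \<in> X. isomorphic C c (SigO C ((SigO C ^^ k) x)))"
  proof
    assume "\<exists>d \<in> (sh ^^ k) X. isomorphic C c (SigO C d)"
    then show "\<exists>x \<in> X. isomorphic C c (SigO C ((SigO C ^^ k) x))"
      unfolding Bex_def Suc using SigO_isomorphic isomorphic_trans by blast
  next
    assume "\<exists>x \<in> X. isomorphic C c (SigO C ((SigO C ^^ k) x))"
    then obtain x where x: "x \<in> X" "isomorphic C c (SigO C ((SigO C ^^ k) x))" by blast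
    have "(SigO C ^^ k) x \<in> (sh ^^ k) X"
      unfolding Suc using x assms(1) SigO_funpow_Obj isomorphic_refl by blast
    then show "\<exists>d \<in> (sh ^^ k) X. isomorphic C c (SigO C d)" using x by blast
  qed
  finally show ?case by simp
qed

lemma funpow_sh_Obj: "X \<subseteq> Obj C \<Longrightarrow> (sh ^^ k) X \<subseteq> Obj C"
  by (cases k) (auto simp: sh_Obj[THEN subsetD])

lemma SigO_funpow_ess_surj:
  "y \<in> Obj C \<Longrightarrow> \<exists>x \<in> Obj C. isomorphic C ((SigO C ^^ k) x) y"
proof (induction k arbitrary: y)
  case 0
  then show ?case by (intro bexI[of _ y]) simp_all
next
  case (Suc k)
  obtain x where x: "x \<in> Obj C" "isomorphic C (SigO C x) y" using SigO_ess_surj[OF Suc.prems] by blast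
  obtain w where w: "w \<in> Obj C" "isomorphic C ((SigO C ^^ k) w) x" using Suc.IH[OF x(1)] by blast
  have "isomorphic C ((SigO C ^^ Suc k) w) y"
    using isomorphic_trans[OF SigO_isomorphic[OF w(2)] x(2)] by simp
  then show ?case using w by blast
qed

lemma perp_SigO_funpow:
  "x \<in> Obj C \<Longrightarrow> y \<in> Obj C \<Longrightarrow> perp C {(SigO C ^^ k) x} {(SigO C ^^ k) y} \<longleftrightarrow> perp C {x} {y}"
  by (induction k) (simp_all add: perp_SigO SigO_funpow_Obj)

text \<open>
  Applying \<open>\<Sigma>\<^sup>k\<close> turns the vanishing of \<open>C(X, \<Sigma>\<^sup>-\<^sup>k X)\<close> into that of \<open>C(\<Sigma>\<^sup>k X, X)\<close>, so that
  only positive shifts occur.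
\<close>

lemma E_cond_iff:
  assumes O: "X \<subseteq> Obj C" and I: "iso_closed C X"
  shows "E_cond C n X \<longleftrightarrow> (\<forall>k \<ge> 1. enat k \<le> n \<longrightarrow> perp C ((sh ^^ k) X) X)"
proof
  assume E: "E_cond C n X"
  show "\<forall>k \<ge> 1. enat k \<le> n \<longrightarrow> perp C ((sh ^^ k) X) X"
  proof (intro allI impI)
    fix k :: nat assume k: "k \<ge> 1" "enat k \<le> n"
    show "perp C ((sh ^^ k) X) X"
      unfolding perp_pointwise[of C "(sh ^^ k) X"]
    proof (intro ballI)
      fix c b assume c: "c \<in> (sh ^^ k) X" and b: "b \<in> X"
      obtain x where x: "x \<in> X" "isomorphic C c ((SigO C ^^ k) x)"
        using c by (auto simp: mem_funpow_sh[OF O I])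
      obtain y where y: "y \<in> Obj C" "isomorphic C ((SigO C ^^ k) y) b"
        using SigO_funpow_ess_surj b O by blast
      have "y \<in> shift C (- int k) X" using y b k by (auto simp: shift_def)
      moreover have "- int k < 0 \<and> enat (nat (- (- int k))) < n + 1"
        using k by (cases n) (auto simp: one_enat_def)
      ultimately have "Hom C x y = {Zer C x y}" using E x(1) unfolding E_cond_def by blast
      then have "perp C {x} {y}" by (simp add: perp_def)
      then have "perp C {(SigO C ^^ k) x} {(SigO C ^^ k) y}"
        using perp_SigO_funpow[of x y k] x y O by auto
      then show "perp C {c} {b}"
        by (rule perp_isomorphic[OF isomorphic_sym[OF x(2)] y(2)])
    qed
  qed
next
  assume P: "\<forall>k \<ge> 1. enat k \<le> n \<longrightarrow> perp C ((sh ^^ k) X) X"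
  show "E_cond C n X"
    unfolding E_cond_def
  proof (intro allI impI ballI)
    fix i :: int and x y
    assume i: "i < 0 \<and> enat (nat (- i)) < n + 1" and x: "x \<in> X" and y: "y \<in> shift C i X"
    define k where "k = nat (- i)"
    have k: "k \<ge> 1" "enat k \<le> n" using i by (cases n; auto simp: one_enat_def k_def)+
    obtain b where b: "y \<in> Obj C" "b \<in> X" "isomorphic C ((SigO C ^^ k) y) b"
      using y i by (auto simp: shift_def k_def)
    have xO: "x \<in> Obj C" using x O by blast
    have "(SigO C ^^ k) x \<in> (sh ^^ k) X"
      unfolding mem_funpow_sh[OF O I] using x xO SigO_funpow_Obj isomorphic_refl by blast
    then have "perp C {(SigO C ^^ k) x} {b}" using P k b by (auto simp: perp_def)
    then have "perp C {(SigO C ^^ k) x} {(SigO C ^^ k) y}"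
      by (rule perp_isomorphic[OF isomorphic_refl[OF SigO_funpow_Obj[OF xO]] isomorphic_sym[OF b(3)]])
    then have "perp C {x} {y}" using perp_SigO_funpow[of x y k] xO b by blast
    then have "Hom C x y \<subseteq> {Zer C x y}" by (simp add: perp_def)
    moreover have "Zer C x y \<in> Hom C x y" using xO b by (simp add: Hom_iff)
    ultimately show "Hom C x y = {Zer C x y}" by blast
  qed
qed

section \<open>A criterion for proper abelian subcategories\<close>

lemma additive_subcategoryD:
  assumes "additive_subcategory C X"
  shows "X \<subseteq> Obj C" "iso_closed C X" "zero_obj C z \<Longrightarrow> z \<in> X"
    "direct_sum C x y s \<Longrightarrow> s \<in> X \<longleftrightarrow> x \<in> X \<and> y \<in> X"
  using assms unfolding additive_subcategory_def by blast+

lemma additive_subcategoryI: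
  assumes X: "retract_closed C X" and ext: "X \<star> X \<subseteq> X" and z: "zero_obj C z" "z \<in> X"
  shows "additive_subcategory C X"
  unfolding additive_subcategory_def
proof (intro conjI allI impI)
  show XO: "X \<subseteq> Obj C" using X by (simp add: retract_closed_def)
  show "iso_closed C X" by (rule retract_closed_iso_closed[OF X])
  fix z' assume "zero_obj C z'"
  then show "z' \<in> X" using zero_obj_retract[of z' z] z retract_closedD[OF X] by (auto simp: zero_obj_iff)
next
  fix x y s assume d: "direct_sum C x y s"
  have "s \<in> X \<Longrightarrow> x \<in> X \<and> y \<in> X"
    using direct_sum_retract[OF d] retract_closedD[OF X] by blast
  moreover have "s \<in> X" if "x \<in> X" "y \<in> X"
  proof -
    obtain i q h where "(i, q, h) \<in> Tri C" "Dom C i = x" "Cod C i = s" "Cod C q = y"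
      using direct_sum_Tri[OF d] by blast
    then have "s \<in> X \<star> X" using that ext_prodI by metis
    then show ?thesis using ext by blast
  qed
  ultimately show "s \<in> X \<longleftrightarrow> x \<in> X \<and> y \<in> X" by blast
qed

lemma full_sub_additive:
  assumes X: "additive_subcategory C X" shows "additive_category (full_sub C X)"
proof -
  note XD = additive_subcategoryD[OF X]
  interpret D: preadditive_category "full_sub C X" by (rule full_sub_preadditive[OF XD(1)])
  show ?thesis
  proof
    obtain z where "zero_obj C z" using ex_zero_obj by blast
    then show "\<exists>z. zero_obj (full_sub C X) z" using XD(3) zero_obj_full_sub[OF XD(1)] by blast
  next
    fix x y assume "x \<in> Obj (full_sub C X)" "y \<in> Obj (full_sub C X)"
    then have xy: "x \<in> X" "y \<in> X" by simp_all
    obtain s where s: "direct_sum C x y s" using ex_direct_sum[of x y] xy XD(1) by blast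
    then have "s \<in> X" using XD(4) xy by blast
    then show "\<exists>s. direct_sum (full_sub C X) x y s"
      using direct_sum_full_sub[OF XD(1)] s xy by blast
  qed
qed

text \<open>Existence of factorisations is exactness of the Hom sequences. Their uniqueness is
  obstructed by arrows from a suspended object of \<open>X\<close> to an object of \<open>X\<close>,
  and these vanish.\<close>

lemma Tri_short_exact:
  assumes X: "X \<subseteq> Obj C" "perp C (sh X) X"
    and T: "(f, g, h) \<in> Tri C" "Dom C f \<in> X" "Cod C f \<in> X" "Cod C g \<in> X"
  shows "short_exact (full_sub C X) f g"
proof -
  interpret D: preadditive_category "full_sub C X" by (rule full_sub_preadditive[OF X(1)])
  note t = TriD[OF T(1)] Tri_Cmp[OF T(1)]
  have XO: "x \<in> Obj C" if "x \<in> X" for x using X(1) that by blast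
  have "is_kernel (full_sub C X) f g"
  proof (rule D.is_kernelI)
    fix a assume a: "a \<in> Arr (full_sub C X)" "Cod (full_sub C X) a = Cod (full_sub C X) f"
      "Cmp (full_sub C X) g a = Zer (full_sub C X) (Dom (full_sub C X) a) (Cod (full_sub C X) g)"
    then obtain s where "s \<in> Arr C" "Dom C s = Dom C a" "Cod C s = Dom C f" "f \<bullet> s = a"
      using Tri_lift[OF T(1), of a] by auto
    then show "\<exists>s. s \<in> Arr (full_sub C X) \<and> Dom (full_sub C X) s = Dom (full_sub C X) a \<and>
        Cod (full_sub C X) s = Dom (full_sub C X) f \<and> Cmp (full_sub C X) f s = a"
      using a T by (intro exI[of _ s]) simp
  next
    fix s assume s: "s \<in> Arr (full_sub C X)" "Cod (full_sub C X) s = Dom (full_sub C X) f"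
      "Cmp (full_sub C X) f s = Zer (full_sub C X) (Dom (full_sub C X) s) (Cod (full_sub C X) f)"
    then obtain l where l: "l \<in> Arr C" "Dom C l = SigO C (Dom C s)" "Cod C l = Cod C g" "h \<bullet> l = SigA C s"
      using Tri_SigA_lift[OF T(1), of s] by auto
    have "l = Zer C (SigO C (Dom C s)) (Cod C g)"
      by (rule perpD[OF X(2)]) (use l s T XO in \<open>simp_all add: SigO_mem_sh\<close>)
    then have "SigA C s = h \<bullet> Zer C (SigO C (Dom C s)) (Cod C g)" using l by metis
    then have "SigA C s = Zer C (SigO C (Dom C s)) (SigO C (Dom C f))" using s t by simp
    then have "s = Zer C (Dom C s) (Dom C f)" by (rule SigA_eq_Zer) (use s in simp_all)
    then show "s = Zer (full_sub C X) (Dom (full_sub C X) s) (Dom (full_sub C X) f)" by simp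
  qed (use t T in simp_all)
  moreover have "is_cokernel (full_sub C X) g f"
  proof (rule D.is_cokernelI)
    fix a assume a: "a \<in> Arr (full_sub C X)" "Dom (full_sub C X) a = Cod (full_sub C X) f"
      "Cmp (full_sub C X) a f = Zer (full_sub C X) (Dom (full_sub C X) f) (Cod (full_sub C X) a)"
    then obtain s where "s \<in> Arr C" "Dom C s = Cod C g" "Cod C s = Cod C a" "s \<bullet> g = a"
      using Tri_extend[OF T(1), of a] by auto
    then show "\<exists>s. s \<in> Arr (full_sub C X) \<and> Dom (full_sub C X) s = Cod (full_sub C X) g \<and>
        Cod (full_sub C X) s = Cod (full_sub C X) a \<and> Cmp (full_sub C X) s g = a"
      using a T by (intro exI[of _ s]) simp
  next
    fix s assume s: "s \<in> Arr (full_sub C X)" "Dom (full_sub C X) s = Cod (full_sub C X) g"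
      "Cmp (full_sub C X) s g = Zer (full_sub C X) (Cod (full_sub C X) f) (Cod (full_sub C X) s)"
    then obtain l where l: "l \<in> Arr C" "Dom C l = SigO C (Dom C f)" "Cod C l = Cod C s" "l \<bullet> h = s"
      using Tri_extend2[OF T(1), of s] by auto
    have "l = Zer C (SigO C (Dom C f)) (Cod C s)"
      by (rule perpD[OF X(2)]) (use l s T XO in \<open>simp_all add: SigO_mem_sh\<close>)
    then have "s = Zer C (SigO C (Dom C f)) (Cod C s) \<bullet> h" using l by metis
    also have "\<dots> = Zer C (Cod C g) (Cod C s)" using s t by simp
    finally show "s = Zer (full_sub C X) (Cod (full_sub C X) g) (Cod (full_sub C X) s)" by simp
  qed (use t T in simp_all)
  ultimately show ?thesis by (simp add: short_exact_def)
qed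

section \<open>Kernel and cokernel read off from the cone\<close>

context
  fixes B
  assumes add: "additive_subcategory C B" and E1: "perp C (sh B) B" and E2: "perp C (sh (sh B)) B"
    and adm: "B \<star> sh B \<subseteq> sh B \<star> B"
begin

lemma B_Obj: "x \<in> B \<Longrightarrow> x \<in> Obj C"
  using additive_subcategoryD(1)[OF add] by blast

lemma admissible_cone:
  assumes T: "(f, g, h) \<in> Tri C" "Dom C f \<in> B" "Cod C f \<in> B"
  obtains m n l k where "(m, n, l) \<in> Tri C" "k \<in> B" "Dom C m = SigO C k" "Cod C m = Cod C g" "Cod C n \<in> B"
  using ext_sh_leftE[of "Cod C g" B B] ext_sh_rightI[OF T] adm additive_subcategoryD(1)[OF add] by blast

text \<open>An arrow of \<open>B\<close> killing \<open>f\<close> extends over the cone of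
  \<open>f\<close>, vanishes on the part \<Sigma>k and so descends to \<open>Cod C n\<close>. For
  uniqueness the ambiguity becomes an arrow out of \<Sigma>\<Sigma>k, which is where the second
  negative degree is used.\<close>

lemma admissible_cokernel:
  assumes T: "(f, g, h) \<in> Tri C" "Dom C f \<in> B" "Cod C f \<in> B"
    and S: "(m, n, l) \<in> Tri C" "k \<in> B" "Dom C m = SigO C k" "Cod C m = Cod C g" "Cod C n \<in> B"
  shows "is_cokernel (full_sub C B) (n \<bullet> g) f"
proof -
  interpret D: preadditive_category "full_sub C B"
    by (rule full_sub_preadditive[OF additive_subcategoryD(1)[OF add]])
  note t = TriD[OF T(1)] Tri_Cmp[OF T(1)]
  note s = TriD[OF S(1), unfolded S] Tri_Cmp[OF S(1), unfolded S]
  note O = B_Obj[OF S(2)] B_Obj[OF T(2)] B_Obj[OF T(3)] B_Obj[OF S(5)]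
  show ?thesis
  proof (rule D.is_cokernelI)
    have "n \<bullet> (g \<bullet> f) = Zer C (Dom C f) (Cod C n)" unfolding t(7) using s t O by simp
    then show "Cmp (full_sub C B) (Cmp C n g) f =
        Zer (full_sub C B) (Dom (full_sub C B) f) (Cod (full_sub C B) (n \<bullet> g))"
      using t s by simp
  next
    fix a assume a: "a \<in> Arr (full_sub C B)" "Dom (full_sub C B) a = Cod (full_sub C B) f"
      "Cmp (full_sub C B) a f = Zer (full_sub C B) (Dom (full_sub C B) f) (Cod (full_sub C B) a)"
    then have aB: "a \<in> Arr C" "Cod C a \<in> B" by simp_all
    obtain r where r: "r \<in> Arr C" "Dom C r = Cod C g" "Cod C r = Cod C a" "r \<bullet> g = a"
      using Tri_extend[OF T(1), of a] a by auto
    have "r \<bullet> m = Zer C (SigO C k) (Cod C a)"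
      by (rule perpD[OF E1]) (use r s S aB O in \<open>simp_all add: SigO_mem_sh\<close>)
    then obtain r' where r': "r' \<in> Arr C" "Dom C r' = Cod C n" "Cod C r' = Cod C r" "r' \<bullet> n = r"
      using Tri_extend[OF S(1), of r] r S by auto
    have "r' \<bullet> (n \<bullet> g) = a"
      using Cmp_eq_Cmp[OF r'(4), of g] r r' s t by simp
    then show "\<exists>s. s \<in> Arr (full_sub C B) \<and> Dom (full_sub C B) s = Cod (full_sub C B) (n \<bullet> g) \<and>
        Cod (full_sub C B) s = Cod (full_sub C B) a \<and> Cmp (full_sub C B) s (n \<bullet> g) = a"
      using r r' aB S s t by (intro exI[of _ r']) simp
  next
    fix a assume "a \<in> Arr (full_sub C B)" "Dom (full_sub C B) a = Cod (full_sub C B) (n \<bullet> g)"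
      "Cmp (full_sub C B) a (n \<bullet> g) = Zer (full_sub C B) (Cod (full_sub C B) f) (Cod (full_sub C B) a)"
    then have a: "a \<in> Arr C" "Dom C a = Cod C n" "Cod C a \<in> B"
      "a \<bullet> (n \<bullet> g) = Zer C (Cod C f) (Cod C a)" using s t by auto
    have "(a \<bullet> n) \<bullet> g = Zer C (Cod C f) (Cod C (a \<bullet> n))" using a s t by simp
    then obtain r where r: "r \<in> Arr C" "Dom C r = SigO C (Dom C f)" "Cod C r = Cod C a" "r \<bullet> h = a \<bullet> n"
      using Tri_extend2[OF T(1), of "a \<bullet> n"] a s by auto
    have "r = Zer C (SigO C (Dom C f)) (Cod C a)"
      by (rule perpD[OF E1]) (use r a T O in \<open>simp_all add: SigO_mem_sh\<close>)
    then have "a \<bullet> n = Zer C (SigO C (Dom C f)) (Cod C a) \<bullet> h" using r by metis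
    also have "\<dots> = Zer C (Cod C m) (Cod C a)" using t a S by simp
    finally obtain q where q: "q \<in> Arr C" "Dom C q = SigO C (SigO C k)" "Cod C q = Cod C a" "q \<bullet> l = a"
      using Tri_extend2[OF S(1) a(1,2)] S by metis
    have "q = Zer C (SigO C (SigO C k)) (Cod C a)"
      by (rule perpD[OF E2]) (use q a S O in \<open>simp_all add: SigO_mem_sh\<close>)
    then have "a = Zer C (SigO C (SigO C k)) (Cod C a) \<bullet> l" using q by metis
    also have "\<dots> = Zer C (Cod C n) (Cod C a)" using s a by simp
    finally show "a = Zer (full_sub C B) (Cod (full_sub C B) (n \<bullet> g)) (Cod (full_sub C B) a)"
      using s t by simp
  qed (use s t T S in simp_all)
qed

text \<open>Once suspended, \<open>k\<close> maps to the cone by \<open>m\<close>, and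
  \<open>h\<close> carries it on to the suspended source of \<open>f\<close>; \<open>i\<close> is
  this composite desuspended. As for cokernels, lifting takes degree one, and uniqueness takes
  degree two as well.\<close>

lemma admissible_kernel:
  assumes T: "(f, g, h) \<in> Tri C" "Dom C f \<in> B" "Cod C f \<in> B"
    and S: "(m, n, l) \<in> Tri C" "k \<in> B" "Dom C m = SigO C k" "Cod C m = Cod C g" "Cod C n \<in> B"
    and i: "i \<in> Arr C" "Dom C i = k" "Cod C i = Dom C f" "SigA C i = h \<bullet> m"
  shows "is_kernel (full_sub C B) i f"
proof -
  interpret D: preadditive_category "full_sub C B"
    by (rule full_sub_preadditive[OF additive_subcategoryD(1)[OF add]])
  note t = TriD[OF T(1)] Tri_Cmp[OF T(1)]
  note s = TriD[OF S(1), unfolded S] Tri_Cmp[OF S(1), unfolded S]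
  note O = B_Obj[OF S(2)] B_Obj[OF T(2)] B_Obj[OF T(3)] B_Obj[OF S(5)]
  show ?thesis
  proof (rule D.is_kernelI)
    have "SigA C (f \<bullet> i) = SigA C f \<bullet> (h \<bullet> m)" using i t by simp
    also have "\<dots> = Zer C (Cod C g) (SigO C (Cod C f)) \<bullet> m"
      by (rule Cmp_eq_Cmp[OF t(9)]) (use s t S in simp_all)
    also have "\<dots> = Zer C (SigO C k) (SigO C (Cod C f))" using s t S O by simp
    finally have "f \<bullet> i = Zer C k (Cod C f)" by (rule SigA_eq_Zer) (use i t in simp_all)
    then show "Cmp (full_sub C B) f i =
        Zer (full_sub C B) (Dom (full_sub C B) i) (Cod (full_sub C B) f)"
      using i by simp
  next
    fix a assume "a \<in> Arr (full_sub C B)" "Cod (full_sub C B) a = Cod (full_sub C B) i"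
      "Cmp (full_sub C B) f a = Zer (full_sub C B) (Dom (full_sub C B) a) (Cod (full_sub C B) f)"
    then have a: "a \<in> Arr C" "Dom C a \<in> B" "Cod C a = Dom C f" "f \<bullet> a = Zer C (Dom C a) (Cod C f)"
      using i by auto
    obtain r where r: "r \<in> Arr C" "Dom C r = SigO C (Dom C a)" "Cod C r = Cod C g" "h \<bullet> r = SigA C a"
      using Tri_SigA_lift[OF T(1) a(1,3,4)] by blast
    have "n \<bullet> r = Zer C (SigO C (Dom C a)) (Cod C n)"
      by (rule perpD[OF E1]) (use r s S a B_Obj in \<open>simp_all add: SigO_mem_sh\<close>)
    then obtain r' where r': "r' \<in> Arr C" "Dom C r' = SigO C (Dom C a)" "Cod C r' = SigO C k" "m \<bullet> r' = r"
      using Tri_lift[OF S(1), of r] r S by auto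
    obtain q where q: "q \<in> Arr C" "Dom C q = Dom C a" "Cod C q = k" "SigA C q = r'"
      using SigA_full[OF r'(1-3)] a O by auto
    have "SigA C (i \<bullet> q) = h \<bullet> (m \<bullet> r')"
      using q i r' s t S by simp
    then have "SigA C (i \<bullet> q) = SigA C a" using r r' by simp
    then have "i \<bullet> q = a" by (rule SigA_eqD) (use q i a in simp_all)
    then show "\<exists>s. s \<in> Arr (full_sub C B) \<and> Dom (full_sub C B) s = Dom (full_sub C B) a \<and>
        Cod (full_sub C B) s = Dom (full_sub C B) i \<and> Cmp (full_sub C B) i s = a"
      using q i a S by (intro exI[of _ q]) simp
  next
    fix a assume "a \<in> Arr (full_sub C B)" "Cod (full_sub C B) a = Dom (full_sub C B) i"
      "Cmp (full_sub C B) i a = Zer (full_sub C B) (Dom (full_sub C B) a) (Cod (full_sub C B) i)"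
    then have a: "a \<in> Arr C" "Dom C a \<in> B" "Cod C a = k" "i \<bullet> a = Zer C (Dom C a) (Dom C f)"
      using i by auto
    let ?w = "SigO C (Dom C a)"
    have w: "?w \<in> Obj C" using a by simp
    have "h \<bullet> (m \<bullet> SigA C a) = (h \<bullet> m) \<bullet> SigA C a" using a s t S by simp
    also have "\<dots> = SigA C i \<bullet> SigA C a" by (simp only: i(4))
    also have "\<dots> = SigA C (i \<bullet> a)"
      by (rule SigA_Cmp_simp[symmetric]) (use a i in simp_all)
    also have "\<dots> = Zer C ?w (SigO C (Dom C f))" unfolding a(4) using a O by simp
    finally obtain r where r: "r \<in> Arr C" "Dom C r = ?w" "Cod C r = Cod C f" "g \<bullet> r = m \<bullet> SigA C a"
      using Tri_lift2[OF T(1), of "m \<bullet> SigA C a"] a s S by auto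
    have "r = Zer C ?w (Cod C f)"
      by (rule perpD[OF E1]) (use r a T B_Obj in \<open>simp_all add: SigO_mem_sh\<close>)
    then have "m \<bullet> SigA C a = g \<bullet> Zer C ?w (Cod C f)" using r by metis
    also have "\<dots> = Zer C ?w (Cod C m)" using t w S by simp
    finally obtain q where q: "q \<in> Arr C" "Dom C q = SigO C ?w" "Cod C q = Cod C n"
      "l \<bullet> q = SigA C (SigA C a)"
      using Tri_SigA_lift[OF S(1), of "SigA C a"] a S by auto
    have "q = Zer C (SigO C ?w) (Cod C n)"
      by (rule perpD[OF E2]) (use q a S B_Obj in \<open>simp_all add: SigO_mem_sh\<close>)
    then have "SigA C (SigA C a) = l \<bullet> Zer C (SigO C ?w) (Cod C n)" using q by metis
    also have "\<dots> = Zer C (SigO C ?w) (SigO C (SigO C k))" using s w by simp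
    finally have "SigA C a = Zer C ?w (SigO C k)"
      by (rule SigA_eq_Zer) (use a in simp_all)
    then have "a = Zer C (Dom C a) k" by (rule SigA_eq_Zer) (use a in simp_all)
    then show "a = Zer (full_sub C B) (Dom (full_sub C B) a) (Dom (full_sub C B) i)"
      using i by simp
  qed (use i t T S in simp_all)
qed

end


text \<open>A monomorphism has zero kernel \<open>i\<close>, so \<open>m\<close> factors through
  \<open>g\<close>, and then vanishes since \<Sigma>k has no nonzero arrow to an object of
  \<open>B\<close>. The cone is thus a retract of the cokernel.\<close>

lemma admissible_mono:
  assumes add: "additive_subcategory C B" and E1: "perp C (sh B) B" and E2: "perp C (sh (sh B)) B"
    and adm: "B \<star> sh B \<subseteq> sh B \<star> B"
    and T: "(f, g, h) \<in> Tri C" "Dom C f \<in> B" "Cod C f \<in> B"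
    and mono: "mono_arr (full_sub C B) f"
  shows "Cod C g \<in> B"
proof -
  note BO = additive_subcategoryD(1)[OF add]
  interpret D: preadditive_category "full_sub C B" by (rule full_sub_preadditive[OF BO])
  note t = TriD[OF T(1)]
  obtain m n l k where S: "(m, n, l) \<in> Tri C" "k \<in> B" "Dom C m = SigO C k" "Cod C m = Cod C g" "Cod C n \<in> B"
    by (rule admissible_cone[OF add E1 E2 adm T])
  note s = TriD[OF S(1), unfolded S]
  have O: "k \<in> Obj C" "Dom C f \<in> Obj C" "Cod C g \<in> Obj C" "Cod C f \<in> Obj C" using S BO t by auto
  obtain i where i: "i \<in> Arr C" "Dom C i = k" "Cod C i = Dom C f" "SigA C i = h \<bullet> m"
    using SigA_full[of "h \<bullet> m" k "Dom C f"] s t S O by auto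
  have "is_kernel (full_sub C B) i f" by (rule admissible_kernel[OF add E1 E2 adm T S i])
  then have "f \<bullet> i = Zer C k (Cod C f)" using D.is_kernelD(4) i by fastforce
  then have "i = Zer C k (Dom C f)"
    by - (rule D.mono_arr_cancel[OF mono], use i t T S O in simp_all)
  then have "h \<bullet> m = Zer C (SigO C k) (SigO C (Dom C f))" using i(4) O by simp
  then obtain r where r: "r \<in> Arr C" "Dom C r = SigO C k" "Cod C r = Cod C f" "g \<bullet> r = m"
    using Tri_lift2[OF T(1), of m] s S by auto
  have "r = Zer C (SigO C k) (Cod C f)"
    by (rule perpD[OF E1]) (use r S T O in \<open>simp_all add: SigO_mem_sh\<close>)
  then have "m = g \<bullet> Zer C (SigO C k) (Cod C f)" using r by metis
  then have m: "m = Zer C (SigO C k) (Cod C g)" using t O by simp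
  have "retract C (Cod C g) (Cod C n)"
    using Tri_first_Zer_retract[OF S(1)] m S by simp
  then show ?thesis
    using S(5) by (rule retract_closedD[OF additive_subcategory_retract_closed[OF add]])
qed

text \<open>Here it is the other end that survives: the cokernel map \<open>n \<bullet> g\<close> is
  zero, hence so is \<open>n\<close>, and the cone is a retract of \<Sigma>k.\<close>

lemma admissible_epi:
  assumes add: "additive_subcategory C B" and E1: "perp C (sh B) B" and E2: "perp C (sh (sh B)) B"
    and adm: "B \<star> sh B \<subseteq> sh B \<star> B"
    and T: "(f, g, h) \<in> Tri C" "Dom C f \<in> B" "Cod C f \<in> B"
    and epi: "epi_arr (full_sub C B) f"
  shows "Cod C g \<in> sh B"
proof -
  note BO = additive_subcategoryD(1)[OF add]
  interpret D: preadditive_category "full_sub C B" by (rule full_sub_preadditive[OF BO])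
  note t = TriD[OF T(1)]
  obtain m n l k where S: "(m, n, l) \<in> Tri C" "k \<in> B" "Dom C m = SigO C k" "Cod C m = Cod C g" "Cod C n \<in> B"
    by (rule admissible_cone[OF add E1 E2 adm T])
  note s = TriD[OF S(1), unfolded S]
  have O: "k \<in> Obj C" "Dom C f \<in> Obj C" "Cod C g \<in> Obj C" "Cod C f \<in> Obj C" "Cod C n \<in> Obj C"
    using S BO t by auto
  have "is_cokernel (full_sub C B) (n \<bullet> g) f" by (rule admissible_cokernel[OF add E1 E2 adm T S])
  then have z: "(n \<bullet> g) \<bullet> f = Zer C (Dom C f) (Cod C n)"
    using D.is_cokernelD(4)[of "n \<bullet> g" f] s t by simp
  have "n \<bullet> g = Zer C (Cod C f) (Cod C n)"
    by (rule D.epi_arr_cancel[OF epi]) (use z s t T S O in simp_all)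
  then obtain r where r: "r \<in> Arr C" "Dom C r = SigO C (Dom C f)" "Cod C r = Cod C n" "r \<bullet> h = n"
    using Tri_extend2[OF T(1), of n] s S by auto
  have "r = Zer C (SigO C (Dom C f)) (Cod C n)"
    by (rule perpD[OF E1]) (use r S T O in \<open>simp_all add: SigO_mem_sh\<close>)
  then have "n = Zer C (SigO C (Dom C f)) (Cod C n) \<bullet> h" using r by metis
  then have n: "n = Zer C (Cod C g) (Cod C n)" using t O by simp
  have "retract C (Cod C g) (SigO C k)"
    using Tri_second_Zer_retract[OF S(1)] n S by simp
  then show ?thesis
    using SigO_mem_sh[OF S(2) O(1)]
    by (rule retract_closedD[OF retract_closed_sh[OF additive_subcategory_retract_closed[OF add]]])
qed

theorem proper_abelianI:
  assumes add: "additive_subcategory C B" and ext: "B \<star> B \<subseteq> B"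
    and E1: "perp C (sh B) B" and E2: "perp C (sh (sh B)) B" and adm: "B \<star> sh B \<subseteq> sh B \<star> B"
  shows "proper_abelian C B"
proof -
  note BO = additive_subcategoryD(1)[OF add]
  interpret D: additive_category "full_sub C B" by (rule full_sub_additive[OF add])
  have mono: "short_exact (full_sub C B) f g \<and> Cod C g \<in> B"
    if T: "(f, g, h) \<in> Tri C" "Dom C f \<in> B" "Cod C f \<in> B" and m: "mono_arr (full_sub C B) f" for f g h
    using admissible_mono[OF add E1 E2 adm T m] Tri_short_exact[OF BO E1 T] by blast
  have "abelian_category (full_sub C B)"
  proof
    fix f assume "f \<in> Arr (full_sub C B)"
    then have f: "f \<in> Arr C" "Dom C f \<in> B" "Cod C f \<in> B" by simp_all
    obtain g h where T: "(f, g, h) \<in> Tri C" using Tri_cone f by blast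
    note t = TriD[OF T]
    obtain m n l k where S: "(m, n, l) \<in> Tri C" "k \<in> B" "Dom C m = SigO C k" "Cod C m = Cod C g" "Cod C n \<in> B"
      by (rule admissible_cone[OF add E1 E2 adm T f(2,3)])
    note s = TriD[OF S(1)]
    obtain i where i: "i \<in> Arr C" "Dom C i = k" "Cod C i = Dom C f" "SigA C i = h \<bullet> m"
      using SigA_full[of "h \<bullet> m" k "Dom C f"] s t S f BO by auto
    show "\<exists>k. is_kernel (full_sub C B) k f"
      using admissible_kernel[OF add E1 E2 adm T f(2,3) S i] by blast
    show "\<exists>c. is_cokernel (full_sub C B) c f"
      using admissible_cokernel[OF add E1 E2 adm T f(2,3) S] by blast
  next
    fix f assume m: "mono_arr (full_sub C B) f"
    then have f: "f \<in> Arr C" "Dom C f \<in> B" "Cod C f \<in> B" by (simp_all add: mono_arr_def)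
    obtain g h where T: "(f, g, h) \<in> Tri C" using Tri_cone f by blast
    show "\<exists>g. is_kernel (full_sub C B) f g"
      using mono[OF T f(2,3) m] by (auto simp: short_exact_def)
  next
    fix f assume e: "epi_arr (full_sub C B) f"
    then have f: "f \<in> Arr C" "Dom C f \<in> B" "Cod C f \<in> B" by (simp_all add: epi_arr_def)
    obtain g h where T: "(f, g, h) \<in> Tri C" using Tri_cone f by blast
    have "Cod C g \<in> sh B" by (rule admissible_epi[OF add E1 E2 adm T f(2,3) e])
    then obtain k where k: "k \<in> B" "isomorphic C (Cod C g) (SigO C k)" by (auto simp: mem_sh)
    \<comment> \<open>Rotating back exhibits \<open>f\<close> as the second map of a triangle with
      vertices in \<open>B\<close>, hence as a cokernel.\<close>
    obtain i h' where i: "(i, f, h') \<in> Tri C" "Dom C i = k" "Cod C i = Dom C f"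
      using Tri_cocone[OF T _ k(2)] k(1) BO by blast
    have "short_exact (full_sub C B) i f"
      by (rule Tri_short_exact[OF BO E1 i(1)]) (use i k f in simp_all)
    then show "\<exists>g. is_cokernel (full_sub C B) f g" by (auto simp: short_exact_def)
  qed
  moreover have "short_triangle C f g"
    if se: "short_exact (full_sub C B) f g" for f g
  proof -
    have k: "is_kernel (full_sub C B) f g" and c: "is_cokernel (full_sub C B) g f"
      using se by (auto simp: short_exact_def)
    have f: "f \<in> Arr C" "Dom C f \<in> B" "Cod C f \<in> B" and g: "g \<in> Arr C" "Dom C g = Cod C f" "Cod C g \<in> B"
      using D.is_kernelD[OF k] by auto
    \<comment> \<open>The given \<open>g\<close> and the map \<open>g'\<close> to the cone are both
      cokernels of \<open>f\<close>, so the comparison isomorphism moves the triangle onto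
      \<open>g\<close>.\<close>
    obtain g' h where T: "(f, g', h) \<in> Tri C" using Tri_cone f by blast
    note t = TriD[OF T]
    have "short_exact (full_sub C B) f g'" and e: "Cod C g' \<in> B"
      using mono[OF T f(2,3) D.kernel_mono[OF k]] by auto
    then have c': "is_cokernel (full_sub C B) g' f" by (simp add: short_exact_def)
    have O: "Cod C g \<in> Obj C" "Cod C g' \<in> Obj C" "Cod C f \<in> Obj C" "Dom C f \<in> Obj C" using g t by simp_all
    obtain u where u: "u \<in> Arr C" "Dom C u = Cod C g'" "Cod C u = Cod C g" "u \<bullet> g' = g"
      using D.cokernel_extend[OF c', of g] f g D.is_cokernelD[OF c] by auto
    obtain v where v: "v \<in> Arr C" "Dom C v = Cod C g" "Cod C v = Cod C g'" "v \<bullet> g = g'"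
      using D.cokernel_extend[OF c, of g'] f t e D.is_cokernelD[OF c'] by auto
    have vu: "v \<bullet> u = Idt C (Cod C g')"
      by - (rule D.cokernel_cancel[OF c', simplified], use u v t e O in simp_all)
    have uv: "u \<bullet> v = Idt C (Cod C g)"
      by - (rule D.cokernel_cancel[OF c, simplified], use u v t e O g in simp_all)
    have i: "iso_arr C u" by (rule iso_arrI[of u v]) (use u v uv vu in simp_all)
    have "(f, g, h \<bullet> v) \<in> Tri C"
      by (rule Tri_iso[OF T, where u = "Idt C (Dom C f)" and v = "Idt C (Cod C f)" and w = u])
        (use i u v vu t f g O in \<open>simp_all add: Hom_iff candidate_def\<close>)
    then show ?thesis by (auto simp: short_triangle_def)
  qed
  moreover have "Dom C f \<in> B \<and> Cod C f \<in> B \<and> Cod C g \<in> B"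
    if "short_exact (full_sub C B) f g" for f g
    using that D.is_kernelD[of f g] by (auto simp: short_exact_def)
  moreover have "short_exact (full_sub C B) f g"
    if "Dom C f \<in> B" "Cod C f \<in> B" "Cod C g \<in> B" "short_triangle C f g" for f g
    using that Tri_short_exact[OF BO E1] by (auto simp: short_triangle_def)
  ultimately show ?thesis
    unfolding proper_abelian_def extension_closed_def using add ext by blast
qed

lemma proper_abelianD:
  assumes "proper_abelian C A"
  shows "additive_subcategory C A" "A \<star> A \<subseteq> A" "abelian_category (full_sub C A)"
    "short_exact (full_sub C A) f g \<longleftrightarrow>
      Dom C f \<in> A \<and> Cod C f \<in> A \<and> Cod C g \<in> A \<and> (\<exists>h. (f, g, h) \<in> Tri C)"
  using assms by (simp_all add: proper_abelian_def extension_closed_def short_triangle_def)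

text \<open>The octahedral axiom for f = m q, where the cone of the epimorphism q is the suspended
  kernel and that of the monomorphism m is the cokernel. The singletons record the actual kernel and
  cokernel, so that finer memberships can be read off later.\<close>

lemma proper_abelian_cone:
  assumes pa: "proper_abelian C A" and T: "(f, g, h) \<in> Tri C" "Dom C f \<in> A" "Cod C f \<in> A"
  obtains k q m c where "short_exact (full_sub C A) k q" "short_exact (full_sub C A) m c"
    "Cod C k = Dom C f" "Cod C m = Cod C f" "Cod C g \<in> sh {Dom C k} \<star> {Cod C c}"
proof -
  note PA = proper_abelianD[OF pa]
  interpret D: abelian_category "full_sub C A" by (rule PA(3))
  note t = TriD[OF T(1)]
  have "f \<in> Arr (full_sub C A)" using t T by simp
  then obtain k q m c where a: "short_exact (full_sub C A) k q" "short_exact (full_sub C A) m c"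
    "Cod C q = Dom C m" "m \<bullet> q = f" "Cod C k = Dom C f" "Cod C m = Cod C f"
    by (rule D.epi_mono_factorization) (simp only: full_sub_simps)
  obtain l where l: "(k, q, l) \<in> Tri C" using a(1) PA(4) by blast
  obtain d where d: "(m, c, d) \<in> Tri C" using a(2) PA(4) by blast
  note s = TriD[OF l] TriD[OF d]
  obtain r p j where r: "r \<in> Hom C (Cod C l) (Cod C g)" "p \<in> Hom C (Cod C g) (Cod C c)" "(r, p, j) \<in> Tri C"
    using octahedron[OF Tri_rot[OF l] d a(3), of g h] T(1) a(4) by blast
  have "Cod C g \<in> sh {Dom C k} \<star> {Cod C c}"
    by (rule ext_prodI[OF r(3)]) (use r s in \<open>auto simp: Hom_iff SigO_mem_sh\<close>)
  then show ?thesis using that a by blast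
qed

end

section \<open>Torsion pairs\<close>

lemma (in category) isomorphic_full_sub:
  assumes "x \<in> X" "y \<in> X" shows "isomorphic (full_sub C X) x y \<longleftrightarrow> isomorphic C x y"
proof
  assume "isomorphic (full_sub C X) x y"
  then obtain f g where "f \<in> Arr C" "Dom C f = x" "Cod C f = y" "g \<in> Arr C" "Dom C g = y" "Cod C g = x"
    "g \<bullet> f = Idt C x" "f \<bullet> g = Idt C y"
    by (auto simp: isomorphic_def iso_arr_def Hom_iff)
  then show "isomorphic C x y" by (rule isomorphicI)
next
  assume "isomorphic C x y"
  then obtain f g where a: "f \<in> Arr C" "Dom C f = x" "Cod C f = y" "g \<in> Arr C" "Dom C g = y"
    "Cod C g = x" "g \<bullet> f = Idt C x" "f \<bullet> g = Idt C y"
    by (rule isomorphicE)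
  have "f \<in> Hom (full_sub C X) x y" "g \<in> Hom (full_sub C X) y x"
    using a assms by (simp_all add: Hom_iff)
  moreover from this have "iso_arr (full_sub C X) f"
    unfolding iso_arr_def using a by (intro conjI bexI[of _ g]) (simp_all add: Hom_iff)
  ultimately show "isomorphic (full_sub C X) x y" unfolding isomorphic_def by blast
qed

context triangulated_category
begin

lemma torsion_pairsD:
  assumes "(T, F) \<in> torsion_pairs (full_sub C A)"
  shows "T \<subseteq> A" "F \<subseteq> A" "iso_closed (full_sub C A) T" "iso_closed (full_sub C A) F" "perp C T F"
    "a \<in> A \<Longrightarrow> \<exists>u v. short_exact (full_sub C A) u v \<and> Dom C u \<in> T \<and> Cod C u = a \<and> Cod C v \<in> F"
proof -
  have *: "T \<subseteq> A \<and> F \<subseteq> A \<and> iso_closed (full_sub C A) T \<and> iso_closed (full_sub C A) F \<and>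
      (\<forall>t \<in> T. \<forall>f \<in> F. Hom (full_sub C A) t f = {Zer C t f}) \<and>
      (\<forall>a \<in> A. \<exists>t \<in> T. \<exists>f \<in> F. \<exists>u \<in> Hom (full_sub C A) t a. \<exists>v \<in> Hom (full_sub C A) a f.
        short_exact (full_sub C A) u v)"
    using assms by (simp add: torsion_pairs_def)
  then show "T \<subseteq> A" "F \<subseteq> A" "iso_closed (full_sub C A) T" "iso_closed (full_sub C A) F" by blast+
  then have "Hom C t f = Hom (full_sub C A) t f" if "t \<in> T" "f \<in> F" for t f
    using that by (auto simp: Hom_full_sub)
  then show "perp C T F" using * by (simp add: perp_def)
  show "\<exists>u v. short_exact (full_sub C A) u v \<and> Dom C u \<in> T \<and> Cod C u = a \<and> Cod C v \<in> F" if "a \<in> A"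
    using * that by (fastforce simp: Hom_iff)
qed

lemma torsion_pairsI:
  assumes TF: "T \<subseteq> A" "F \<subseteq> A" "iso_closed C T" "iso_closed C F" "perp C T F" "A \<subseteq> T \<star> F"
    and pa: "proper_abelian C A"
  shows "(T, F) \<in> torsion_pairs (full_sub C A)"
proof -
  note PA = proper_abelianD[OF pa]
  have AO: "A \<subseteq> Obj C" by (rule additive_subcategoryD(1)[OF PA(1)])
  have "iso_closed (full_sub C A) X" if X: "X \<subseteq> A" "iso_closed C X" for X
    unfolding iso_closed_def
  proof (intro ballI impI)
    fix x y assume "x \<in> X" "y \<in> Obj (full_sub C A)" "isomorphic (full_sub C A) x y"
    then have "x \<in> X" "y \<in> Obj C" "isomorphic C x y"
      using X AO isomorphic_full_sub[of x A y] by auto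
    then show "y \<in> X" using X(2) unfolding iso_closed_def by blast
  qed
  moreover have "Hom (full_sub C A) t f = {Zer C t f}" if "t \<in> T" "f \<in> F" for t f
  proof -
    have "t \<in> Obj C" "f \<in> Obj C" using that TF AO by auto
    then have "Zer C t f \<in> Hom C t f" by (simp add: Hom_iff)
    moreover have "Hom C t f \<subseteq> {Zer C t f}" using TF(5) that by (auto simp: perp_def)
    ultimately show ?thesis using that TF(1,2) by (auto simp: Hom_full_sub)
  qed
  moreover have "\<exists>t \<in> T. \<exists>f \<in> F. \<exists>u \<in> Hom (full_sub C A) t a. \<exists>v \<in> Hom (full_sub C A) a f.
      short_exact (full_sub C A) u v" if a: "a \<in> A" for a
  proof -
    obtain u v w where T: "(u, v, w) \<in> Tri C" "Dom C u \<in> T" "Cod C u = a" "Cod C v \<in> F"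
      using a TF(6) ext_prodE by blast
    note t = TriD[OF T(1)]
    have "short_exact (full_sub C A) u v" using T a TF PA(4) by blast
    moreover have "u \<in> Hom (full_sub C A) (Dom C u) a" "v \<in> Hom (full_sub C A) a (Cod C v)"
      using T t a TF by (auto simp: Hom_iff)
    ultimately show ?thesis using T by blast
  qed
  ultimately show ?thesis using TF(1-4) by (simp add: torsion_pairs_def)
qed

section \<open>Closure properties of the two classes of a torsion pair\<close>

context
  fixes A T F
  assumes pa: "proper_abelian C A" and tors: "(T, F) \<in> torsion_pairs (full_sub C A)"
begin

lemma torsion_A_Obj: "a \<in> A \<Longrightarrow> a \<in> Obj C"
  using additive_subcategoryD(1)[OF proper_abelianD(1)[OF pa]] by blast

lemma torsion_subset_ext: "A \<subseteq> T \<star> F"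
  using torsion_pairsD(6)[OF tors] proper_abelianD(4)[OF pa] ext_prodI by blast

text \<open>The map from \<open>a\<close> to its torsion-free quotient vanishes, so the torsion
  subobject is all of \<open>a\<close>. Closure properties of \<open>T\<close> thereby reduce to
  those of a left orthogonal.\<close>

lemma torsion_T_char:
  assumes a: "a \<in> A" "perp C {a} F" shows "a \<in> T"
proof -
  interpret D: abelian_category "full_sub C A" by (rule proper_abelianD(3)[OF pa])
  obtain u v where uv: "short_exact (full_sub C A) u v" "Dom C u \<in> T" "Cod C u = a" "Cod C v \<in> F"
    using torsion_pairsD(6)[OF tors a(1)] by blast
  then have k: "is_kernel (full_sub C A) u v" by (simp add: short_exact_def)
  note kk = D.is_kernelD[OF k, simplified]
  have aO: "a \<in> Obj C" by (rule torsion_A_Obj[OF a(1)])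
  have "v = Zer C a (Cod C v)" by (rule perpD[OF a(2)]) (use kk uv in simp_all)
  then have "v \<bullet> Idt C a = Zer C a (Cod C v)" using aO kk uv by simp
  then obtain s where s: "s \<in> Arr C" "Dom C s = a" "Cod C s = Dom C u" "u \<bullet> s = Idt C a"
    using D.kernel_lift[OF k, of "Idt C a"] a aO uv by auto
  have "s \<bullet> u = Idt C (Dom C u)"
    by (rule D.kernel_cancel[OF k, simplified])
      (use kk uv s a Cmp_eq_Cmp[OF s(4), of u] in simp_all)
  then have "isomorphic C (Dom C u) a"
    by (intro isomorphicI[of u _ _ s]) (use kk uv s in simp_all)
  then have "isomorphic (full_sub C A) (Dom C u) a" using isomorphic_full_sub[of _ A] kk a by blast
  then show ?thesis
    using torsion_pairsD(3)[OF tors] uv(2) a by (auto simp: iso_closed_def)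
qed

lemma torsion_F_char:
  assumes a: "a \<in> A" "perp C T {a}" shows "a \<in> F"
proof -
  interpret D: abelian_category "full_sub C A" by (rule proper_abelianD(3)[OF pa])
  obtain u v where uv: "short_exact (full_sub C A) u v" "Dom C u \<in> T" "Cod C u = a" "Cod C v \<in> F"
    using torsion_pairsD(6)[OF tors a(1)] by blast
  then have k: "is_cokernel (full_sub C A) v u" by (simp add: short_exact_def)
  note kk = D.is_cokernelD[OF k, simplified]
  have aO: "a \<in> Obj C" by (rule torsion_A_Obj[OF a(1)])
  have "u = Zer C (Dom C u) a" by (rule perpD[OF a(2)]) (use kk uv in simp_all)
  then have "Idt C a \<bullet> u = Zer C (Dom C u) a" using aO kk uv by simp
  then obtain s where s: "s \<in> Arr C" "Dom C s = Cod C v" "Cod C s = a" "s \<bullet> v = Idt C a"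
    using D.cokernel_extend[OF k, of "Idt C a"] a aO uv by auto
  have "v \<bullet> s = Idt C (Cod C v)"
    by (rule D.cokernel_cancel[OF k, simplified])
      (use kk uv s a Cmp_eq_Cmp[OF s(4), of v] in simp_all)
  then have "isomorphic C (Cod C v) a"
    by (intro isomorphicI[of s _ _ v]) (use kk uv s in simp_all)
  then have "isomorphic (full_sub C A) (Cod C v) a" using isomorphic_full_sub[of _ A] kk a by blast
  then show ?thesis
    using torsion_pairsD(4)[OF tors] uv(4) a by (auto simp: iso_closed_def)
qed

lemma torsion_T_retract: "retract_closed C T"
  unfolding retract_closed_def
proof (intro conjI ballI allI impI)
  note td = torsion_pairsD[OF tors]
  show "T \<subseteq> Obj C" using td(1) torsion_A_Obj by blast
  fix y x assume y: "y \<in> T" and xy: "retract C x y"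
  then obtain s r where s: "s \<in> Arr C" "Dom C s = x" "Cod C s = y"
    and r: "r \<in> Arr C" "Dom C r = y" "Cod C r = x" "r \<bullet> s = Idt C x"
    by (auto simp: retract_def Hom_iff)
  have xA: "x \<in> A"
    using retract_closedD[OF additive_subcategory_retract_closed[OF proper_abelianD(1)[OF pa]] xy] y td(1)
    by blast
  show "x \<in> T"
  proof (rule torsion_T_char[OF xA], rule perpI)
    fix f assume f: "f \<in> Arr C" "Dom C f \<in> {x}" "Cod C f \<in> F"
    have z: "f \<bullet> r = Zer C y (Cod C f)"
      by (rule perpD[OF td(5)]) (use f r y in simp_all)
    have "f = (f \<bullet> r) \<bullet> s" using f r s by simp
    also have "\<dots> = Zer C (Dom C f) (Cod C f)" unfolding z using s f by simp
    finally show "f = Zer C (Dom C f) (Cod C f)" .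
  qed
qed

lemma torsion_F_retract: "retract_closed C F"
  unfolding retract_closed_def
proof (intro conjI ballI allI impI)
  note td = torsion_pairsD[OF tors]
  show "F \<subseteq> Obj C" using td(2) torsion_A_Obj by blast
  fix y x assume y: "y \<in> F" and xy: "retract C x y"
  then obtain s r where s: "s \<in> Arr C" "Dom C s = x" "Cod C s = y"
    and r: "r \<in> Arr C" "Dom C r = y" "Cod C r = x" "r \<bullet> s = Idt C x"
    by (auto simp: retract_def Hom_iff)
  have xA: "x \<in> A"
    using retract_closedD[OF additive_subcategory_retract_closed[OF proper_abelianD(1)[OF pa]] xy] y td(2)
    by blast
  show "x \<in> F"
  proof (rule torsion_F_char[OF xA], rule perpI)
    fix f assume f: "f \<in> Arr C" "Dom C f \<in> T" "Cod C f \<in> {x}"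
    have z: "s \<bullet> f = Zer C (Dom C f) y"
      by (rule perpD[OF td(5)]) (use f s y in simp_all)
    have "f = r \<bullet> (s \<bullet> f)" using f r s Cmp_eq_Cmp[OF r(4), of f] by simp
    also have "\<dots> = Zer C (Dom C f) (Cod C f)" unfolding z using r f by simp
    finally show "f = Zer C (Dom C f) (Cod C f)" .
  qed
qed

lemma torsion_T_quotient:
  assumes "short_exact (full_sub C A) m c" "Cod C m \<in> T" shows "Cod C c \<in> T"
proof -
  interpret D: abelian_category "full_sub C A" by (rule proper_abelianD(3)[OF pa])
  note td = torsion_pairsD[OF tors]
  have k: "is_cokernel (full_sub C A) c m" using assms by (simp add: short_exact_def)
  note kk = D.is_cokernelD[OF k, simplified]
  have cA: "Cod C c \<in> A" using kk by simp
  show ?thesis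
  proof (rule torsion_T_char[OF cA], rule perpI)
    fix f assume f: "f \<in> Arr C" "Dom C f \<in> {Cod C c}" "Cod C f \<in> F"
    have fA: "Cod C f \<in> A" using f td(2) by blast
    have "f \<bullet> c = Zer C (Cod C m) (Cod C f)"
      by (rule perpD[OF td(5)]) (use f kk assms in simp_all)
    then show "f = Zer C (Dom C f) (Cod C f)"
      by - (rule D.cokernel_cancel[OF k, simplified], use f kk fA cA torsion_A_Obj in simp_all)
  qed
qed

lemma torsion_F_subobject:
  assumes "short_exact (full_sub C A) k q" "Cod C k \<in> F" shows "Dom C k \<in> F"
proof -
  interpret D: abelian_category "full_sub C A" by (rule proper_abelianD(3)[OF pa])
  note td = torsion_pairsD[OF tors]
  have k: "is_kernel (full_sub C A) k q" using assms by (simp add: short_exact_def)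
  note kk = D.is_kernelD[OF k, simplified]
  have cA: "Dom C k \<in> A" using kk by simp
  show ?thesis
  proof (rule torsion_F_char[OF cA], rule perpI)
    fix f assume f: "f \<in> Arr C" "Dom C f \<in> T" "Cod C f \<in> {Dom C k}"
    have fA: "Dom C f \<in> A" using f td(1) by blast
    have "k \<bullet> f = Zer C (Dom C f) (Cod C k)"
      by (rule perpD[OF td(5)]) (use f kk assms in simp_all)
    then show "f = Zer C (Dom C f) (Cod C f)"
      by - (rule D.kernel_cancel[OF k, simplified], use f kk fA cA torsion_A_Obj in simp_all)
  qed
qed

lemma torsion_zero_obj:
  assumes z: "zero_obj C z" shows "z \<in> T" "z \<in> F"
proof -
  have zA: "z \<in> A" by (rule additive_subcategoryD(3)[OF proper_abelianD(1)[OF pa] z])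
  show "z \<in> T" by (rule torsion_T_char[OF zA]) (use z zero_obj_Dom in \<open>auto intro: perpI\<close>)
  show "z \<in> F" by (rule torsion_F_char[OF zA]) (use z zero_obj_Cod in \<open>auto intro: perpI\<close>)
qed

lemma torsion_cone:
  assumes "Y \<subseteq> A" "X \<subseteq> A" "e \<in> X \<star> sh Y"
  obtains k q m c where "short_exact (full_sub C A) k q" "short_exact (full_sub C A) m c"
    "Cod C k \<in> Y" "Cod C m \<in> X" "e \<in> sh {Dom C k} \<star> {Cod C c}" "Dom C k \<in> A" "Cod C c \<in> A"
proof -
  have "Y \<subseteq> Obj C" using assms torsion_A_Obj by blast
  then obtain f g h where t: "(f, g, h) \<in> Tri C" "Dom C f \<in> Y" "Cod C f \<in> X" "Cod C g = e"
    using ext_sh_rightE assms(3) by metis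
  then have "Dom C f \<in> A" "Cod C f \<in> A" using assms by auto
  then obtain k q m c where "short_exact (full_sub C A) k q" "short_exact (full_sub C A) m c"
    "Cod C k = Dom C f" "Cod C m = Cod C f" "Cod C g \<in> sh {Dom C k} \<star> {Cod C c}"
    using proper_abelian_cone[OF pa t(1)] by blast
  then show ?thesis using that t proper_abelianD(4)[OF pa] by metis
qed

text \<open>The cone of an arrow between objects of \<open>F\<close> has its kernel in
  \<open>F\<close>, as a subobject, but its cokernel is controlled only by \<open>A\<close>; dually
  for \<open>T\<close> below. The loss is repaired in the tilted category by decomposing
  \<open>A\<close> again.\<close>

lemma torsion_FF: "F \<star> sh F \<subseteq> sh F \<star> A"
proof
  fix e assume "e \<in> F \<star> sh F"
  then obtain k q m c where a: "short_exact (full_sub C A) k q" "Cod C k \<in> F"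
    "e \<in> sh {Dom C k} \<star> {Cod C c}" "Cod C c \<in> A"
    using torsion_cone torsion_pairsD(2)[OF tors] by metis
  have "sh {Dom C k} \<star> {Cod C c} \<subseteq> sh F \<star> A"
    by (intro ext_mono sh_mono) (use a torsion_F_subobject in auto)
  then show "e \<in> sh F \<star> A" using a by blast
qed

lemma torsion_TT: "T \<star> sh T \<subseteq> sh A \<star> T"
proof
  fix e assume "e \<in> T \<star> sh T"
  then obtain k q m c where a: "short_exact (full_sub C A) m c" "Cod C m \<in> T"
    "e \<in> sh {Dom C k} \<star> {Cod C c}" "Dom C k \<in> A"
    using torsion_cone torsion_pairsD(1)[OF tors] by metis
  have "sh {Dom C k} \<star> {Cod C c} \<subseteq> sh A \<star> T"
    by (intro ext_mono sh_mono) (use a torsion_T_quotient in auto)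
  then show "e \<in> sh A \<star> T" using a by blast
qed

text \<open>For an arrow from \<open>F\<close> to \<open>T\<close> nothing is lost: the kernel is a
  subobject of an object of \<open>F\<close> and the cokernel a quotient of one of
  \<open>T\<close>.\<close>

lemma torsion_TF: "T \<star> sh F \<subseteq> sh F \<star> T"
proof
  fix e assume "e \<in> T \<star> sh F"
  then obtain k q m c where a: "short_exact (full_sub C A) k q" "Cod C k \<in> F"
    "short_exact (full_sub C A) m c" "Cod C m \<in> T" "e \<in> sh {Dom C k} \<star> {Cod C c}"
    using torsion_cone torsion_pairsD(1,2)[OF tors] by metis
  have "sh {Dom C k} \<star> {Cod C c} \<subseteq> sh F \<star> T"
    by (intro ext_mono sh_mono) (use a torsion_F_subobject torsion_T_quotient in auto)
  then show "e \<in> sh F \<star> T" using a by blast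
qed

lemma torsion_ext_closed: "T \<star> T \<subseteq> T" "F \<star> F \<subseteq> F"
proof -
  note td = torsion_pairsD[OF tors] and ext = proper_abelianD(2)[OF pa]
  have FO: "F \<subseteq> Obj C" using td(2) torsion_A_Obj by blast
  show "T \<star> T \<subseteq> T"
  proof
    fix e assume e: "e \<in> T \<star> T"
    have "perp C (T \<star> T) F" by (rule perp_ext_left[OF td(5,5) FO])
    then have "perp C {e} F" using e by (auto simp: perp_def)
    moreover have "e \<in> A" using e ext ext_mono[OF td(1,1)] by blast
    ultimately show "e \<in> T" using torsion_T_char by blast
  qed
  show "F \<star> F \<subseteq> F"
  proof
    fix e assume e: "e \<in> F \<star> F"
    have "perp C T (F \<star> F)" by (rule perp_ext_right[OF td(5,5)])
    then have "perp C T {e}" using e by (auto simp: perp_def)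
    moreover have "e \<in> A" using e ext ext_mono[OF td(2,2)] by blast
    ultimately show "e \<in> F" using torsion_F_char by blast
  qed
qed

end

end

section \<open>Tilting\<close>

text \<open>Any positive lower bound would do for the truncated subtraction: at \<open>n = 0\<close>
  the left side would hold for \<open>k = 0\<close> and the right side fail. For infinite
  \<open>n\<close> both sides hold.\<close>

lemma enat_le_diff_one: "4 \<le> (n :: enat) \<Longrightarrow> enat k \<le> n - 1 \<longleftrightarrow> enat (Suc k) \<le> n"
  by (cases n) (auto simp: one_enat_def numeral_eq_enat)

context triangulated_category
begin

lemma funpow_sh_mono: "X \<subseteq> Y \<Longrightarrow> (sh ^^ k) X \<subseteq> (sh ^^ k) Y"
  by (induction k) (simp_all add: sh_mono)

lemma funpow_sh_ext:
  "X \<subseteq> Obj C \<Longrightarrow> Y \<subseteq> Obj C \<Longrightarrow> (sh ^^ k) (X \<star> Y) = (sh ^^ k) X \<star> (sh ^^ k) Y"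
  by (induction k) (simp_all add: sh_ext funpow_sh_Obj)

lemma perp_sh_shift_minus1:
  assumes p: "perp C (sh X) Y" and X: "X \<subseteq> Obj C" and I: "iso_closed C Y"
  shows "perp C X (shift C (- 1) Y)"
  unfolding perp_pointwise[of C X]
proof (intro ballI)
  fix x y assume x: "x \<in> X" and "y \<in> shift C (- 1) Y"
  then have y: "y \<in> Obj C" "SigO C y \<in> Y" using mem_shift_minus1[OF I] by auto
  have xO: "x \<in> Obj C" using x X by blast
  have "perp C {SigO C x} {SigO C y}"
    using p y(2) SigO_mem_sh[OF x xO] by (auto simp: perp_def)
  then show "perp C {x} {y}" using perp_SigO xO y(1) by blast
qed

lemma sh_shift_minus1: "iso_closed C X \<Longrightarrow> sh (shift C (- 1) X) \<subseteq> X"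
proof
  fix c assume X: "iso_closed C X" and "c \<in> sh (shift C (- 1) X)"
  then obtain y where y: "SigO C y \<in> X" "isomorphic C c (SigO C y)"
    using mem_shift_minus1[OF X] by (auto simp: mem_sh)
  then show "c \<in> X"
    using X isomorphic_sym[OF y(2)] isomorphic_Obj[OF y(2)] unfolding iso_closed_def by blast
qed

lemma shift_minus1_sh:
  assumes "iso_closed C X" "X \<subseteq> Obj C" shows "shift C (- 1) (sh X) = X"
proof -
  have I: "iso_closed C (sh X)"
    unfolding iso_closed_def using sh_isomorphic by blast
  show ?thesis
    using mem_shift_minus1[OF I] SigO_mem_sh_iff[OF assms] assms(2) by blast
qed

text \<open>
  The symmetric form of the decomposition: it is used for \<open>(P, Q) = (A, B)\<close> and for
  \<open>(P, Q) = (B, \<Sigma>A)\<close>. For \<open>t \<rightarrow> a \<rightarrow> f\<close> with \<open>t \<in> Q\<close>, \<open>\<Sigma>f \<in> Q\<close>, the \<open>\<Sigma>P\<close>-part of \<open>t\<close> maps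
  trivially to \<open>a\<close>, hence factors through \<open>\<Sigma>\<^sup>-\<^sup>1f\<close> and vanishes; dually for \<open>f\<close>.
\<close>

lemma interval_decomposition:
  assumes P: "retract_closed C P" and Q: "Q \<subseteq> Obj C" "iso_closed C Q"
    and p1: "perp C (sh P) P" and p2: "perp C (sh (sh P)) P" and p3: "perp C (sh (sh (sh P))) P"
    and PQ: "P \<subseteq> Q \<star> shift C (- 1) Q" and QP: "Q \<subseteq> sh P \<star> P"
  shows "P \<subseteq> (P \<inter> Q) \<star> (P \<inter> shift C (- 1) Q)"
proof
  fix a assume a: "a \<in> P"
  have PO: "P \<subseteq> Obj C" using P by (simp add: retract_closed_def)
  obtain u v w where T: "(u, v, w) \<in> Tri C" "Dom C u \<in> Q" "Cod C u = a" "Cod C v \<in> shift C (- 1) Q"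
    using PQ a ext_prodE by blast
  note t = TriD[OF T(1), unfolded T(3)]
  have O: "a \<in> Obj C" "Dom C u \<in> Obj C" "Cod C v \<in> Obj C" using a PO t by auto
  have f: "SigO C (Cod C v) \<in> Q" using mem_shift_minus1[OF Q(2)] T(4) by blast
  note T1 = Tri_SigA[OF T(1)]
  \<comment> \<open>The test map lands in \<open>Q\<close>, known only through its two pieces in
    \<Sigma>P and P: against the first it takes degree two of \<open>P\<close>, against the second
    degree three.\<close>
  have p31: "perp C (sh (sh (sh P))) (sh P \<star> P)"
    by (rule perp_ext_right[OF perp_sh[OF p2 sh_Obj PO] p3])
  have "Dom C u \<in> P"
  proof -
    obtain m n l where S: "(m, n, l) \<in> Tri C" "Dom C m \<in> sh P" "Cod C m = Dom C u" "Cod C n \<in> P"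
      using QP T(2) ext_prodE by blast
    note s = TriD[OF S(1), unfolded S(3)]
    let ?x = "Dom C m"
    have x: "?x \<in> Obj C" using s by simp
    have um: "u \<bullet> m = Zer C ?x a"
      by (rule perpD[OF p1]) (use s t S T a in simp_all)
    have "SigA C u \<bullet> SigA C m = Zer C (SigO C ?x) (SigO C a)"
      using SigA_Cmp_simp[of m u] um s t S x O by simp
    then obtain r where r: "r \<in> Arr C" "Dom C r = SigO C ?x" "Cod C r = Cod C v" "w \<bullet> r = SigA C m"
      using Tri_lift3[OF T(1), of "SigA C m"] s t S T by auto
    have "SigA C r = Zer C (SigO C (SigO C ?x)) (SigO C (Cod C v))"
      by (rule perpD[OF p31]) (use r S f QP x in \<open>auto simp: SigO_mem_sh\<close>)
    then have "r = Zer C (SigO C ?x) (Cod C v)" by (rule SigA_eq_Zer) (use r in simp_all)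
    then have "SigA C m = w \<bullet> Zer C (SigO C ?x) (Cod C v)" using r by metis
    also have "\<dots> = Zer C (SigO C ?x) (SigO C (Dom C u))" using t x by simp
    finally have "m = Zer C ?x (Dom C u)" by (rule SigA_eq_Zer) (use s S in simp_all)
    then have "retract C (Dom C u) (Cod C n)" using Tri_first_Zer_retract[OF S(1)] S(3) by simp
    then show ?thesis using S(4) by (rule retract_closedD[OF P])
  qed
  moreover have "Cod C v \<in> P"
  proof -
    obtain m n l where S: "(m, n, l) \<in> Tri C" "Dom C m \<in> sh P" "Cod C m = SigO C (Cod C v)" "Cod C n \<in> P"
      using QP f ext_prodE by blast
    note s = TriD[OF S(1), unfolded S(3)]
    have "n \<bullet> SigA C v = Zer C (SigO C a) (Cod C n)"
      by (rule perpD[OF p1]) (use s t S a O in \<open>simp_all add: SigO_mem_sh\<close>)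
    then obtain r where r: "r \<in> Arr C" "Dom C r = SigO C (SigO C (Dom C u))" "Cod C r = Cod C n"
      "r \<bullet> Neg C (SigA C w) = n"
      using Tri_extend2[OF T1, of n] s t S T by auto
    have sQ: "sh (sh Q) \<subseteq> sh (sh (sh P)) \<star> sh (sh P)"
      using sh_mono[OF sh_mono[OF QP]] sh_ext[of "sh P" P] sh_ext[of "sh (sh P)" "sh P"] sh_Obj PO by simp
    have "perp C (sh (sh Q)) P"
      by (rule perp_mono[OF perp_ext_left[OF p3 p2 PO] sQ subset_refl])
    then have "r = Zer C (SigO C (SigO C (Dom C u))) (Cod C n)"
      by (rule perpD) (use r S T O in \<open>simp_all add: SigO_mem_sh\<close>)
    then have "n = Zer C (SigO C (SigO C (Dom C u))) (Cod C n) \<bullet> Neg C (SigA C w)" using r by metis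
    then have "n = Zer C (SigO C (Cod C v)) (Cod C n)" using t s O by simp
    then have "retract C (SigO C (Cod C v)) (Dom C m)" using Tri_second_Zer_retract[OF S(1)] S(3) by simp
    then have "SigO C (Cod C v) \<in> sh P" using S(2) by (rule retract_closedD[OF retract_closed_sh[OF P]])
    then show ?thesis
      using SigO_mem_sh_iff[OF retract_closed_iso_closed[OF P] PO O(3)] by blast
  qed
  ultimately show "a \<in> (P \<inter> Q) \<star> (P \<inter> shift C (- 1) Q)"
    by (intro ext_prodI[OF T(1)]) (use T in simp_all)
qed

context
  fixes A n
  assumes pa: "proper_abelian C A" and n: "4 \<le> n" and E: "E_cond C n A"
begin

lemma A_add: "additive_subcategory C A"
  by (rule proper_abelianD(1)[OF pa])

lemma A_sub: "A \<subseteq> Obj C"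
  by (rule additive_subcategoryD(1)[OF A_add])

lemma A_iso: "iso_closed C A"
  by (rule additive_subcategoryD(2)[OF A_add])

lemma A_perp: "1 \<le> k \<Longrightarrow> enat k \<le> n \<Longrightarrow> perp C ((sh ^^ k) A) A"
  using E E_cond_iff[OF A_sub A_iso] by blast

lemma A_perp_low:
  "perp C (sh A) A" "perp C (sh (sh A)) A" "perp C (sh (sh (sh A))) A"
proof -
  have "enat 1 \<le> n" "enat 2 \<le> n" "enat 3 \<le> n" using n by (cases n; simp add: numeral_eq_enat)+
  then show "perp C (sh A) A" "perp C (sh (sh A)) A" "perp C (sh (sh (sh A))) A"
    using A_perp[of 1] A_perp[of 2] A_perp[of 3] by (simp_all add: eval_nat_numeral)
qed

section \<open>From a torsion pair to the interval\<close>

context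
  fixes T F
  assumes tors: "(T, F) \<in> torsion_pairs (full_sub C A)"
begin

abbreviation (input) "tilt \<equiv> sh F \<star> T"

lemma TF_sub: "T \<subseteq> A" "F \<subseteq> A" "T \<subseteq> Obj C" "F \<subseteq> Obj C"
  using torsion_pairsD(1,2)[OF tors] A_sub by auto

lemma TF_zero:
  obtains z where "zero_obj C z" "z \<in> T" "z \<in> F" "z \<in> sh F"
proof -
  obtain z where z: "zero_obj C z" using ex_zero_obj by blast
  have "z \<in> T" "z \<in> F" using torsion_zero_obj[OF pa tors z] by blast+
  moreover have "z \<in> sh F"
  proof -
    have zO: "z \<in> Obj C" using z by (simp add: zero_obj_iff)
    have "retract C z (SigO C z)" using z zO by (intro zero_obj_retract) simp_all
    moreover have "SigO C z \<in> sh F" using \<open>z \<in> F\<close> zO by (rule SigO_mem_sh)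
    ultimately show ?thesis
      by (rule retract_closedD[OF retract_closed_sh[OF torsion_F_retract[OF pa tors]]])
  qed
  ultimately show ?thesis using that z by blast
qed

lemma tilt_T: "T \<subseteq> tilt"
  by (rule TF_zero, rule ext_zero_left[OF TF_sub(3)])

lemma tilt_shF: "sh F \<subseteq> tilt"
  by (rule TF_zero, rule ext_zero_right[OF sh_Obj])

text \<open>The two orthogonalities asked for by \<open>retract_closed_ext\<close> are degrees one
  and two over \<open>A\<close>, and an idempotent of an object of \<open>T\<close> is an arrow of
  the abelian category \<open>A\<close>.\<close>

lemma tilt_retract: "retract_closed C tilt"
proof (rule retract_closed_ext)
  interpret D: abelian_category "full_sub C A" by (rule proper_abelianD(3)[OF pa])
  show "retract_closed C (sh F)" by (rule retract_closed_sh[OF torsion_F_retract[OF pa tors]])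
  show "retract_closed C T" by (rule torsion_T_retract[OF pa tors])
  show "perp C (sh F) T" by (rule perp_mono[OF A_perp_low(1) sh_mono]) (rule TF_sub)+
  show "perp C (sh (sh F)) T" by (rule perp_mono[OF A_perp_low(2) sh_mono[OF sh_mono]]) (rule TF_sub)+
  fix b assume b: "b \<in> Arr C" "Dom C b \<in> T" "Cod C b = Dom C b" "b \<bullet> b = b"
  have "b \<in> Arr (full_sub C A)" using b TF_sub by auto
  then obtain i p where "i \<in> Arr (full_sub C A)" "p \<in> Arr (full_sub C A)" "Cod C i = Dom C b"
    "Dom C p = Dom C b" "Cod C p = Dom C i" "p \<bullet> i = Idt C (Dom C i)" "i \<bullet> p = b"
    using D.idempotent_split[of b] b by (auto simp: b)
  then show "\<exists>i p. i \<in> Arr C \<and> p \<in> Arr C \<and> Cod C i = Dom C b \<and> Dom C p = Dom C b \<and>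
      Cod C p = Dom C i \<and> p \<bullet> i = Idt C (Dom C i) \<and> i \<bullet> p = b"
    by auto
qed

lemma tilt_iso: "iso_closed C tilt"
  by (rule retract_closed_iso_closed[OF tilt_retract])

text \<open>Only the two inner factors are out of order; \<open>torsion_TF\<close> exchanges T *
  \<Sigma>F for \<Sigma>F * T, after which \<open>F\<close> and \<open>T\<close> absorb their own
  extensions.\<close>

lemma tilt_ext: "tilt \<star> tilt \<subseteq> tilt"
proof -
  note O = TF_sub(3,4) sh_Obj ext_Obj
  have "tilt \<star> tilt = sh F \<star> ((T \<star> sh F) \<star> T)" by (simp add: ext_assoc O)
  also have "\<dots> \<subseteq> sh F \<star> ((sh F \<star> T) \<star> T)"
    by (intro ext_mono torsion_TF[OF pa tors] subset_refl)
  also have "\<dots> = sh (F \<star> F) \<star> (T \<star> T)" by (simp add: ext_assoc sh_ext O)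
  also have "\<dots> \<subseteq> sh F \<star> T"
    by (intro ext_mono sh_mono torsion_ext_closed[OF pa tors])
  finally show ?thesis .
qed

lemma tilt_admissible: "tilt \<star> sh tilt \<subseteq> sh tilt \<star> tilt"
proof -
  note O = TF_sub(3,4) A_sub sh_Obj ext_Obj
  \<comment> \<open>Arrows from \<Sigma>F to \<open>T\<close> vanish, so the triangles defining T *
    \<Sigma>^2 F split and the factors may be exchanged.\<close>
  have comm: "T \<star> sh (sh F) \<subseteq> sh (sh F) \<star> T"
    by (rule ext_sh_commute[OF perp_mono[OF A_perp_low(1) sh_mono] sh_Obj]) (rule TF_sub)+
  have "tilt \<star> sh tilt = sh F \<star> ((T \<star> sh (sh F)) \<star> sh T)" by (simp add: ext_assoc sh_ext O)
  also have "\<dots> \<subseteq> sh F \<star> ((sh (sh F) \<star> T) \<star> sh T)"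
    by (intro ext_mono comm subset_refl)
  also have "\<dots> = sh (F \<star> sh F) \<star> (T \<star> sh T)" by (simp add: ext_assoc sh_ext O)
  also have "\<dots> \<subseteq> sh (sh F \<star> A) \<star> (sh A \<star> T)"
    by (intro ext_mono sh_mono torsion_FF[OF pa tors] torsion_TT[OF pa tors])
  also have "\<dots> = sh (sh F) \<star> (sh (A \<star> A) \<star> T)" by (simp add: ext_assoc sh_ext O)
  also have "\<dots> \<subseteq> sh (sh F) \<star> (sh A \<star> T)"
    by (intro ext_mono sh_mono proper_abelianD(2)[OF pa] subset_refl)
  \<comment> \<open>The middle factor \<Sigma>A is cut into \<Sigma>T * \<Sigma>F, so that its
    halves complete \<Sigma>^2 F on the left and \<open>T\<close> on the right.\<close>
  also have "\<dots> \<subseteq> sh (sh F) \<star> (sh (T \<star> F) \<star> T)"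
    by (intro ext_mono sh_mono torsion_subset_ext[OF pa tors] subset_refl)
  also have "\<dots> = sh tilt \<star> tilt" by (simp add: ext_assoc sh_ext O)
  finally show ?thesis .
qed

text \<open>Both arguments are extensions, so four pairs of pieces are tested. From \<Sigma>F to
  \<open>T\<close> the degree is k + 1, which accounts for \<open>Suc k\<close>; from
  \<open>T\<close> to \<Sigma>F it drops to k - 1.\<close>

lemma tilt_perp:
  assumes k: "1 \<le> k" "enat (Suc k) \<le> n" shows "perp C ((sh ^^ k) tilt) tilt"
proof -
  have k': "enat k \<le> n" using k(2) by (rule order_trans[rotated]) simp
  have AA: "perp C ((sh ^^ j) X) Y" if "1 \<le> j" "enat j \<le> n" "X \<subseteq> A" "Y \<subseteq> A" for j X Y
    by (rule perp_mono[OF A_perp[OF that(1,2)] funpow_sh_mono[OF that(3)] that(4)])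
  have "perp C ((sh ^^ k) (sh F)) (sh F)"
    using perp_sh[OF AA[OF k(1) k' TF_sub(2,2)] funpow_sh_Obj[OF TF_sub(4)] TF_sub(4)]
    by (simp add: funpow_swap1)
  moreover have "perp C ((sh ^^ k) (sh F)) T"
    using AA[of "Suc k" F T] k TF_sub by (simp add: funpow_swap1)
  moreover have "perp C ((sh ^^ k) T) (sh F)"
  proof -
    obtain j where j: "k = Suc j" using k(1) by (cases k) auto
    have "perp C ((sh ^^ j) T) F"
    \<comment> \<open>In degree zero E_n says nothing about \<open>A\<close>; the vanishing is that
      of the torsion pair itself.\<close>
    proof (cases "j = 0")
      case True
      then show ?thesis using torsion_pairsD(5)[OF tors] by simp
    next
      case False
      have "enat j \<le> n" using k' j by (auto intro: order_trans[rotated])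
      then show ?thesis using AA[of j T F] False TF_sub by simp
    qed
    then show ?thesis
      using perp_sh[OF _ funpow_sh_Obj[OF TF_sub(3)] TF_sub(4)] j by simp
  qed
  moreover have "perp C ((sh ^^ k) T) T"
    using AA[of k T T] k k' TF_sub by simp
  ultimately show ?thesis
    unfolding funpow_sh_ext[OF sh_Obj TF_sub(3)]
    by (intro perp_ext_left perp_ext_right ext_Obj)
qed

lemma tilt_E_interval: "tilt \<in> E_interval C (n - 1) A"
proof -
  note O = TF_sub(3,4) A_sub sh_Obj ext_Obj
  have "enat (Suc 1) \<le> n" "enat (Suc 2) \<le> n" using n by (cases n; simp add: numeral_eq_enat)+
  then have p: "perp C (sh tilt) tilt" "perp C (sh (sh tilt)) tilt"
    using tilt_perp[of 1] tilt_perp[of 2] by (simp_all add: eval_nat_numeral)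
  obtain z where z: "zero_obj C z" "z \<in> T" by (rule TF_zero)
  have "additive_subcategory C tilt"
    by (rule additive_subcategoryI[OF tilt_retract tilt_ext z(1)]) (use z tilt_T in blast)
  then have "proper_abelian C tilt"
    using tilt_ext p tilt_admissible by (rule proper_abelianI)
  moreover have "E_cond C (n - 1) tilt"
    unfolding E_cond_iff[OF ext_Obj tilt_iso] enat_le_diff_one[OF n] using tilt_perp by blast
  moreover have "A \<subseteq> tilt \<star> shift C (- 1) tilt"
  proof -
    have "F \<subseteq> shift C (- 1) tilt"
      using mem_shift_minus1[OF tilt_iso] TF_sub(4) SigO_mem_sh[of _ F] tilt_shF by blast
    then have "T \<star> F \<subseteq> tilt \<star> shift C (- 1) tilt" by (intro ext_mono tilt_T)
    then show ?thesis using torsion_subset_ext[OF pa tors] by blast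
  qed
  moreover have "tilt \<subseteq> sh A \<star> A" by (intro ext_mono sh_mono TF_sub)
  ultimately show ?thesis by (simp add: E_interval_def)
qed

text \<open>For an object of \<open>A\<close> in the tilt, the arrow from its \<Sigma>F-part is zero
  by the first negative degree, so the object is a retract of its \<open>T\<close>-part.\<close>

lemma tilt_Int_T: "A \<inter> tilt = T"
proof
  show "T \<subseteq> A \<inter> tilt" using TF_sub(1) tilt_T by blast
  show "A \<inter> tilt \<subseteq> T"
  proof
    fix a assume a: "a \<in> A \<inter> tilt"
    then obtain f g h where t: "(f, g, h) \<in> Tri C" "Dom C f \<in> sh F" "Cod C f = a" "Cod C g \<in> T"
      using ext_prodE by blast
    have "f = Zer C (Dom C f) (Cod C f)"
      by (rule perpD[OF A_perp_low(1)])
        (use t a TriD[OF t(1)] sh_mono[OF TF_sub(2)] in auto)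
    then have "retract C a (Cod C g)" using Tri_first_Zer_retract[OF t(1)] t by simp
    then show "a \<in> T" using t(4) by (rule retract_closedD[OF torsion_T_retract[OF pa tors]])
  qed
qed

text \<open>After suspension the arrow to the \<open>T\<close>-part goes from \<Sigma>A to
  \<open>A\<close>, hence vanishes, and a retract of the \<Sigma>F-part remains.\<close>

lemma tilt_Int_F: "A \<inter> shift C (- 1) tilt = F"
proof
  show "F \<subseteq> A \<inter> shift C (- 1) tilt"
    using mem_shift_minus1[OF tilt_iso] TF_sub(2,4) SigO_mem_sh[of _ F] tilt_shF by blast
  show "A \<inter> shift C (- 1) tilt \<subseteq> F"
  proof
    fix a assume "a \<in> A \<inter> shift C (- 1) tilt"
    then have a: "a \<in> A" "a \<in> Obj C" "SigO C a \<in> tilt" using mem_shift_minus1[OF tilt_iso] by auto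
    obtain f g h where t: "(f, g, h) \<in> Tri C" "Dom C f \<in> sh F" "Cod C f = SigO C a" "Cod C g \<in> T"
      using a(3) ext_prodE by blast
    have "g = Zer C (Cod C f) (Cod C g)"
      by (rule perpD[OF A_perp_low(1)])
        (use t a TriD[OF t(1)] SigO_mem_sh[of a A] TF_sub(1) in auto)
    then have "retract C (SigO C a) (Dom C f)" using Tri_second_Zer_retract[OF t(1)] t by simp
    then have "SigO C a \<in> sh F"
      using t(2) by (rule retract_closedD[OF retract_closed_sh[OF torsion_F_retract[OF pa tors]]])
    then show "a \<in> F"
      using SigO_mem_sh_iff[OF retract_closed_iso_closed[OF torsion_F_retract[OF pa tors]] TF_sub(4) a(2)]
      by blast
  qed
qed

end

text \<open>A larger torsion-free class has a smaller torsion class. Each half decomposes the piece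
  that is too large, \<open>T'\<close> or \<Sigma>F, through the other torsion pair and regroups by
  associativity.\<close>

lemma tilt_mono:
  assumes tors': "(T', F') \<in> torsion_pairs (full_sub C A)" and tors: "(T, F) \<in> torsion_pairs (full_sub C A)"
    and FF: "F' \<subseteq> F"
  shows "interval_le C (sh F' \<star> T') (sh F \<star> T)"
proof -
  note O = TF_sub(3,4)[OF tors] TF_sub(3,4)[OF tors'] A_sub sh_Obj ext_Obj
  have TT: "T \<subseteq> T'"
  proof
    fix t assume t: "t \<in> T"
    have "perp C {t} F'" by (rule perp_mono[OF torsion_pairsD(5)[OF tors]]) (use t FF in auto)
    then show "t \<in> T'" using torsion_T_char[OF pa tors'] t TF_sub(1)[OF tors] by blast
  qed
  have "sh F' \<star> T' \<subseteq> sh F \<star> (T \<star> F)"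
    using TF_sub(1)[OF tors'] torsion_subset_ext[OF pa tors]
    by (intro ext_mono sh_mono FF) blast
  also have "\<dots> = (sh F \<star> T) \<star> F" by (simp add: ext_assoc O)
  also have "\<dots> \<subseteq> (sh F \<star> T) \<star> shift C (- 1) (sh F \<star> T)"
    using tilt_Int_F[OF tors] by (intro ext_mono) auto
  finally have 1: "sh F' \<star> T' \<subseteq> (sh F \<star> T) \<star> shift C (- 1) (sh F \<star> T)" .
  have "sh F \<star> T \<subseteq> sh (T' \<star> F') \<star> T'"
    using TF_sub(2)[OF tors] torsion_subset_ext[OF pa tors']
    by (intro ext_mono sh_mono TT) blast
  also have "\<dots> = sh T' \<star> (sh F' \<star> T')" by (simp add: ext_assoc sh_ext O)
  also have "\<dots> \<subseteq> sh (sh F' \<star> T') \<star> (sh F' \<star> T')"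
    by (intro ext_mono sh_mono tilt_T[OF tors'] subset_refl)
  finally show ?thesis using 1 by (simp add: interval_le_def)
qed

section \<open>From the interval to a torsion pair\<close>

context
  fixes B
  assumes B: "B \<in> E_interval C (n - 1) A"
begin

lemma B_proper: "proper_abelian C B" and B_AB: "A \<subseteq> B \<star> shift C (- 1) B" and B_BA: "B \<subseteq> sh A \<star> A"
  using B by (auto simp: E_interval_def)

lemma B_add: "additive_subcategory C B"
  by (rule proper_abelianD(1)[OF B_proper])

lemma B_sub: "B \<subseteq> Obj C"
  by (rule additive_subcategoryD(1)[OF B_add])

lemma B_iso: "iso_closed C B"
  by (rule additive_subcategoryD(2)[OF B_add])

lemma B_perp: "perp C (sh B) B" "perp C (sh (sh B)) B" "perp C (sh (sh (sh B))) B"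
proof -
  have "E_cond C (n - 1) B" using B by (simp add: E_interval_def)
  then have p: "perp C ((sh ^^ k) B) B" if "1 \<le> k" "enat (Suc k) \<le> n" for k
    using that unfolding E_cond_iff[OF B_sub B_iso] enat_le_diff_one[OF n] by blast
  have "enat (Suc 1) \<le> n" "enat (Suc 2) \<le> n" "enat (Suc 3) \<le> n"
    using n by (cases n; simp add: numeral_eq_enat)+
  then show "perp C (sh B) B" "perp C (sh (sh B)) B" "perp C (sh (sh (sh B))) B"
    using p[of 1] p[of 2] p[of 3] by (simp_all add: eval_nat_numeral)
qed

text \<open>Orthogonality is the first negative degree of \<open>B\<close>, desuspended; the two
  inclusions defining the interval are exactly what the decomposition of \<open>A\<close> along
  \<open>B\<close> asks for.\<close>

lemma interval_torsion_pair: "(A \<inter> B, A \<inter> shift C (- 1) B) \<in> torsion_pairs (full_sub C A)"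
proof (rule torsion_pairsI[OF _ _ _ _ _ _ pa])
  show "iso_closed C (A \<inter> B)" using A_iso B_iso by (auto simp: iso_closed_def)
  have "iso_closed C (shift C (- 1) B)"
    unfolding iso_closed_def
  proof (intro ballI impI)
    fix x y assume "x \<in> shift C (- 1) B" "y \<in> Obj C" "isomorphic C x y"
    then show "y \<in> shift C (- 1) B"
      using B_iso SigO_isomorphic[of x y] SigO_in[of y]
      unfolding iso_closed_def mem_shift_minus1[OF B_iso] by blast
  qed
  then show "iso_closed C (A \<inter> shift C (- 1) B)" using A_iso by (auto simp: iso_closed_def)
  show "perp C (A \<inter> B) (A \<inter> shift C (- 1) B)"
    by (rule perp_mono[OF perp_sh_shift_minus1[OF B_perp(1) B_sub B_iso]]) auto
  show "A \<subseteq> (A \<inter> B) \<star> (A \<inter> shift C (- 1) B)"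
    by (rule interval_decomposition[OF additive_subcategory_retract_closed[OF A_add] B_sub B_iso
          A_perp_low B_AB B_BA])
qed auto

lemma interval_tilt: "sh (A \<inter> shift C (- 1) B) \<star> (A \<inter> B) = B"
proof
  have "sh (A \<inter> shift C (- 1) B) \<subseteq> B"
    using sh_mono[of "A \<inter> shift C (- 1) B" "shift C (- 1) B"] sh_shift_minus1[OF B_iso] by auto
  then have "sh (A \<inter> shift C (- 1) B) \<star> (A \<inter> B) \<subseteq> B \<star> B" by (intro ext_mono) auto
  then show "sh (A \<inter> shift C (- 1) B) \<star> (A \<inter> B) \<subseteq> B" using proper_abelianD(2)[OF B_proper] by blast
  have dA: "shift C (- 1) (sh A) = A" by (rule shift_minus1_sh[OF A_iso A_sub])
  \<comment> \<open>Suspending A \<subseteq> B * \<Sigma>^-1 B brings it into the form needed to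
    decompose again, now with \<open>B\<close> in the role of \<open>A\<close> and \<Sigma>A in the
    role of \<open>B\<close>.\<close>
  have "sh A \<subseteq> sh B \<star> sh (shift C (- 1) B)"
    using sh_mono[OF B_AB] sh_ext[OF B_sub, of "shift C (- 1) B"] by (auto simp: shift_def)
  also have "\<dots> \<subseteq> sh B \<star> B" by (intro ext_mono subset_refl sh_shift_minus1[OF B_iso])
  finally have AB: "sh A \<subseteq> sh B \<star> B" .
  have I: "iso_closed C (sh A)" unfolding iso_closed_def using sh_isomorphic by blast
  have "B \<subseteq> (B \<inter> sh A) \<star> (B \<inter> shift C (- 1) (sh A))"
    by (rule interval_decomposition[OF additive_subcategory_retract_closed[OF B_add] sh_Obj I B_perp _ AB])
      (use B_BA dA in simp)
  moreover have "B \<inter> sh A \<subseteq> sh (A \<inter> shift C (- 1) B)"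
  proof
    fix c assume "c \<in> B \<inter> sh A"
    then obtain a where a: "c \<in> B" "a \<in> A" "isomorphic C c (SigO C a)" by (auto simp: mem_sh)
    then have "SigO C a \<in> B" using B_iso isomorphic_Obj[OF a(3)] unfolding iso_closed_def by blast
    then have "a \<in> shift C (- 1) B" using mem_shift_minus1[OF B_iso] a A_sub by blast
    then show "c \<in> sh (A \<inter> shift C (- 1) B)" using a by (auto simp: mem_sh)
  qed
  ultimately show "B \<subseteq> sh (A \<inter> shift C (- 1) B) \<star> (A \<inter> B)"
    using ext_mono[of "B \<inter> sh A" "sh (A \<inter> shift C (- 1) B)" "B \<inter> A" "A \<inter> B"] dA by auto
qed

end

text \<open>An object of \<Sigma>^-1 B' receives no nonzero arrow from B' or \<Sigma>B', hence none
  from \<open>B\<close>, whose objects are extensions of these. If it lies in \<open>A\<close>, it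
  is right orthogonal to the torsion class of \<open>B\<close>, which characterises the torsion-free
  class.\<close>

lemma interval_torsion_mono:
  assumes B': "B' \<in> E_interval C (n - 1) A" and B: "B \<in> E_interval C (n - 1) A"
    and le: "interval_le C B' B"
  shows "A \<inter> shift C (- 1) B' \<subseteq> A \<inter> shift C (- 1) B"
proof
  fix a assume a: "a \<in> A \<inter> shift C (- 1) B'"
  note b = B_sub[OF B'] B_iso[OF B'] B_perp[OF B']
  have d: "shift C (- 1) B' \<subseteq> Obj C" by (auto simp: shift_def)
  have "perp C (sh B' \<star> B') (shift C (- 1) B')"
    using perp_sh_shift_minus1[OF b(4) sh_Obj b(2)] perp_sh_shift_minus1[OF b(3,1,2)] d
    by (rule perp_ext_left)
  then have "perp C (A \<inter> B) {a}"
    by (rule perp_mono) (use le a in \<open>auto simp: interval_le_def\<close>)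
  then show "a \<in> A \<inter> shift C (- 1) B"
    using torsion_F_char[OF pa interval_torsion_pair[OF B]] a by blast
qed

text \<open>\<open>tors_le\<close> compares torsion-free classes only; it is antisymmetric because
  the torsion class is the left orthogonal of \<open>F\<close> in \<open>A\<close>.\<close>

lemma torsion_pair_determined:
  assumes tors': "(T', F) \<in> torsion_pairs (full_sub C A)" and tors: "(T, F) \<in> torsion_pairs (full_sub C A)"
  shows "T' = T"
proof -
  have "X \<subseteq> Y" if X: "(X, F) \<in> torsion_pairs (full_sub C A)" and Y: "(Y, F) \<in> torsion_pairs (full_sub C A)"
    for X Y
  proof
    fix t assume t: "t \<in> X"
    have "perp C {t} F" using torsion_pairsD(5)[OF X] t by (auto simp: perp_def)
    then show "t \<in> Y" using torsion_T_char[OF pa Y] t TF_sub(1)[OF X] by blast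
  qed
  then show ?thesis using assms by blast
qed

end

end

theorem theorem2:
  fixes C :: "('o, 'm) tricat" and A :: "'o set" and n :: enat
  assumes "triangulated_category C"
    and "krull_schmidt_category C"
    and "proper_abelian C A"
    and "4 \<le> n"
    and "E_cond C n A"
  shows "let Tors = torsion_pairs (full_sub C A);
             Itv = E_interval C (n - 1) A;
             \<Phi> = (\<lambda>(T, F). ext_prod C (shift C 1 F) T);
             \<Psi> = (\<lambda>B. (A \<inter> B, A \<inter> shift C (- 1) B))
         in partial_order_on Tors {(p', p). p' \<in> Tors \<and> p \<in> Tors \<and> tors_le p' p} \<and>
            partial_order_on Itv {(B', B). B' \<in> Itv \<and> B \<in> Itv \<and> interval_le C B' B} \<and>
            bij_betw \<Phi> Tors Itv \<and>
            bij_betw \<Psi> Itv Tors \<and>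
            (\<forall>p \<in> Tors. \<Psi> (\<Phi> p) = p) \<and>
            (\<forall>B \<in> Itv. \<Phi> (\<Psi> B) = B) \<and>
            monotone_on Tors tors_le (interval_le C) \<Phi> \<and>
            monotone_on Itv (interval_le C) tors_le \<Psi>"
proof -
  interpret triangulated_category C by (rule assms(1))
  define Tors where "Tors = torsion_pairs (full_sub C A)"
  define Itv where "Itv = E_interval C (n - 1) A"
  define \<Phi> where "\<Phi> = (\<lambda>(T, F). ext_prod C (shift C 1 F) T)"
  define \<Psi> where "\<Psi> = (\<lambda>B. (A \<inter> B, A \<inter> shift C (- 1) B))"
  note hyps = assms(3-5)
  have \<Phi>: "\<Phi> p \<in> Itv" "\<Psi> (\<Phi> p) = p" if "p \<in> Tors" for p
    using that tilt_E_interval[OF hyps] tilt_Int_T[OF hyps] tilt_Int_F[OF hyps]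
    by (cases p; simp add: Tors_def Itv_def \<Phi>_def \<Psi>_def)+
  have \<Psi>: "\<Psi> B \<in> Tors" "\<Phi> (\<Psi> B) = B" if "B \<in> Itv" for B
    using that interval_torsion_pair[OF hyps] interval_tilt[OF hyps]
    by (simp_all add: Tors_def Itv_def \<Phi>_def \<Psi>_def)
  have \<Phi>_mono: "interval_le C (\<Phi> p') (\<Phi> p)" if "p' \<in> Tors" "p \<in> Tors" "tors_le p' p" for p' p
    using that tilt_mono[OF hyps] by (cases p'; cases p; simp add: Tors_def \<Phi>_def tors_le_def)
  have \<Psi>_mono: "tors_le (\<Psi> B') (\<Psi> B)" if "B' \<in> Itv" "B \<in> Itv" "interval_le C B' B" for B' B
    using that interval_torsion_mono[OF hyps] by (simp add: Itv_def \<Psi>_def tors_le_def)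
  \<comment> \<open>Transitivity of \<open>interval_le\<close> is not visible from its definition;
    through \<open>\<Psi>\<close> it becomes that of inclusion.\<close>
  have le_iff: "interval_le C B' B \<longleftrightarrow> tors_le (\<Psi> B') (\<Psi> B)" if "B' \<in> Itv" "B \<in> Itv" for B' B
    using that \<Psi>_mono \<Phi>_mono \<Psi> by metis
  have tors_antisym: "p' = p" if "p' \<in> Tors" "p \<in> Tors" "tors_le p' p" "tors_le p p'" for p' p
  proof (rule prod_eqI)
    show snd: "snd p' = snd p" using that(3,4) by (auto simp: tors_le_def)
    \<comment> \<open>Both pairs are rewritten with a common second component, the form in which the
      torsion class is determined.\<close>
    have "(fst p', snd p) \<in> Tors" "(fst p, snd p) \<in> Tors"
      using that(1,2) by (simp_all flip: snd) (simp add: snd)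
    then show "fst p' = fst p"
      unfolding Tors_def by (rule torsion_pair_determined[OF hyps])
  qed
  have "partial_order_on Tors {(p', p). p' \<in> Tors \<and> p \<in> Tors \<and> tors_le p' p}"
    unfolding partial_order_on_def preorder_on_def
  proof (intro conjI)
    show "antisym {(p', p). p' \<in> Tors \<and> p \<in> Tors \<and> tors_le p' p}"
      by (rule antisymI) (use tors_antisym in blast)
  qed (auto intro!: refl_onI transI simp: tors_le_def)
  moreover have "partial_order_on Itv {(B', B). B' \<in> Itv \<and> B \<in> Itv \<and> interval_le C B' B}"
    unfolding partial_order_on_def preorder_on_def
  proof (intro conjI)
    show "antisym {(B', B). B' \<in> Itv \<and> B \<in> Itv \<and> interval_le C B' B}"
    proof (rule antisymI)
      fix B' B assume "(B', B) \<in> {(B', B). B' \<in> Itv \<and> B \<in> Itv \<and> interval_le C B' B}"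
        "(B, B') \<in> {(B', B). B' \<in> Itv \<and> B \<in> Itv \<and> interval_le C B' B}"
      then have b: "B' \<in> Itv" "B \<in> Itv" "tors_le (\<Psi> B') (\<Psi> B)" "tors_le (\<Psi> B) (\<Psi> B')"
        using \<Psi>_mono by auto
      have "\<Psi> B' = \<Psi> B" by (rule tors_antisym[OF \<Psi>(1)[OF b(1)] \<Psi>(1)[OF b(2)] b(3,4)])
      then show "B' = B" using \<Psi>(2) b(1,2) by metis
    qed
  qed (auto intro!: refl_onI transI simp: le_iff tors_le_def)
  moreover have "bij_betw \<Phi> Tors Itv"
    by (rule bij_betwI[where g = \<Psi>]) (use \<Phi> \<Psi> in auto)
  moreover have "bij_betw \<Psi> Itv Tors"
    by (rule bij_betwI[where g = \<Phi>]) (use \<Phi> \<Psi> in auto)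
  moreover have "monotone_on Tors tors_le (interval_le C) \<Phi>" "monotone_on Itv (interval_le C) tors_le \<Psi>"
    using \<Phi>_mono \<Psi>_mono by (simp_all add: monotone_on_def)
  ultimately show ?thesis
    unfolding Let_def using \<Phi>(2) \<Psi>(2) unfolding Tors_def Itv_def \<Phi>_def \<Psi>_def by blast
qed

end
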